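(* The entailment problem for QPL (given a finite set $\mathcal H$ of formulas and a formula $Q$, decide whether $\mathcal H\vdash Q$) is solvable in time $O(n^n)$, where $n$ is the total length of the formulas in $S=\mathcal H\cup\{Q\}$. In the case that the number of quantifications in $S$ is bounded, the QPL entailment problem is solvable in polynomial time.
   Context: Language: first-order, no equality, no function symbols of positive arity; terms are variables and constants; atomic formulas $\top,\bot,R(t_1,\dots,t_j)$; formulas (strings; length = number of symbol occurrences) built by $\land,\lor,\to,\forall x,\exists x$; $A(t)$ is substitution of substitutable $t$ for free $x$. QPL is the Hilbert-style calculus with rules (premises / conclusion): axioms $\top$ and $A\to A$; $A,B/A\land B$; $A\land B/A$, $A\land B/B$; $A/A\lor B$, $B/A\lor B$; $A\lor A/A$; $B/A\to B$; $A,A\to B/B$; $\bot/A$; $A/\forall xA$ ($x$ not free in $A$); $\forall xA(x)/A(t)$; $A(t)/\exists xA(x)$; $\exists xA/A$ ($x$ not free in $A$). $\mathcal H\vdash Q$ means there is a finite derivation tree of $Q$ whose leaves are axioms or members of $\mathcal H$. Time is measured in the standard computation model of the analysis of algorithms. *)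

theory Defs
  imports "HOL-Library.Landau_Symbols"
begin

section \<open>Formulas\<close>

text \<open>
  Variables, constants and relation symbols are indexed by natural numbers. A language fixes which
  constants and relation symbols are available and the arity of each relation symbol; there is
  always a countably infinite supply of variables.
\<close>

record lang =
  csyms :: "nat set"
  rsyms :: "nat set"
  arity :: "nat \<Rightarrow> nat"

datatype trm = Var nat | Cst nat

datatype fm =
    Top
  | Bot
  | Rel nat "trm list"
  | Conj fm fm
  | Disj fm fm
  | Imp fm fm
  | All nat fm
  | Ex nat fm

fun wf_trm :: "lang \<Rightarrow> trm \<Rightarrow> bool" where
  "wf_trm L (Var x) = True"
| "wf_trm L (Cst c) = (c \<in> csyms L)"

fun wf_fm :: "lang \<Rightarrow> fm \<Rightarrow> bool" where
  "wf_fm L Top = True"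
| "wf_fm L Bot = True"
| "wf_fm L (Rel R ts) = (R \<in> rsyms L \<and> length ts = arity L R \<and> (\<forall>t \<in> set ts. wf_trm L t))"
| "wf_fm L (Conj A B) = (wf_fm L A \<and> wf_fm L B)"
| "wf_fm L (Disj A B) = (wf_fm L A \<and> wf_fm L B)"
| "wf_fm L (Imp A B) = (wf_fm L A \<and> wf_fm L B)"
| "wf_fm L (All x A) = wf_fm L A"
| "wf_fm L (Ex x A) = wf_fm L A"

fun fv :: "fm \<Rightarrow> nat set" where
  "fv Top = {}"
| "fv Bot = {}"
| "fv (Rel R ts) = {x. Var x \<in> set ts}"
| "fv (Conj A B) = fv A \<union> fv B"
| "fv (Disj A B) = fv A \<union> fv B"
| "fv (Imp A B) = fv A \<union> fv B"
| "fv (All x A) = fv A - {x}"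
| "fv (Ex x A) = fv A - {x}"

text \<open>
  \<open>subst x t A\<close> replaces the free occurrences of \<open>x\<close> in \<open>A\<close> by \<open>t\<close>, with no renaming of bound
  variables (formulas are strings, not strings up to alpha-equivalence); it is only used when \<open>t\<close>
  is substitutable for \<open>x\<close> in \<open>A\<close>.
\<close>

fun subst :: "nat \<Rightarrow> trm \<Rightarrow> fm \<Rightarrow> fm" where
  "subst x t Top = Top"
| "subst x t Bot = Bot"
| "subst x t (Rel R ts) = Rel R (map (\<lambda>s. if s = Var x then t else s) ts)"
| "subst x t (Conj A B) = Conj (subst x t A) (subst x t B)"
| "subst x t (Disj A B) = Disj (subst x t A) (subst x t B)"
| "subst x t (Imp A B) = Imp (subst x t A) (subst x t B)"
| "subst x t (All y A) = (if y = x then All y A else All y (subst x t A))"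
| "subst x t (Ex y A) = (if y = x then Ex y A else Ex y (subst x t A))"

fun substitutable :: "trm \<Rightarrow> nat \<Rightarrow> fm \<Rightarrow> bool" where
  "substitutable t x Top = True"
| "substitutable t x Bot = True"
| "substitutable t x (Rel R ts) = True"
| "substitutable t x (Conj A B) = (substitutable t x A \<and> substitutable t x B)"
| "substitutable t x (Disj A B) = (substitutable t x A \<and> substitutable t x B)"
| "substitutable t x (Imp A B) = (substitutable t x A \<and> substitutable t x B)"
| "substitutable t x (All y A) = (x \<notin> fv (All y A) \<or> t \<noteq> Var y \<and> substitutable t x A)"
| "substitutable t x (Ex y A) = (x \<notin> fv (Ex y A) \<or> t \<noteq> Var y \<and> substitutable t x A)"


section \<open>The calculus QPL\<close>

text \<open>
  Provability by finite derivation trees over the language \<open>L\<close>. Well-formedness is required exactly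
  where a rule brings in new syntactic material, so all formulas in a derivation from \<open>L\<close>-formulas
  are \<open>L\<close>-formulas.
\<close>

inductive qpl :: "lang \<Rightarrow> fm set \<Rightarrow> fm \<Rightarrow> bool" for L :: lang and H :: "fm set" where
  hyp: "A \<in> H \<Longrightarrow> qpl L H A"
| top: "qpl L H Top"
| imp_refl: "wf_fm L A \<Longrightarrow> qpl L H (Imp A A)"
| conjI: "qpl L H A \<Longrightarrow> qpl L H B \<Longrightarrow> qpl L H (Conj A B)"
| conjE1: "qpl L H (Conj A B) \<Longrightarrow> qpl L H A"
| conjE2: "qpl L H (Conj A B) \<Longrightarrow> qpl L H B"
| disjI1: "qpl L H A \<Longrightarrow> wf_fm L B \<Longrightarrow> qpl L H (Disj A B)"
| disjI2: "qpl L H B \<Longrightarrow> wf_fm L A \<Longrightarrow> qpl L H (Disj A B)"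
| disjE: "qpl L H (Disj A A) \<Longrightarrow> qpl L H A"
| impI: "qpl L H B \<Longrightarrow> wf_fm L A \<Longrightarrow> qpl L H (Imp A B)"
| impE: "qpl L H A \<Longrightarrow> qpl L H (Imp A B) \<Longrightarrow> qpl L H B"
| botE: "qpl L H Bot \<Longrightarrow> wf_fm L A \<Longrightarrow> qpl L H A"
| allI: "qpl L H A \<Longrightarrow> x \<notin> fv A \<Longrightarrow> qpl L H (All x A)"
| allE: "qpl L H (All x A) \<Longrightarrow> wf_trm L t \<Longrightarrow> substitutable t x A \<Longrightarrow> qpl L H (subst x t A)"
| exI: "qpl L H (subst x t A) \<Longrightarrow> wf_trm L t \<Longrightarrow> substitutable t x A \<Longrightarrow> qpl L H (Ex x A)"
| exE: "qpl L H (Ex x A) \<Longrightarrow> x \<notin> fv A \<Longrightarrow> qpl L H A"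


section \<open>Formulas as strings, lengths, and problem instances\<close>

datatype symbol =
    TopS | BotS | ConjS | DisjS | ImpS | AllS | ExS | VarS nat | CstS nat | RelS nat | Comma

text \<open>
  Formulas are written in prefix notation, so that they contain no punctuation; this is uniquely
  readable because the argument list of a relation symbol ends at the first symbol that is not a
  term. As punctuation would only increase lengths, this is the least, hence for upper bounds the
  most demanding, way of counting symbol occurrences.
\<close>

fun trm_symbol :: "trm \<Rightarrow> symbol" where
  "trm_symbol (Var x) = VarS x"
| "trm_symbol (Cst c) = CstS c"

fun fm_string :: "fm \<Rightarrow> symbol list" where
  "fm_string Top = [TopS]"
| "fm_string Bot = [BotS]"
| "fm_string (Rel R ts) = RelS R # map trm_symbol ts"
| "fm_string (Conj A B) = ConjS # fm_string A @ fm_string B"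
| "fm_string (Disj A B) = DisjS # fm_string A @ fm_string B"
| "fm_string (Imp A B) = ImpS # fm_string A @ fm_string B"
| "fm_string (All x A) = AllS # VarS x # fm_string A"
| "fm_string (Ex x A) = ExS # VarS x # fm_string A"

definition fm_length :: "fm \<Rightarrow> nat" where
  "fm_length A = length (fm_string A)"

fun quantifications :: "fm \<Rightarrow> nat" where
  "quantifications Top = 0"
| "quantifications Bot = 0"
| "quantifications (Rel R ts) = 0"
| "quantifications (Conj A B) = quantifications A + quantifications B"
| "quantifications (Disj A B) = quantifications A + quantifications B"
| "quantifications (Imp A B) = quantifications A + quantifications B"
| "quantifications (All x A) = Suc (quantifications A)"
| "quantifications (Ex x A) = Suc (quantifications A)"

text \<open>
  A finite set of hypotheses is presented to an algorithm as a repetition-free list, in any order.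
\<close>

definition qpl_instance :: "lang \<Rightarrow> fm list \<Rightarrow> fm \<Rightarrow> bool" where
  "qpl_instance L hs Q \<longleftrightarrow> distinct hs \<and> (\<forall>A \<in> insert Q (set hs). wf_fm L A)"

definition total_length :: "fm list \<Rightarrow> fm \<Rightarrow> nat" where
  "total_length hs Q = (\<Sum>A \<in> insert Q (set hs). fm_length A)"

definition total_quantifications :: "fm list \<Rightarrow> fm \<Rightarrow> nat" where
  "total_quantifications hs Q = (\<Sum>A \<in> insert Q (set hs). quantifications A)"

definition instance_string :: "fm list \<Rightarrow> fm \<Rightarrow> symbol list" where
  "instance_string hs Q = concat (map (\<lambda>A. fm_string A @ [Comma]) hs) @ fm_string Q"

text \<open>
  The kind (nonzero) and the index of a symbol occupy one machine word each, since every symbol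
  occurrence, including that of a variable, counts 1 towards the length.
\<close>

fun symbol_words :: "symbol \<Rightarrow> nat list" where
  "symbol_words TopS = [1, 0]"
| "symbol_words BotS = [2, 0]"
| "symbol_words ConjS = [3, 0]"
| "symbol_words DisjS = [4, 0]"
| "symbol_words ImpS = [5, 0]"
| "symbol_words AllS = [6, 0]"
| "symbol_words ExS = [7, 0]"
| "symbol_words (VarS i) = [8, i]"
| "symbol_words (CstS i) = [9, i]"
| "symbol_words (RelS i) = [10, i]"
| "symbol_words Comma = [11, 0]"

definition encode_instance :: "fm list \<Rightarrow> fm \<Rightarrow> nat list" where
  "encode_instance hs Q = concat (map symbol_words (instance_string hs Q))"


section \<open>Random access machines\<close>

text \<open>
  A unit-cost random access machine with a read-only input tape and indirect addressing. The only
  arithmetic operations are addition and truncated subtraction: multiplication at unit cost on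
  unbounded registers would make the model unrealistically strong.
\<close>

datatype instr =
    SetC nat nat
  | Move nat nat
  | Add nat nat nat
  | Sub nat nat nat
  | Load nat nat
  | Store nat nat
  | Read nat
  | Jump nat
  | JumpZero nat nat

text \<open>
  Program counter, register contents, unread part of the input. Reading past the end of the input
  yields 0, which is never the first word of a symbol.
\<close>

type_synonym config = "nat \<times> (nat \<Rightarrow> nat) \<times> nat list"

fun exec :: "instr \<Rightarrow> config \<Rightarrow> config" where
  "exec (SetC r c) (pc, m, w) = (Suc pc, m(r := c), w)"
| "exec (Move r s) (pc, m, w) = (Suc pc, m(r := m s), w)"
| "exec (Add r s t) (pc, m, w) = (Suc pc, m(r := m s + m t), w)"
| "exec (Sub r s t) (pc, m, w) = (Suc pc, m(r := m s - m t), w)"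
| "exec (Load r s) (pc, m, w) = (Suc pc, m(r := m (m s)), w)"
| "exec (Store r s) (pc, m, w) = (Suc pc, m(m r := m s), w)"
| "exec (Read r) (pc, m, w) = (Suc pc, m(r := (case w of [] \<Rightarrow> 0 | a # _ \<Rightarrow> a)), tl w)"
| "exec (Jump l) (pc, m, w) = (l, m, w)"
| "exec (JumpZero r l) (pc, m, w) = (if m r = 0 then l else Suc pc, m, w)"

definition halted :: "instr list \<Rightarrow> config \<Rightarrow> bool" where
  "halted P c \<longleftrightarrow> length P \<le> fst c"

definition step :: "instr list \<Rightarrow> config \<Rightarrow> config" where
  "step P c = (if halted P c then c else exec (P ! fst c) c)"

definition initial :: "nat list \<Rightarrow> config" where
  "initial w = (0, \<lambda>_. 0, w)"

definition answers_within :: "instr list \<Rightarrow> nat list \<Rightarrow> bool \<Rightarrow> nat \<Rightarrow> bool" where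
  "answers_within P w b t \<longleftrightarrow>
     (\<exists>k \<le> t. let c = (step P ^^ k) (initial w) in
        halted P c \<and> fst (snd c) 0 = (if b then 1 else 0))"

definition solves_entailment ::
    "lang \<Rightarrow> (fm list \<Rightarrow> fm \<Rightarrow> bool) \<Rightarrow> instr list \<Rightarrow> (nat \<Rightarrow> nat) \<Rightarrow> bool" where
  "solves_entailment L D P T \<longleftrightarrow>
     (\<forall>hs Q. qpl_instance L hs Q \<longrightarrow> D hs Q \<longrightarrow>
        answers_within P (encode_instance hs Q) (qpl L (set hs) Q) (T (total_length hs Q)))"

end

theory Submission
  imports Defs "HOL-Library.FuncSet"
begin

text \<open>
  Every rule of QPL passes only between formulas that are substitution instances of subformulas of
  the instance, except for introduction rules whose conclusion is never eliminated again; hence a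
  derivation can be normalised so that it stays within these instances, and all terms foreign to
  the instance can be replaced by a single fresh variable. With \<open>q\<close> quantifications there are at most
  \<open>n - q\<close> terms to substitute, so there are \<open>N = O(n (n - q) ^ q)\<close> relevant formulas. The machine lists
  them without repetition, as a hash-consed table in which a formula is looked up by linear search,
  writes down all rule instances between them as Horn clauses, and saturates. This takes
  time polynomial in \<open>n\<close> times \<open>N ^ 2\<close>. Since \<open>2 q < n\<close>, this is \<open>O(n ^ n)\<close>, and it is polynomial in \<open>n\<close>
  when \<open>q\<close> is bounded.
\<close>

section \<open>A while language and its compilation to the random access machine\<close>

text \<open>No rule of QPL discharges an assumption: disjunction is eliminated only from
  \<open>Disj A A\<close>, the existential quantifier only when it is vacuous. So an introduction
  followed by an elimination of the same connective merely returns a formula that was derived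
  before, and no reduction of derivations is needed: it suffices that the formulas built by
  introductions from a local core are closed under the eliminations. The only exception is ex falso.
  It is harmless because a derivable \<open>Bot\<close> settles the question, so the machine tests
  both \<open>Q\<close> and \<open>Bot\<close>.

  The bound leaves little room. Searching and saturating in rounds square \<open>N\<close>, which
  doubles the exponent \<open>q\<close> of \<open>n - q\<close>. This fits because a quantification
  takes two symbols. When \<open>q\<close> is close to \<open>n / 2\<close>, however, the exponent
  is close to \<open>n\<close>, and the polynomial factor can only be paid out of the base. This is
  why the terms are counted by \<open>n - q\<close> and not merely by \<open>n\<close>.\<close>

datatype test = Lt nat nat | Ne nat nat | NeC nat nat

datatype cmd =
    Const nat nat
  | Mov nat nat
  | Plus nat nat nat
  | AddC nat nat
  | SubC nat nat
  | Get nat nat nat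
  | Put nat nat nat
  | In nat
  | Seq cmd cmd (infixr ";;" 60)
  | If test cmd cmd
  | While test cmd

type_synonym state = "(nat \<Rightarrow> nat) \<times> (nat \<Rightarrow> nat \<Rightarrow> nat) \<times> nat list"

fun holds :: "test \<Rightarrow> (nat \<Rightarrow> nat) \<Rightarrow> bool" where
  "holds (Lt x y) v = (v x < v y)"
| "holds (Ne x y) v = (v x \<noteq> v y)"
| "holds (NeC x c) v = (v x \<noteq> c)"

inductive run :: "cmd \<Rightarrow> state \<Rightarrow> nat \<Rightarrow> state \<Rightarrow> bool" where
  "run (Const x c) (v, h, w) 1 (v(x := c), h, w)"
| "run (Mov x y) (v, h, w) 1 (v(x := v y), h, w)"
| "run (Plus x y z) (v, h, w) 1 (v(x := v y + v z), h, w)"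
| "run (AddC x c) (v, h, w) 1 (v(x := v x + c), h, w)"
| "run (SubC x c) (v, h, w) 1 (v(x := v x - c), h, w)"
| "run (Get x a y) (v, h, w) 1 (v(x := h a (v y)), h, w)"
| "run (Put a y x) (v, h, w) 1 (v, h(a := (h a)(v y := v x)), w)"
| "run (In x) (v, h, w) 1 (v(x := (case w of [] \<Rightarrow> 0 | a # _ \<Rightarrow> a)), h, tl w)"
| "run c s t s' \<Longrightarrow> run d s' t' s'' \<Longrightarrow> run (c ;; d) s (t + t') s''"
| "holds b v \<Longrightarrow> run c (v, h, w) t s' \<Longrightarrow> run (If b c d) (v, h, w) (t + 1) s'"
| "\<not> holds b v \<Longrightarrow> run d (v, h, w) t s' \<Longrightarrow> run (If b c d) (v, h, w) (t + 1) s'"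
| "\<not> holds b v \<Longrightarrow> run (While b c) (v, h, w) 1 (v, h, w)"
| "holds b v \<Longrightarrow> run c (v, h, w) t s' \<Longrightarrow> run (While b c) s' t' s'' \<Longrightarrow>
    run (While b c) (v, h, w) (t + t' + 1) s''"

text \<open>The postcondition also receives the time of the run, so termination, correctness and
  cost are established by a single argument.\<close>

definition wp :: "cmd \<Rightarrow> state \<Rightarrow> (nat \<Rightarrow> state \<Rightarrow> bool) \<Rightarrow> bool" where
  "wp c s Q \<longleftrightarrow> (\<exists>t s'. run c s t s' \<and> Q t s')"

inductive_cases run_ConstE: "run (Const x c) (v, h, w) t s"
inductive_cases run_MovE: "run (Mov x y) (v, h, w) t s"
inductive_cases run_PlusE: "run (Plus x y z) (v, h, w) t s"
inductive_cases run_AddCE: "run (AddC x c) (v, h, w) t s"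
inductive_cases run_SubCE: "run (SubC x c) (v, h, w) t s"
inductive_cases run_GetE: "run (Get x a y) (v, h, w) t s"
inductive_cases run_PutE: "run (Put a y x) (v, h, w) t s"
inductive_cases run_InE: "run (In x) (v, h, w) t s"
inductive_cases run_SeqE: "run (c ;; d) s t s'"
inductive_cases run_IfE: "run (If b c d) (v, h, w) t s"

lemma wpI: "run c s t s' \<Longrightarrow> Q t s' \<Longrightarrow> wp c s Q"
  unfolding wp_def by blast

lemma wpE: "wp c s Q \<Longrightarrow> (\<And>t s'. run c s t s' \<Longrightarrow> Q t s' \<Longrightarrow> R) \<Longrightarrow> R"
  unfolding wp_def by blast

lemma wp_simps [simp]:
  "wp (Const x c) (v, h, w) Q = Q 1 (v(x := c), h, w)"
  "wp (Mov x y) (v, h, w) Q = Q 1 (v(x := v y), h, w)"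
  "wp (Plus x y z) (v, h, w) Q = Q 1 (v(x := v y + v z), h, w)"
  "wp (AddC x c) (v, h, w) Q = Q 1 (v(x := v x + c), h, w)"
  "wp (SubC x c) (v, h, w) Q = Q 1 (v(x := v x - c), h, w)"
  "wp (Get x a y) (v, h, w) Q = Q 1 (v(x := h a (v y)), h, w)"
  "wp (Put a y x) (v, h, w) Q = Q 1 (v, h(a := (h a)(v y := v x)), w)"
  "wp (In x) (v, h, w) Q = Q 1 (v(x := (case w of [] \<Rightarrow> 0 | a # _ \<Rightarrow> a)), h, tl w)"
  by (auto elim!: wpE run_ConstE run_MovE run_PlusE run_AddCE run_SubCE run_GetE run_PutE run_InE
      intro: wpI run.intros)

lemma wp_Seq [simp]: "wp (c ;; d) s Q = wp c s (\<lambda>t s'. wp d s' (\<lambda>t'. Q (t + t')))"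
  unfolding wp_def by (blast intro: run.intros elim: run_SeqE)

lemma wp_If [simp]:
  "wp (If b c d) (v, h, w) Q =
    (if holds b v then wp c (v, h, w) (\<lambda>t. Q (t + 1)) else wp d (v, h, w) (\<lambda>t. Q (t + 1)))"
proof (cases "holds b v")
  case True
  have "wp (If b c d) (v, h, w) Q \<longleftrightarrow> wp c (v, h, w) (\<lambda>t. Q (t + 1))"
  proof
    show "wp (If b c d) (v, h, w) Q \<Longrightarrow> wp c (v, h, w) (\<lambda>t. Q (t + 1))"
      using True by (auto elim!: wpE run_IfE intro: wpI)
    show "wp c (v, h, w) (\<lambda>t. Q (t + 1)) \<Longrightarrow> wp (If b c d) (v, h, w) Q"
      using run.intros(10)[OF True] by (blast elim!: wpE intro: wpI)
  qed
  then show ?thesis using True by simp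
next
  case False
  have "wp (If b c d) (v, h, w) Q \<longleftrightarrow> wp d (v, h, w) (\<lambda>t. Q (t + 1))"
  proof
    show "wp (If b c d) (v, h, w) Q \<Longrightarrow> wp d (v, h, w) (\<lambda>t. Q (t + 1))"
      using False by (auto elim!: wpE run_IfE intro: wpI)
    show "wp d (v, h, w) (\<lambda>t. Q (t + 1)) \<Longrightarrow> wp (If b c d) (v, h, w) Q"
      using run.intros(11)[OF False] by (blast elim!: wpE intro: wpI)
  qed
  then show ?thesis using False by simp
qed

lemma wp_mono: "wp c s Q \<Longrightarrow> (\<And>t s'. Q t s' \<Longrightarrow> R t s') \<Longrightarrow> wp c s R"
  unfolding wp_def by blast

text \<open>The variant \<open>k\<close> is carried by the invariant. Each iteration lowers it and
  costs at most \<open>B\<close> and one unit for the test; the summand 1 in \<open>k + 1\<close>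
  pays for the last, failing test.\<close>

lemma wp_While:
  assumes "I k v h w"
    and step: "\<And>k v h w. I k v h w \<Longrightarrow> holds b v \<Longrightarrow>
      wp c (v, h, w) (\<lambda>t (v', h', w'). t \<le> B \<and> (\<exists>k' < k. I k' v' h' w'))"
  shows "wp (While b c) (v, h, w)
      (\<lambda>t (v', h', w'). t \<le> (k + 1) * (B + 1) \<and> \<not> holds b v' \<and> (\<exists>k' \<le> k. I k' v' h' w'))"
  using assms(1)
proof (induction k arbitrary: v h w rule: less_induct)
  case (less k)
  show ?case
  proof (cases "holds b v")
    case False
    then have "run (While b c) (v, h, w) 1 (v, h, w)" by (rule run.intros)
    then show ?thesis unfolding wp_def using less.prems False by fastforce
  next
    case True
    from step[OF less.prems True] obtain t v1 h1 w1 k' where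
      1: "run c (v, h, w) t (v1, h1, w1)" "t \<le> B" "k' < k" "I k' v1 h1 w1"
      unfolding wp_def by auto
    from less.IH[OF 1(3,4)] obtain t' v2 h2 w2 k2 where
      2: "run (While b c) (v1, h1, w1) t' (v2, h2, w2)" "t' \<le> (k' + 1) * (B + 1)"
        "\<not> holds b v2" "k2 \<le> k'" "I k2 v2 h2 w2"
      unfolding wp_def by auto
    have "run (While b c) (v, h, w) (t + t' + 1) (v2, h2, w2)"
      using True 1(1) 2(1) by (rule run.intros)
    moreover have "t + t' + 1 \<le> (k + 1) * (B + 1)"
    proof -
      have "t + t' + 1 \<le> (B + 1) + (k' + 1) * (B + 1)" using 1(2) 2(2) by simp
      also have "\<dots> = (k' + 2) * (B + 1)" by simp
      also have "\<dots> \<le> (k + 1) * (B + 1)" using 1(3) by (intro mult_right_mono) auto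
      finally show ?thesis .
    qed
    moreover have "k2 \<le> k" using 1(3) 2(4) by simp
    ultimately show ?thesis unfolding wp_def using 2 by fastforce
  qed
qed

section \<open>Compilation and its simulation proof\<close>

fun ctest :: "test \<Rightarrow> instr list" where
  "ctest (Lt x y) = [Sub 30 y x, Move 30 30, Move 30 30, Move 30 30]"
| "ctest (Ne x y) = [Sub 30 x y, Sub 31 y x, Add 30 30 31, Move 30 30]"
| "ctest (NeC x c) = [SetC 31 c, Sub 30 x 31, Sub 31 31 x, Add 30 30 31]"

definition caddr :: "nat \<Rightarrow> nat \<Rightarrow> instr list" where
  "caddr a y = [Add 30 y y, Add 30 30 30, Add 30 30 30, Add 30 30 30, Add 30 30 30,
     SetC 31 (32 + a), Add 30 30 31]"

text \<open>Jumps are absolute, so \<open>p\<close> is the address at which the code will stand.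
  Every test is padded with idle moves to four instructions and leaves a nonzero value in register
  30 exactly when it holds. The offset 5 counts the test and the conditional jump; 6 also counts the
  jump that closes the first branch or the loop body.\<close>

fun comp :: "nat \<Rightarrow> cmd \<Rightarrow> instr list" where
  "comp p (Const x c) = [SetC x c]"
| "comp p (Mov x y) = [Move x y]"
| "comp p (Plus x y z) = [instr.Add x y z]"
| "comp p (AddC x c) = [SetC 31 c, instr.Add x x 31]"
| "comp p (SubC x c) = [SetC 31 c, Sub x x 31]"
| "comp p (Get x a y) = caddr a y @ [Load x 30]"
| "comp p (Put a y x) = caddr a y @ [Store 30 x]"
| "comp p (In x) = [Read x]"
| "comp p (c ;; d) = (let C = comp p c in C @ comp (p + length C) d)"
| "comp p (If b c d) =
    (let C = comp (p + 5) c; D = comp (p + 6 + length C) d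
     in ctest b @ [JumpZero 30 (p + 6 + length C)] @ C @ [Jump (p + 6 + length C + length D)] @ D)"
| "comp p (While b c) =
    (let C = comp (p + 5) c
     in ctest b @ [JumpZero 30 (p + 6 + length C)] @ C @ [Jump p])"

fun ok_test :: "test \<Rightarrow> bool" where
  "ok_test (Lt x y) = (x < 30 \<and> y < 30)"
| "ok_test (Ne x y) = (x < 30 \<and> y < 30)"
| "ok_test (NeC x c) = (x < 30)"

fun ok_cmd :: "cmd \<Rightarrow> bool" where
  "ok_cmd (Const x c) = (x < 30)"
| "ok_cmd (Mov x y) = (x < 30 \<and> y < 30)"
| "ok_cmd (Plus x y z) = (x < 30 \<and> y < 30 \<and> z < 30)"
| "ok_cmd (AddC x c) = (x < 30)"
| "ok_cmd (SubC x c) = (x < 30)"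
| "ok_cmd (Get x a y) = (x < 30 \<and> a < 32 \<and> y < 30)"
| "ok_cmd (Put a y x) = (x < 30 \<and> a < 32 \<and> y < 30)"
| "ok_cmd (In x) = (x < 30)"
| "ok_cmd (c ;; d) = (ok_cmd c \<and> ok_cmd d)"
| "ok_cmd (If b c d) = (ok_test b \<and> ok_cmd c \<and> ok_cmd d)"
| "ok_cmd (While b c) = (ok_test b \<and> ok_cmd c)"

text \<open>
  The scalars occupy registers below 30, registers 30 and 31 are scratch, and 32 unbounded arrays are
  interleaved, so that an address is computed by five doublings.
\<close>

definition rel :: "(nat \<Rightarrow> nat) \<Rightarrow> (nat \<Rightarrow> nat \<Rightarrow> nat) \<Rightarrow> (nat \<Rightarrow> nat) \<Rightarrow> bool" where
  "rel v h m \<longleftrightarrow> (\<forall>r < 30. m r = v r) \<and> (\<forall>a < 32. \<forall>j. m (32 * j + (32 + a)) = h a j)"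

definition code_at :: "instr list \<Rightarrow> nat \<Rightarrow> instr list \<Rightarrow> bool" where
  "code_at P p C \<longleftrightarrow> p + length C \<le> length P \<and> (\<forall>i < length C. P ! (p + i) = C ! i)"

definition reach :: "instr list \<Rightarrow> config \<Rightarrow> nat \<Rightarrow> config \<Rightarrow> bool" where
  "reach P c k c' \<longleftrightarrow> (\<exists>j \<le> k. (step P ^^ j) c = c')"

lemma code_at_append: "code_at P p (C @ D) \<longleftrightarrow> code_at P p C \<and> code_at P (p + length C) D"
proof -
  have "(\<forall>i < length C + length D. P ! (p + i) = (C @ D) ! i) \<longleftrightarrow>
    (\<forall>i < length C. P ! (p + i) = C ! i) \<and> (\<forall>i < length D. P ! (p + length C + i) = D ! i)"
    (is "?l \<longleftrightarrow> ?r")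
  proof
    assume l: ?l
    show ?r
    proof (intro HOL.conjI HOL.allI HOL.impI)
      fix i assume "i < length C"
      then show "P ! (p + i) = C ! i" using l[rule_format, of i] by (simp add: nth_append)
    next
      fix i assume "i < length D"
      then show "P ! (p + length C + i) = D ! i"
        using l[rule_format, of "length C + i"] by (simp add: add.assoc)
    qed
  next
    assume r: ?r
    show ?l
    proof (intro HOL.allI HOL.impI)
      fix i assume "i < length C + length D"
      then show "P ! (p + i) = (C @ D) ! i"
        using conjunct1[OF r, rule_format, of i] conjunct2[OF r, rule_format, of "i - length C"]
        by (cases "i < length C") (auto simp: nth_append)
    qed
  qed
  then show ?thesis by (auto simp: code_at_def)
qed

lemma code_at_Cons: "code_at P p (i # C) \<longleftrightarrow> p < length P \<and> P ! p = i \<and> code_at P (Suc p) C"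
proof -
  have "code_at P p ([i] @ C) \<longleftrightarrow> code_at P p [i] \<and> code_at P (p + 1) C"
    by (subst code_at_append) simp
  then show ?thesis by (auto simp: code_at_def)
qed

lemma reach_refl: "reach P c k c"
  unfolding reach_def by (rule HOL.exI[of _ 0]) simp

lemma reach_trans: "reach P c k c' \<Longrightarrow> reach P c' l c'' \<Longrightarrow> reach P c (k + l) c''"
proof -
  assume "reach P c k c'" "reach P c' l c''"
  then obtain i j where "i \<le> k" "j \<le> l" "(step P ^^ i) c = c'" "(step P ^^ j) c' = c''"
    by (auto simp: reach_def)
  then show ?thesis unfolding reach_def
    by (intro HOL.exI[of _ "j + i"]) (simp add: funpow_add)
qed

lemma reach_mono: "reach P c k c' \<Longrightarrow> k \<le> l \<Longrightarrow> reach P c l c'"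
  unfolding reach_def using order_trans by blast

lemma reach_step:
  "fst c < length P \<Longrightarrow> reach P (exec (P ! fst c) c) k c' \<Longrightarrow> reach P c (Suc k) c'"
proof -
  assume a: "fst c < length P" "reach P (exec (P ! fst c) c) k c'"
  have "reach P c 1 (exec (P ! fst c) c)" unfolding reach_def
    by (rule HOL.exI[of _ 1]) (use a(1) in \<open>simp add: step_def halted_def\<close>)
  then show ?thesis using reach_trans[OF _ a(2)] by fastforce
qed

text \<open>Besides jumps this excludes \<open>Read\<close>, so that the effect of a block is a fold
  over the register contents alone.\<close>

fun straight :: "instr \<Rightarrow> bool" where
  "straight (Jump l) = False"
| "straight (JumpZero r l) = False"
| "straight (Read r) = False"
| "straight _ = True"

definition upd :: "instr \<Rightarrow> (nat \<Rightarrow> nat) \<Rightarrow> nat \<Rightarrow> nat" where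
  "upd i m = fst (snd (exec i (0, m, [])))"

lemma upd_simps [simp]:
  "upd (SetC r c) m = m(r := c)"
  "upd (Move r s) m = m(r := m s)"
  "upd (instr.Add r s t) m = m(r := m s + m t)"
  "upd (Sub r s t) m = m(r := m s - m t)"
  "upd (Load r s) m = m(r := m (m s))"
  "upd (Store r s) m = m(m r := m s)"
  by (simp_all add: upd_def)

lemma reach_straight:
  "code_at P p C \<Longrightarrow> list_all straight C \<Longrightarrow>
    reach P (p, m, w) (length C) (p + length C, fold upd C m, w)"
proof (induction C arbitrary: p m)
  case Nil
  show ?case by (simp add: reach_refl)
next
  case (Cons i C)
  then have "exec i (p, m, w) = (Suc p, upd i m, w)" by (cases i) auto
  then show ?case using Cons.IH[of "Suc p" "upd i m"] Cons.prems
    reach_step[of "(p, m, w)" P] by (simp add: code_at_Cons)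
qed

lemma length_ctest [simp]: "length (ctest b) = 4"
  by (cases b) auto

lemma length_caddr [simp]: "length (caddr a y) = 7"
  by (simp add: caddr_def)

lemma straight_ctest: "list_all straight (ctest b)"
  by (cases b) auto

lemma straight_caddr: "list_all straight (caddr a y)"
  by (simp add: caddr_def)

lemma rel_tmp: "rel v h m \<Longrightarrow> rel v h (m(30 := a))" "rel v h m \<Longrightarrow> rel v h (m(31 := a))"
  by (auto simp: rel_def)

lemma rel_set: "rel v h m \<Longrightarrow> x < 30 \<Longrightarrow> rel (v(x := a)) h (m(x := a))"
  by (auto simp: rel_def)

lemma rel_get: "rel v h m \<Longrightarrow> x < 30 \<Longrightarrow> m x = v x"
  by (auto simp: rel_def)

lemma rel_aget: "rel v h m \<Longrightarrow> a < 32 \<Longrightarrow> m (32 * j + (32 + a)) = h a j"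
  by (auto simp: rel_def)

text \<open>The address of an array cell is at least 32 and its residue modulo 32 is the number of
  the array, so a write meets neither a scalar nor another array.\<close>

lemma rel_aset:
  assumes "rel v h m" "a < 32"
  shows "rel v (h(a := (h a)(j := b))) (m(32 * j + (32 + a) := b))"
proof -
  have "j = j' \<and> a = a'" if "32 * j' + (32 + a') = 32 * j + (32 + a)" "a' < 32" for a' j'
  proof -
    have "a' = (32 * j' + (32 + a')) mod 32" "a = (32 * j + (32 + a)) mod 32"
      using that(2) assms(2) by simp_all
    then have "a = a'" using that(1) by metis
    then show ?thesis using that(1) by simp
  qed
  then show ?thesis using assms by (auto simp: rel_def)
qed

lemma run_ctest:
  assumes "rel v h m" "ok_test b" "code_at P p (ctest b)"
  shows "\<exists>m'. reach P (p, m, w) 4 (p + 4, m', w) \<and> rel v h m' \<and> (m' 30 \<noteq> 0 \<longleftrightarrow> holds b v)"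
proof -
  have 1: "reach P (p, m, w) 4 (p + 4, fold upd (ctest b) m, w)"
    using reach_straight[OF assms(3), of m w] straight_ctest by simp
  have 2: "rel v h (fold upd (ctest b) m)" "fold upd (ctest b) m 30 \<noteq> 0 \<longleftrightarrow> holds b v"
    using assms(1,2) by (cases b; auto intro!: rel_tmp simp: rel_get)+
  show ?thesis using 1 2 by blast
qed

lemma run_caddr:
  assumes "rel v h m" "y < 30" "code_at P p (caddr a y)"
  shows "\<exists>m'. reach P (p, m, w) 7 (p + 7, m', w) \<and> rel v h m' \<and> m' 30 = 32 * v y + (32 + a)"
proof -
  have 1: "reach P (p, m, w) 7 (p + 7, fold upd (caddr a y) m, w)"
    using reach_straight[OF assms(3), of m w] by (simp add: straight_caddr)
  have "rel v h (fold upd (caddr a y) m)" "fold upd (caddr a y) m 30 = 32 * v y + (32 + a)"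
    using assms(1,2) by (auto intro!: rel_tmp simp: rel_get caddr_def)
  then show ?thesis using 1 by blast
qed

lemma code_at_branch:
  assumes "code_at P p (ctest b @ [J] @ C @ [K] @ D)"
  shows "code_at P p (ctest b)" "p + 4 < length P" "P ! (p + 4) = J" "code_at P (p + 5) C"
    "p + 5 + length C < length P" "P ! (p + 5 + length C) = K" "code_at P (p + 6 + length C) D"
  using assms by (simp_all add: code_at_append code_at_Cons numeral_eq_Suc)

lemma reach1:
  "p < length P \<Longrightarrow> P ! p = i \<Longrightarrow> exec i (p, m, w) = c \<Longrightarrow> reach P (p, m, w) 1 c"
  using reach_step[of "(p, m, w)" P 0 c] by (auto simp: reach_refl)

lemma straight_simulation:
  assumes "code_at P p C" "list_all straight C" "length C \<le> 12" "rel v' h' (fold upd C m)"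
  shows "\<exists>m'. reach P (p, m, w) (12 * 1) (p + length C, m', w) \<and> rel v' h' m'"
  using reach_mono[OF reach_straight[OF assms(1,2)], of 12] assms(3,4) by auto

text \<open>Twelve is a generous uniform factor: an array access takes seven instructions for the
  address and one for the transfer, and the control part of a branch or an iteration takes at most
  six.\<close>

theorem simulation:
  "run c s t s' \<Longrightarrow> ok_cmd c \<Longrightarrow> code_at P p (comp p c) \<Longrightarrow> rel (fst s) (fst (snd s)) m \<Longrightarrow>
    \<exists>m'. reach P (p, m, snd (snd s)) (12 * t) (p + length (comp p c), m', snd (snd s'))
      \<and> rel (fst s') (fst (snd s')) m'"
proof (induction c s t s' arbitrary: p m rule: run.induct)
  case (1 x c v h w)
  then have "rel (v(x := c)) h (m(x := c))" by (simp add: rel_set)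
  then show ?case
    using straight_simulation[of P p "[SetC x c]" "v(x := c)" h m w] 1 by (simp add: fun_upd_def)
next
  case (2 x y v h w)
  then have "rel (v(x := v y)) h (m(x := m y))" by (simp add: rel_set rel_get)
  then show ?case
    using straight_simulation[of P p "[Move x y]" "v(x := v y)" h m w] 2 by (simp add: fun_upd_def)
next
  case (3 x y z v h w)
  then have "rel (v(x := v y + v z)) h (m(x := m y + m z))" by (simp add: rel_set rel_get)
  then show ?case
    using straight_simulation[of P p "[instr.Add x y z]" "v(x := v y + v z)" h m w] 3 by (simp add: fun_upd_def)
next
  case (4 x c v h w)
  have "rel (v(x := v x + c)) h (m(31 := c, x := m x + c))"
    using rel_set[OF rel_tmp(2), of v h m x "v x + c" c] 4 by (simp add: rel_get)
  then show ?case
    using straight_simulation[of P p "[SetC 31 c, instr.Add x x 31]" "v(x := v x + c)" h m w] 4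
    by (simp add: numeral_2_eq_2 fun_upd_def)
next
  case (5 x c v h w)
  have "rel (v(x := v x - c)) h (m(31 := c, x := m x - c))"
    using rel_set[OF rel_tmp(2), of v h m x "v x - c" c] 5 by (simp add: rel_get)
  then show ?case
    using straight_simulation[of P p "[SetC 31 c, Sub x x 31]" "v(x := v x - c)" h m w] 5
    by (simp add: numeral_2_eq_2 fun_upd_def)
next
  case (6 x a y v h w)
  then have 1: "code_at P p (caddr a y)" "code_at P (p + 7) [Load x 30]"
    by (simp_all add: code_at_append)
  obtain m1 where 2: "reach P (p, m, w) 7 (p + 7, m1, w)" "rel v h m1"
      "m1 30 = 32 * v y + (32 + a)"
    using run_caddr[of v h m y P p a w] 6 1 by auto
  have "reach P (p + 7, m1, w) 1 (Suc (p + 7), m1(x := h a (v y)), w)"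
    using 1(2) 2(2,3) 6(1) by (auto intro!: reach1[unfolded One_nat_def] simp: code_at_Cons rel_aget)
  from reach_mono[OF reach_trans[OF 2(1) this], of 12] show ?case
    using rel_set[OF 2(2), of x "h a (v y)"] 6(1) by (auto simp: fun_upd_def add.commute)
next
  case (7 a y x v h w)
  then have 1: "code_at P p (caddr a y)" "code_at P (p + 7) [Store 30 x]"
    by (simp_all add: code_at_append)
  obtain m1 where 2: "reach P (p, m, w) 7 (p + 7, m1, w)" "rel v h m1"
      "m1 30 = 32 * v y + (32 + a)"
    using run_caddr[of v h m y P p a w] 7 1 by auto
  have "reach P (p + 7, m1, w) 1 (Suc (p + 7), m1(32 * v y + (32 + a) := v x), w)"
    using 1(2) 2(2,3) 7(1) by (auto intro!: reach1[unfolded One_nat_def] simp: code_at_Cons rel_get)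
  from reach_mono[OF reach_trans[OF 2(1) this], of 12] show ?case
    using rel_aset[OF 2(2), of a "v y" "v x"] 7(1) by (auto simp: fun_upd_def add.commute)
next
  case (8 x v h w)
  then have "reach P (p, m, w) 1
      (Suc p, m(x := (case w of [] \<Rightarrow> 0 | a # _ \<Rightarrow> a)), tl w)"
    by (auto intro!: reach1[unfolded One_nat_def] simp: code_at_Cons)
  from reach_mono[OF this, of 12] show ?case
    using rel_set[of v h m x "case w of [] \<Rightarrow> 0 | a # _ \<Rightarrow> a"] 8 by (auto simp: fun_upd_def)
next
  case (9 c s t s' d t' s'')
  let ?C = "comp p c" and ?D = "comp (p + length (comp p c)) d"
  have 1: "code_at P p ?C" "code_at P (p + length ?C) ?D"
    using 9(6) by (simp_all add: code_at_append Let_def)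
  obtain m1 where 2: "reach P (p, m, snd (snd s)) (12 * t) (p + length ?C, m1, snd (snd s'))"
      "rel (fst s') (fst (snd s')) m1"
    using 9(3)[of p m] 9(5,7) 1 by auto
  obtain m2 where 3: "reach P (p + length ?C, m1, snd (snd s')) (12 * t')
      (p + length ?C + length ?D, m2, snd (snd s''))" "rel (fst s'') (fst (snd s'')) m2"
    using 9(4)[of "p + length ?C" m1] 9(5) 1 2 by auto
  show ?case using reach_trans[OF 2(1) 3(1)] 3(2)
    by (auto simp: Let_def add.assoc algebra_simps)
next
  case (10 b v c h w t s' d)
  let ?C = "comp (p + 5) c"
  let ?D = "comp (p + 6 + length ?C) d"
  note 1 = code_at_branch[OF 10(5)[unfolded comp.simps Let_def]]
  obtain m1 where 2: "reach P (p, m, w) 4 (p + 4, m1, w)" "rel v h m1" "m1 30 \<noteq> 0"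
    using run_ctest[of v h m b P p w] 10 1 by auto
  have 3: "reach P (p + 4, m1, w) 1 (p + 5, m1, w)"
    by (rule reach1[OF 1(2,3)]) (simp add: 2(3))
  obtain m2 where 4: "reach P (p + 5, m1, w) (12 * t) (p + 5 + length ?C, m2, snd (snd s'))"
      "rel (fst s') (fst (snd s')) m2"
    using 10(3)[of "p + 5" m1] 10(4) 1 2 by auto
  have 5: "reach P (p + 5 + length ?C, m2, snd (snd s')) 1
      (p + 6 + length ?C + length ?D, m2, snd (snd s'))"
    by (rule reach1[OF 1(5,6)]) simp
  have "reach P (p, m, w) (12 * (t + 1)) (p + 6 + length ?C + length ?D, m2, snd (snd s'))"
    by (rule reach_mono[OF reach_trans[OF reach_trans[OF reach_trans[OF 2(1) 3] 4(1)] 5]]) simp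
  then show ?case using 4(2) by (auto simp: Let_def algebra_simps)
next
  case (11 b v d h w t s' c)
  let ?C = "comp (p + 5) c"
  let ?D = "comp (p + 6 + length ?C) d"
  note 1 = code_at_branch[OF 11(5)[unfolded comp.simps Let_def]]
  obtain m1 where 2: "reach P (p, m, w) 4 (p + 4, m1, w)" "rel v h m1" "m1 30 = 0"
    using run_ctest[of v h m b P p w] 11 1 by auto
  have 3: "reach P (p + 4, m1, w) 1 (p + 6 + length ?C, m1, w)"
    by (rule reach1[OF 1(2,3)]) (simp add: 2(3))
  obtain m2 where 4: "reach P (p + 6 + length ?C, m1, w) (12 * t)
      (p + 6 + length ?C + length ?D, m2, snd (snd s'))" "rel (fst s') (fst (snd s')) m2"
    using 11(3)[of "p + 6 + length ?C" m1] 11(4) 1 2 by auto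
  have "reach P (p, m, w) (12 * (t + 1)) (p + 6 + length ?C + length ?D, m2, snd (snd s'))"
    by (rule reach_mono[OF reach_trans[OF reach_trans[OF 2(1) 3] 4(1)]]) simp
  then show ?case using 4(2) by (auto simp: Let_def algebra_simps)
next
  case (12 b v c h w)
  let ?C = "comp (p + 5) c"
  have "code_at P p (ctest b @ [JumpZero 30 (p + 6 + length ?C)] @ ?C @ [Jump p] @ [])"
    using 12(3) by (simp add: Let_def)
  note 1 = code_at_branch[OF this]
  obtain m1 where 2: "reach P (p, m, w) 4 (p + 4, m1, w)" "rel v h m1" "m1 30 = 0"
    using run_ctest[of v h m b P p w] 12 1 by auto
  have 3: "reach P (p + 4, m1, w) 1 (p + 6 + length ?C, m1, w)"
    by (rule reach1[OF 1(2,3)]) (simp add: 2(3))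
  have "reach P (p, m, w) (12 * 1) (p + 6 + length ?C, m1, w)"
    by (rule reach_mono[OF reach_trans[OF 2(1) 3]]) simp
  then show ?case using 2(2) by (auto simp: Let_def algebra_simps)
next
  case (13 b v c h w t s' t' s'')
  let ?C = "comp (p + 5) c"
  have "code_at P p (ctest b @ [JumpZero 30 (p + 6 + length ?C)] @ ?C @ [Jump p] @ [])"
    using 13(7) by (simp add: Let_def)
  note 1 = code_at_branch[OF this]
  obtain m1 where 2: "reach P (p, m, w) 4 (p + 4, m1, w)" "rel v h m1" "m1 30 \<noteq> 0"
    using run_ctest[of v h m b P p w] 13 1 by auto
  have 3: "reach P (p + 4, m1, w) 1 (p + 5, m1, w)"
    by (rule reach1[OF 1(2,3)]) (simp add: 2(3))
  obtain m2 where 4: "reach P (p + 5, m1, w) (12 * t) (p + 5 + length ?C, m2, snd (snd s'))"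
      "rel (fst s') (fst (snd s')) m2"
    using 13(4)[of "p + 5" m1] 13(6) 1 2 by auto
  have 5: "reach P (p + 5 + length ?C, m2, snd (snd s')) 1 (p, m2, snd (snd s'))"
    by (rule reach1[OF 1(5,6)]) simp
  \<comment> \<open>Control is back at \<open>p\<close>, where the same code still stands, so the
    induction hypothesis for the remaining iterations applies with the same address.\<close>
  obtain m3 where 6: "reach P (p, m2, snd (snd s')) (12 * t')
      (p + length (comp p (While b c)), m3, snd (snd s''))" "rel (fst s'') (fst (snd s'')) m3"
    using 13(5)[of p m2] 13(6,7) 4(2) by blast
  have "reach P (p, m, w) (12 * (t + t' + 1))
      (p + length (comp p (While b c)), m3, snd (snd s''))"
    by (rule reach_mono[OF reach_trans[OF reach_trans[OF reach_trans[OF reach_trans[OF 2(1) 3] 4(1)] 5] 6(1)]]) simp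
  then show ?case using 6(2) by auto
qed

corollary compile_answers:
  assumes "ok_cmd c" "wp c (\<lambda>_. 0, \<lambda>_ _. 0, w) (\<lambda>t (v, h, w'). t \<le> T \<and> v 0 = (if b then 1 else 0))"
  shows "answers_within (comp 0 c) w b (12 * T)"
proof -
  let ?P = "comp 0 c"
  obtain t v h w' where 1: "run c (\<lambda>_. 0, \<lambda>_ _. 0, w) t (v, h, w')" "t \<le> T" "v 0 = (if b then 1 else 0)"
    using assms(2) unfolding wp_def by auto
  have "code_at ?P 0 ?P" "rel (\<lambda>_. 0) (\<lambda>_ _. 0) (\<lambda>_. 0)" by (auto simp: code_at_def rel_def)
  then obtain m where 2: "reach ?P (0, \<lambda>_. 0, w) (12 * t) (length ?P, m, w')" "rel v h m"
    using simulation[OF 1(1) assms(1), of ?P 0 "\<lambda>_. 0"] by auto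
  from 2(2) 1(3) have "m 0 = (if b then 1 else 0)" by (simp add: rel_get)
  moreover obtain k where "k \<le> 12 * t" "(step ?P ^^ k) (0, \<lambda>_. 0, w) = (length ?P, m, w')"
    using 2(1) by (auto simp: reach_def)
  moreover have "k \<le> 12 * T" using calculation(2) 1(2) by simp
  ultimately show ?thesis
    unfolding answers_within_def initial_def by (intro HOL.exI[of _ k]) (simp add: halted_def)
qed

section \<open>Completeness of the saturated set of local formulas\<close>

text \<open>Two premises suffice for every rule of QPL. A rule with one premise repeats it, and
  axioms and hypotheses become clauses from the base element, which will be
  \<open>Fm Top\<close>.\<close>

inductive horn :: "('a \<times> 'a \<times> 'a) set \<Rightarrow> 'a \<Rightarrow> 'a \<Rightarrow> bool" for C and b where
  horn_base: "horn C b b"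
| horn_step: "(p, q, c) \<in> C \<Longrightarrow> horn C b p \<Longrightarrow> horn C b q \<Longrightarrow> horn C b c"

text \<open>
  \<open>Fail\<close> stands for the result of substituting a term that is not substitutable. Argument lists are
  objects as well, so that every object has at most two children.
\<close>

datatype obj = Fail | Fm fm | Args "trm list"

text \<open>These are the rules that relate a node to its children without a substitution. Ex falso
  has no clause, since it would connect \<open>Bot\<close> with every node; \<open>qpl_iff\<close>
  accounts for it separately.\<close>

fun rules0 :: "obj \<Rightarrow> (obj \<times> obj \<times> obj) list" where
  "rules0 (Fm (Conj B C)) =
    [(Fm B, Fm C, Fm (Conj B C)), (Fm (Conj B C), Fm (Conj B C), Fm B), (Fm (Conj B C), Fm (Conj B C), Fm C)]"
| "rules0 (Fm (Disj B C)) =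
    [(Fm B, Fm B, Fm (Disj B C)), (Fm C, Fm C, Fm (Disj B C))]
    @ (if B = C then [(Fm (Disj B C), Fm (Disj B C), Fm B)] else [])"
| "rules0 (Fm (Imp B C)) =
    [(Fm C, Fm C, Fm (Imp B C)), (Fm B, Fm (Imp B C), Fm C)]
    @ (if B = C then [(Fm Top, Fm Top, Fm (Imp B C))] else [])"
| "rules0 _ = []"

text \<open>The side condition that \<open>x\<close> is not free in \<open>B\<close> appears as
  \<open>subst x (Var f) B = B\<close>. For \<open>f\<close> distinct from \<open>x\<close> the two
  are equivalent, and a search for free occurrences becomes a comparison of two node
  numbers.\<close>

fun rules1 :: "nat \<Rightarrow> nat \<times> trm \<Rightarrow> obj \<Rightarrow> (obj \<times> obj \<times> obj) list" where
  "rules1 f (x, t) (Fm (All y B)) =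
    (if y = x \<and> substitutable t x B
     then (Fm (All y B), Fm (All y B), Fm (subst x t B))
       # (if t = Var f \<and> subst x t B = B then [(Fm B, Fm B, Fm (All y B))] else [])
     else [])"
| "rules1 f (x, t) (Fm (Ex y B)) =
    (if y = x \<and> substitutable t x B
     then (Fm (subst x t B), Fm (subst x t B), Fm (Ex y B))
       # (if t = Var f \<and> subst x t B = B then [(Fm (Ex y B), Fm (Ex y B), Fm B)] else [])
     else [])"
| "rules1 f p _ = []"

definition clauses :: "fm set \<Rightarrow> nat \<Rightarrow> (nat \<times> trm) set \<Rightarrow> obj set \<Rightarrow> (obj \<times> obj \<times> obj) set" where
  "clauses H f P W = (\<lambda>h. (Fm Top, Fm Top, Fm h)) ` H
     \<union> (\<Union>B\<in>W. set (rules0 B) \<union> (\<Union>p\<in>P. set (rules1 f p B)))"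

fun children :: "obj \<Rightarrow> obj set" where
  "children (Fm (Rel R ts)) = {Args ts}"
| "children (Fm (Conj B C)) = {Fm B, Fm C}"
| "children (Fm (Disj B C)) = {Fm B, Fm C}"
| "children (Fm (Imp B C)) = {Fm B, Fm C}"
| "children (Fm (All x B)) = {Fm B}"
| "children (Fm (Ex x B)) = {Fm B}"
| "children (Args (t # ts)) = {Args ts}"
| "children _ = {}"

fun osub :: "nat \<times> trm \<Rightarrow> obj \<Rightarrow> obj" where
  "osub (x, t) Fail = Fail"
| "osub (x, t) (Fm B) = (if substitutable t x B then Fm (subst x t B) else Fail)"
| "osub (x, t) (Args ts) = Args (map (\<lambda>s. if s = Var x then t else s) ts)"

fun bv :: "fm \<Rightarrow> nat set" where
  "bv (Conj B C) = bv B \<union> bv C"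
| "bv (Disj B C) = bv B \<union> bv C"
| "bv (Imp B C) = bv B \<union> bv C"
| "bv (All x B) = insert x (bv B)"
| "bv (Ex x B) = insert x (bv B)"
| "bv _ = {}"

fun trms :: "fm \<Rightarrow> trm set" where
  "trms (Rel R ts) = set ts"
| "trms (Conj B C) = trms B \<union> trms C"
| "trms (Disj B C) = trms B \<union> trms C"
| "trms (Imp B C) = trms B \<union> trms C"
| "trms (All x B) = insert (Var x) (trms B)"
| "trms (Ex x B) = insert (Var x) (trms B)"
| "trms _ = {}"

lemma bv_subst [simp]: "bv (subst x t B) = bv B"
  by (induction B) auto

lemma subst_notin_fv: "x \<notin> fv B \<Longrightarrow> subst x t B = B"
  by (induction B) (auto intro: map_idI)

lemma notin_fv_if_subst_eq: "subst x t B = B \<Longrightarrow> t \<noteq> Var x \<Longrightarrow> x \<notin> fv B"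
proof (induction B)
  case (Rel R ts)
  have "map (\<lambda>s. if s = Var x then t else s) ts = ts" using Rel by simp
  then have "\<forall>s\<in>set ts. (if s = Var x then t else s) = s"
    using map_eq_conv[of "\<lambda>s. if s = Var x then t else s" ts "\<lambda>s. s"] by simp
  then show ?case using Rel(2) by auto
qed (auto split: if_splits)

lemma substitutable_notin_fv: "x \<notin> fv B \<Longrightarrow> substitutable t x B"
  by (induction B) auto

section \<open>Soundness and completeness of the local Horn clauses\<close>

definition rename :: "trm set \<Rightarrow> nat \<Rightarrow> trm \<Rightarrow> trm" where
  "rename T f t = (if t \<in> T then t else Var f)"

fun renamef :: "trm set \<Rightarrow> nat \<Rightarrow> fm \<Rightarrow> fm" where
  "renamef T f Top = Top"
| "renamef T f Bot = Bot"
| "renamef T f (Rel R ts) = Rel R (map (rename T f) ts)"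
| "renamef T f (Conj B C) = Conj (renamef T f B) (renamef T f C)"
| "renamef T f (Disj B C) = Disj (renamef T f B) (renamef T f C)"
| "renamef T f (Imp B C) = Imp (renamef T f B) (renamef T f C)"
| "renamef T f (All x B) = All x (renamef T f B)"
| "renamef T f (Ex x B) = Ex x (renamef T f B)"

lemma renamef_id: "trms B \<subseteq> T \<Longrightarrow> renamef T f B = B"
  by (induction B) (auto simp: rename_def intro!: map_idI)

text \<open>The predicate \<open>X\<close> is the core on which eliminations may have to work. There
  is a clause for each introduction and none for an elimination or for \<open>Bot\<close>, so
  inversion leaves only two possibilities: the formula is in the core, or its outermost connective
  has just been introduced or comes from an axiom.\<close>

inductive intro_closure :: "(fm \<Rightarrow> bool) \<Rightarrow> fm \<Rightarrow> bool" for X where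
  "X B \<Longrightarrow> intro_closure X B"
| "intro_closure X Top"
| "intro_closure X (Imp B B)"
| "intro_closure X B \<Longrightarrow> intro_closure X C \<Longrightarrow> intro_closure X (Conj B C)"
| "intro_closure X B \<Longrightarrow> intro_closure X (Disj B C)"
| "intro_closure X C \<Longrightarrow> intro_closure X (Disj B C)"
| "intro_closure X C \<Longrightarrow> intro_closure X (Imp B C)"
| "intro_closure X B \<Longrightarrow> x \<notin> fv B \<Longrightarrow> intro_closure X (All x B)"
| "intro_closure X (subst x t B) \<Longrightarrow> substitutable t x B \<Longrightarrow> intro_closure X (Ex x B)"

inductive_cases intro_closure_BotE: "intro_closure X Bot"
inductive_cases intro_closure_ConjE: "intro_closure X (Conj B C)"
inductive_cases intro_closure_DisjE: "intro_closure X (Disj B C)"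
inductive_cases intro_closure_ImpE: "intro_closure X (Imp B C)"
inductive_cases intro_closure_AllE: "intro_closure X (All x B)"
inductive_cases intro_closure_ExE: "intro_closure X (Ex x B)"

text \<open>The set \<open>W\<close> is assumed to be closed, but not to be minimal or of any
  particular form. Hence the finished table of the machine can be used for it without being
  identified with an explicitly described set.\<close>

locale entailment =
  fixes L :: lang and H :: "fm set" and Q :: fm
    and V :: "nat set" and T :: "trm set" and f :: nat and W :: "obj set"
  assumes fresh: "Var f \<in> T" "f \<notin> V"
    and V_T: "x \<in> V \<Longrightarrow> Var x \<in> T"
    and wf_T: "t \<in> T \<Longrightarrow> wf_trm L t"
    and in_W: "Fm Top \<in> W" "Fm Q \<in> W" "Fm Bot \<in> W" "B \<in> H \<Longrightarrow> Fm B \<in> W"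
    and bv_S: "B \<in> insert Q H \<Longrightarrow> bv B \<subseteq> V"
    and trms_S: "B \<in> insert Q H \<Longrightarrow> trms B \<subseteq> T"
    and children_W: "ob \<in> W \<Longrightarrow> children ob \<subseteq> W"
    and osub_W: "ob \<in> W \<Longrightarrow> x \<in> V \<Longrightarrow> t \<in> T \<Longrightarrow> osub (x, t) ob \<in> W"
    and wf_W: "Fm B \<in> W \<Longrightarrow> wf_fm L B"
begin

abbreviation "CL \<equiv> clauses H f (V \<times> T) W"
abbreviation "X B \<equiv> horn CL (Fm Top) (Fm B)"
abbreviation "rn \<equiv> rename T f"
abbreviation "rnf \<equiv> renamef T f"

lemma subst_W: "Fm B \<in> W \<Longrightarrow> x \<in> V \<Longrightarrow> t \<in> T \<Longrightarrow> substitutable t x B \<Longrightarrow> Fm (subst x t B) \<in> W"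
  using osub_W[of "Fm B" x t] by simp

lemma clauses_sound:
  assumes "(p, q, c) \<in> CL" "p = Fm B \<Longrightarrow> qpl L H B" "q = Fm C \<Longrightarrow> qpl L H C"
    "p = Fm B" "q = Fm C"
  shows "\<exists>D. c = Fm D \<and> qpl L H D"
proof -
  have B: "qpl L H B" and C: "qpl L H C" using assms by auto
  consider h where "h \<in> H" "c = Fm h" | ob where "ob \<in> W" "(p, q, c) \<in> set (rules0 ob)"
    | ob x t where "ob \<in> W" "x \<in> V" "t \<in> T" "(p, q, c) \<in> set (rules1 f (x, t) ob)"
    using assms(1) unfolding clauses_def by auto
  then show ?thesis
  proof cases
    case 1
    then show ?thesis by (auto intro: qpl.intros)
  next
    case 2
    have "children ob \<subseteq> W" using children_W 2(1) .
    then have wf: "Fm D \<in> children ob \<Longrightarrow> wf_fm L D" for D using wf_W by auto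
    show ?thesis
      using 2(2) assms(4,5) B C wf
      by (cases ob rule: rules0.cases) (auto intro: qpl.intros split: if_splits)
  next
    case 3
    have wt: "wf_trm L t" using 3 wf_T by simp
    \<comment> \<open>As \<open>f\<close> lies outside \<open>V\<close>, the term
      \<open>Var f\<close> differs from \<open>Var x\<close>, so an unchanged body certifies the
      side condition of the vacuous quantifier rules.\<close>
    have nf: "x \<notin> fv D" if "t = Var f" "subst x t D = D" for D
      using notin_fv_if_subst_eq[OF that(2)] that(1) 3(2) fresh(2) by auto
    show ?thesis
    proof (cases "\<exists>D. ob = Fm (All x D)")
      case True
      then obtain D where ob: "ob = Fm (All x D)" by auto
      then show ?thesis using 3(4) assms(4,5) B C nf[of D] wt
        by (auto split: if_splits intro: qpl.allI qpl.allE)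
    next
      case False
      then obtain D where ob: "ob = Fm (Ex x D)" using 3(4)
        by (cases "(f, (x, t), ob)" rule: rules1.cases) (auto split: if_splits)
      then show ?thesis using 3(4) assms(4,5) B C nf[of D] wt
        by (auto split: if_splits intro: qpl.exI qpl.exE)
    qed
  qed
qed

lemma horn_sound: "horn CL (Fm Top) ob \<Longrightarrow> \<exists>B. ob = Fm B \<and> qpl L H B"
proof (induction rule: horn.induct)
  case horn_base
  then show ?case by (auto intro: qpl.intros)
next
  case (horn_step p q c)
  then show ?case using clauses_sound by blast
qed

lemma X_step: "(Fm B, Fm C, Fm D) \<in> CL \<Longrightarrow> X B \<Longrightarrow> X C \<Longrightarrow> X D"
  by (rule horn.horn_step)

lemma rules0_CL: "Fm B \<in> W \<Longrightarrow> c \<in> set (rules0 (Fm B)) \<Longrightarrow> c \<in> CL"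
  unfolding clauses_def by auto

lemma rules1_CL: "Fm B \<in> W \<Longrightarrow> x \<in> V \<Longrightarrow> t \<in> T \<Longrightarrow> c \<in> set (rules1 f (x, t) (Fm B)) \<Longrightarrow> c \<in> CL"
  unfolding clauses_def by auto

lemma rn_T: "rn t \<in> T"
  using fresh by (simp add: rename_def)

text \<open>This is the reason for taking \<open>f\<close> outside \<open>V\<close>: renaming
  neither creates nor destroys an occurrence of a variable that can be bound. The behaviour of
  renaming with respect to substitution, free variables and substitutability rests on it.\<close>

lemma rn_eq_Var: "x \<in> V \<Longrightarrow> rn t = Var x \<longleftrightarrow> t = Var x"
  using fresh V_T by (auto simp: rename_def)

lemma rnf_subst: "x \<in> V \<Longrightarrow> rnf (subst x t B) = subst x (rn t) (rnf B)"
  by (induction B) (auto simp: rn_eq_Var)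

lemma fv_rnf: "x \<in> V \<Longrightarrow> x \<in> fv (rnf B) \<longleftrightarrow> x \<in> fv B"
proof (induction B)
  case (Rel R ts)
  then show ?case using rn_eq_Var[of x] by (force simp: image_iff)
qed auto

lemma substitutable_rnf:
  "x \<in> V \<Longrightarrow> bv B \<subseteq> V \<Longrightarrow> substitutable t x B \<Longrightarrow> substitutable (rn t) x (rnf B)"
  by (induction B) (auto simp: fv_rnf rn_eq_Var)

text \<open>
  A derivation may use arbitrary terms; renaming those foreign to the instance to the fresh variable
  \<open>f\<close> maps it into \<open>W\<close>. Bound variables of local formulas lie in \<open>V\<close> and are not affected.
\<close>

definition X' :: "fm \<Rightarrow> bool" where
  "X' B \<longleftrightarrow> bv B \<subseteq> V \<and> X (rnf B)"

text \<open>Only nodes of \<open>W\<close> generate clauses, so an elimination can be applied to a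
  derived compound formula only once that formula is known to be a node.\<close>

lemma X_W: "X B \<Longrightarrow> Fm B \<in> W"
proof -
  have "ob \<in> W" if "horn CL (Fm Top) ob" for ob
    using that
  proof cases
    case horn_base
    then show ?thesis using in_W by simp
  next
    case (horn_step p q)
    from horn_step(1) consider h where "h \<in> H" "ob = Fm h"
      | ob' where "ob' \<in> W" "(p, q, ob) \<in> set (rules0 ob')"
      | ob' x t where "ob' \<in> W" "x \<in> V" "t \<in> T" "(p, q, ob) \<in> set (rules1 f (x, t) ob')"
      unfolding clauses_def by auto
    then show ?thesis
    proof cases
      case 1
      then show ?thesis using in_W by simp
    next
      case 2
      then show ?thesis using children_W[of ob']
        by (cases ob' rule: rules0.cases) (auto split: if_splits)
    next
      case 3
      then have "ob = ob' \<or> ob \<in> children ob' \<or> (\<exists>D. Fm D \<in> children ob' \<and> substitutable t x D \<and> ob = Fm (subst x t D))"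
        by (cases "(f, (x, t), ob')" rule: rules1.cases) (auto split: if_splits)
      then show ?thesis using 3 children_W[of ob'] subst_W by blast
    qed
  qed
  then show "X B \<Longrightarrow> Fm B \<in> W" by simp
qed

text \<open>Membership in \<open>W\<close> passes down: the premise of an introduction is a child of
  the conclusion, or an instance of a child by a term that renaming has brought into
  \<open>T\<close>. So each introduction can be replayed by a clause; a vacuous universal quantifier
  uses the clause for \<open>Var f\<close>.\<close>

lemma intro_closure_X':
  "intro_closure X' B \<Longrightarrow> bv B \<subseteq> V \<Longrightarrow> Fm (rnf B) \<in> W \<Longrightarrow> X (rnf B)"
proof (induction rule: intro_closure.induct)
  case (1 B)
  then show ?case by (simp add: X'_def)
next
  case 2
  then show ?case by (simp add: horn_base)
next
  case (3 B)
  then show ?case using X_step[OF rules0_CL[OF 3(2)], of Top Top] by (auto intro: horn_base)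
next
  case (4 B C)
  then show ?case using X_step[OF rules0_CL[OF 4(6)], of "rnf B" "rnf C"] children_W[OF 4(6)]
    by auto
next
  case (5 B C)
  then show ?case using X_step[OF rules0_CL[OF 5(4)], of "rnf B" "rnf B"] children_W[OF 5(4)]
    by auto
next
  case (6 C B)
  then show ?case using X_step[OF rules0_CL[OF 6(4)], of "rnf C" "rnf C"] children_W[OF 6(4)]
    by auto
next
  case (7 C B)
  then show ?case using X_step[OF rules0_CL[OF 7(4)], of "rnf C" "rnf C"] children_W[OF 7(4)]
    by auto
next
  case (8 B x)
  have "x \<notin> fv (rnf B)" using 8 by (simp add: fv_rnf)
  then have "subst x (Var f) (rnf B) = rnf B" "substitutable (Var f) x (rnf B)"
    by (simp_all add: subst_notin_fv substitutable_notin_fv)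
  then show ?case
    using X_step[OF rules1_CL[OF 8(5), of x "Var f"], of "rnf B" "rnf B"] children_W[OF 8(5)] 8 fresh
    by auto
next
  case (9 x t B)
  have s: "substitutable (rn t) x (rnf B)" using 9 by (simp add: substitutable_rnf)
  have r: "rnf (subst x t B) = subst x (rn t) (rnf B)" using 9 by (simp add: rnf_subst)
  have "Fm (subst x (rn t) (rnf B)) \<in> W"
    using subst_W[OF _ _ rn_T s] children_W[OF 9(5)] 9(4) by simp
  then have "X (subst x (rn t) (rnf B))" using 9 r by simp
  then show ?case
    using X_step[OF rules1_CL[OF 9(5), of x "rn t"], of "subst x (rn t) (rnf B)" "subst x (rn t) (rnf B)"]
      9 s rn_T by auto
qed

text \<open>Eliminations do not lead out of the core. The delicate one is modus ponens, whose minor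
  premise may have been built by introductions. Being a child of a local implication it is local
  itself, and \<open>intro_closure_X'\<close> brings it back into the core.\<close>

lemma X'_elim:
  shows X'_Conj: "X' (Conj B C) \<Longrightarrow> X' B \<and> X' C"
    and X'_Disj: "X' (Disj B B) \<Longrightarrow> X' B"
    and X'_Imp: "X' (Imp B C) \<Longrightarrow> intro_closure X' B \<Longrightarrow> X' C"
    and X'_All: "X' (All x B) \<Longrightarrow> substitutable t x B \<Longrightarrow> X' (subst x t B)"
    and X'_Ex: "X' (Ex x B) \<Longrightarrow> x \<notin> fv B \<Longrightarrow> X' B"
proof -
  assume a: "X' (Conj B C)"
  then have w: "Fm (Conj (rnf B) (rnf C)) \<in> W" using X_W by (auto simp: X'_def)
  show "X' B \<and> X' C"
    using X_step[OF rules0_CL[OF w], of "Conj (rnf B) (rnf C)" "Conj (rnf B) (rnf C)"] a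
    by (auto simp: X'_def)
next
  assume a: "X' (Disj B B)"
  then have w: "Fm (Disj (rnf B) (rnf B)) \<in> W" using X_W by (auto simp: X'_def)
  show "X' B"
    using X_step[OF rules0_CL[OF w], of "Disj (rnf B) (rnf B)" "Disj (rnf B) (rnf B)"] a
    by (auto simp: X'_def)
next
  assume a: "X' (Imp B C)" "intro_closure X' B"
  then have w: "Fm (Imp (rnf B) (rnf C)) \<in> W" using X_W by (auto simp: X'_def)
  have "X (rnf B)" using intro_closure_X'[OF a(2)] a(1) children_W[OF w] by (simp add: X'_def)
  then show "X' C"
    using X_step[OF rules0_CL[OF w], of "rnf B" "Imp (rnf B) (rnf C)"] a(1)
    by (auto simp: X'_def)
next
  assume a: "X' (All x B)" "substitutable t x B"
  then have w: "Fm (All x (rnf B)) \<in> W" using X_W by (auto simp: X'_def)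
  have v: "x \<in> V" "bv B \<subseteq> V" using a(1) by (auto simp: X'_def)
  have "substitutable (rn t) x (rnf B)" using v a by (simp add: substitutable_rnf)
  then show "X' (subst x t B)"
    using X_step[OF rules1_CL[OF w, of x "rn t"], of "All x (rnf B)" "All x (rnf B)"] a(1) v rn_T
    by (auto simp: X'_def rnf_subst)
next
  assume a: "X' (Ex x B)" "x \<notin> fv B"
  then have w: "Fm (Ex x (rnf B)) \<in> W" using X_W by (auto simp: X'_def)
  have v: "x \<in> V" "bv B \<subseteq> V" using a(1) by (auto simp: X'_def)
  have "x \<notin> fv (rnf B)" using v a by (simp add: fv_rnf)
  then have "subst x (Var f) (rnf B) = rnf B" "substitutable (Var f) x (rnf B)"
    by (simp_all add: subst_notin_fv substitutable_notin_fv)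
  then show "X' B"
    using X_step[OF rules1_CL[OF w, of x "Var f"], of "Ex x (rnf B)" "Ex x (rnf B)"] a(1) v fresh
    by (auto simp: X'_def)
qed

text \<open>If the major premise of an elimination is in the core, \<open>X'_elim\<close> applies.
  If its connective has just been introduced, the conclusion is a premise of that introduction; for
  the axiom \<open>Imp B B\<close> it is the minor premise. Ex falso is excluded by the assumption,
  because \<open>Bot\<close> can enter the closure only through the core.\<close>

lemma complete:
  assumes "\<not> X Bot"
  shows "qpl L H B \<Longrightarrow> intro_closure X' B"
proof (induction rule: qpl.induct)
  case (hyp B)
  then have "(Fm Top, Fm Top, Fm B) \<in> CL" by (simp add: clauses_def)
  then have "X B" using horn_base horn_step by metis
  moreover have "renamef T f B = B" using trms_S hyp by (intro renamef_id) auto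
  ultimately show ?case using bv_S[of B] hyp by (auto simp: X'_def intro: intro_closure.intros)
next
  case (conjE1 B C)
  from conjE1(2) show ?case using X'_Conj[of B C] by (auto elim!: intro_closure_ConjE intro: intro_closure.intros)
next
  case (conjE2 B C)
  from conjE2(2) show ?case using X'_Conj[of B C] by (auto elim!: intro_closure_ConjE intro: intro_closure.intros)
next
  case (disjE B)
  from disjE(2) show ?case using X'_Disj[of B] by (auto elim!: intro_closure_DisjE intro: intro_closure.intros)
next
  case (impE B C)
  from impE(4,3) show ?case using X'_Imp[of B C] by (auto elim!: intro_closure_ImpE intro: intro_closure.intros)
next
  case (botE B)
  from botE(3) have "X' Bot" by (auto elim: intro_closure_BotE)
  then show ?case using assms by (simp add: X'_def)
next
  case (allE x B t)
  from allE(4) show ?case using X'_All[of x B t] allE(3)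
    by (auto elim!: intro_closure_AllE intro: intro_closure.intros simp: subst_notin_fv)
next
  case (exE x B)
  from exE(3) show ?case using X'_Ex[of x B] exE(2)
    by (auto elim!: intro_closure_ExE intro: intro_closure.intros simp: subst_notin_fv)
qed (auto intro: intro_closure.intros)

theorem qpl_iff: "qpl L H Q \<longleftrightarrow> X Q \<or> X Bot"
proof
  assume q: "qpl L H Q"
  show "X Q \<or> X Bot"
  proof (rule ccontr)
    assume n: "\<not> (X Q \<or> X Bot)"
    then have "intro_closure X' Q" using complete q by simp
    moreover have "renamef T f Q = Q" using trms_S by (intro renamef_id) auto
    ultimately have "X Q" using intro_closure_X'[of Q] bv_S[of Q] in_W by simp
    then show False using n by simp
  qed
next
  assume "X Q \<or> X Bot"
  then show "qpl L H Q" using horn_sound in_W(2) wf_W by (blast intro: qpl.botE)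
qed

end

section \<open>Objects, parsing, and the number of instances\<close>

definition ix :: "'a list \<Rightarrow> 'a \<Rightarrow> nat" where
  "ix os ob = length (takeWhile (\<lambda>y. y \<noteq> ob) os)"

lemma ix_less: "ob \<in> set os \<Longrightarrow> ix os ob < length os"
proof -
  assume "ob \<in> set os"
  then have "takeWhile (\<lambda>y. y \<noteq> ob) os \<noteq> os" by (metis (mono_tags) set_takeWhileD)
  then show ?thesis unfolding ix_def using length_takeWhile_le[of "\<lambda>y. y \<noteq> ob" os]
    takeWhile_eq_take[of "\<lambda>y. y \<noteq> ob" os] by (cases "length (takeWhile (\<lambda>y. y \<noteq> ob) os) = length os") auto
qed

lemma nth_ix: "ob \<in> set os \<Longrightarrow> os ! ix os ob = ob"
  unfolding ix_def using nth_length_takeWhile[of "\<lambda>y. y \<noteq> ob" os] ix_less[of ob os]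
  by (auto simp: ix_def)

lemma ix_append: "ob \<in> set os \<Longrightarrow> ix (os @ zs) ob = ix os ob"
  unfolding ix_def by (simp add: takeWhile_append1)

lemma ix_new: "ob \<notin> set os \<Longrightarrow> ix (os @ [ob]) ob = length os"
proof -
  assume "ob \<notin> set os"
  then have "takeWhile (\<lambda>y. y \<noteq> ob) (os @ [ob]) = os @ takeWhile (\<lambda>y. y \<noteq> ob) [ob]"
    by (intro takeWhile_append2) auto
  then show ?thesis by (simp add: ix_def)
qed

lemma ix_nth: "distinct os \<Longrightarrow> i < length os \<Longrightarrow> ix os (os ! i) = i"
  using ix_less[of "os ! i" os] nth_ix[of "os ! i" os]
  by (simp add: nth_eq_iff_index_eq)

lemma ix_inj: "ob \<in> set os \<Longrightarrow> ob' \<in> set os \<Longrightarrow> ix os ob = ix os ob' \<longleftrightarrow> ob = ob'"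
  by (metis nth_ix)

text \<open>
  The kinds of nodes are those of the symbols on the tape, with 0 for \<open>Fail\<close> and 11 for the empty
  argument list; for formulas without children the other components are 0.
\<close>

fun code :: "obj list \<Rightarrow> obj \<Rightarrow> nat \<times> nat \<times> nat" where
  "code os Fail = (0, 0, 0)"
| "code os (Fm Top) = (1, 0, 0)"
| "code os (Fm Bot) = (2, 0, 0)"
| "code os (Fm (Conj B C)) = (3, ix os (Fm B), ix os (Fm C))"
| "code os (Fm (Disj B C)) = (4, ix os (Fm B), ix os (Fm C))"
| "code os (Fm (Imp B C)) = (5, ix os (Fm B), ix os (Fm C))"
| "code os (Fm (All x B)) = (6, x, ix os (Fm B))"
| "code os (Fm (Ex x B)) = (7, x, ix os (Fm B))"
| "code os (Args (Var x # ts)) = (8, x, ix os (Args ts))"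
| "code os (Args (Cst c # ts)) = (9, c, ix os (Args ts))"
| "code os (Fm (Rel R ts)) = (10, R, ix os (Args ts))"
| "code os (Args []) = (11, 0, 0)"

lemma code_append: "children ob \<subseteq> set os \<Longrightarrow> code (os @ zs) ob = code os ob"
  by (cases "(os, ob)" rule: code.cases) (auto simp: ix_append)

text \<open>This justifies the sharing: once the children are numbered, equality of objects is
  equality of triples, and a node is found by comparing three words.\<close>

lemma code_inj:
  "children ob \<subseteq> set os \<Longrightarrow> children ob' \<subseteq> set os \<Longrightarrow> code os ob = code os ob' \<longleftrightarrow> ob = ob'"
  by (cases "(os, ob)" rule: code.cases; cases "(os, ob')" rule: code.cases) (simp_all add: ix_inj)

definition base :: "obj list" where
  "base = [Fail, Fm Top, Fm Bot, Args []]"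

text \<open>Children stand before their parents, so a scan in table order meets a node only after
  the substitution rows of its children are complete. The fixed prefix gives the constants 0 to 3 as
  numbers of the four objects that programs refer to directly.\<close>

definition okl :: "obj list \<Rightarrow> bool" where
  "okl os \<longleftrightarrow> distinct os \<and> (\<forall>i < length os. children (os ! i) \<subseteq> set (take i os)) \<and>
     (\<exists>zs. os = base @ zs)"

definition ins :: "obj list \<Rightarrow> obj \<Rightarrow> obj list" where
  "ins os ob = (if ob \<in> set os then os else os @ [ob])"

lemma set_ins [simp]: "set (ins os ob) = insert ob (set os)"
  by (auto simp: ins_def)

lemma ins_extends: "\<exists>zs. ins os ob = os @ zs"
  by (auto simp: ins_def)

lemma okl_children: "okl os \<Longrightarrow> ob \<in> set os \<Longrightarrow> children ob \<subseteq> set os"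
  unfolding okl_def in_set_conv_nth using set_take_subset[of _ os] by blast

lemma okl_ins: "okl os \<Longrightarrow> children ob \<subseteq> set os \<Longrightarrow> okl (ins os ob)"
proof (cases "ob \<in> set os")
  case False
  assume a: "okl os" "children ob \<subseteq> set os"
  have "children ((os @ [ob]) ! i) \<subseteq> set (take i (os @ [ob]))" if "i < length (os @ [ob])" for i
    using that a by (cases "i < length os") (auto simp: okl_def nth_append)
  then show ?thesis using a False by (auto simp: okl_def ins_def)
qed (simp add: ins_def)

lemma okl_base: "okl base"
  unfolding okl_def base_def by (auto simp: less_Suc_eq nth_Cons')

lemma okl_in: "okl os \<Longrightarrow> Fail \<in> set os \<and> Fm Top \<in> set os \<and> Fm Bot \<in> set os \<and> Args [] \<in> set os"
  by (auto simp: okl_def base_def)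

lemma okl_ix:
  assumes "okl os"
  shows "ix os Fail = 0" "ix os (Fm Top) = 1" "ix os (Fm Bot) = 2" "ix os (Args []) = 3"
proof -
  obtain zs where "os = base @ zs" using assms by (auto simp: okl_def)
  then show "ix os Fail = 0" "ix os (Fm Top) = 1" "ix os (Fm Bot) = 2" "ix os (Args []) = 3"
    by (simp_all add: base_def ix_def)
qed

lemma ix_eq_0: "okl os \<Longrightarrow> ob \<in> set os \<Longrightarrow> ix os ob = 0 \<longleftrightarrow> ob = Fail"
  using okl_ix(1) okl_in ix_inj by metis

lemma okl_child_less:
  assumes "okl os" "i < length os" "c \<in> children (os ! i)"
  shows "ix os c < i"
proof -
  have c: "c \<in> set (take i os)" using assms by (auto simp: okl_def)
  then have "ix os c = ix (take i os) c" using ix_append[OF c, of "drop i os"] by simp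
  then show ?thesis using ix_less[OF c] by simp
qed

section \<open>Parsing from right to left\<close>

fun skind :: "symbol \<Rightarrow> nat" where
  "skind TopS = 1" | "skind BotS = 2" | "skind ConjS = 3" | "skind DisjS = 4" | "skind ImpS = 5"
| "skind AllS = 6" | "skind ExS = 7" | "skind (VarS i) = 8" | "skind (CstS i) = 9"
| "skind (RelS i) = 10" | "skind Comma = 11"

fun sidx :: "symbol \<Rightarrow> nat" where
  "sidx (VarS i) = i" | "sidx (CstS i) = i" | "sidx (RelS i) = i" | "sidx _ = 0"

lemma symbol_words_eq: "symbol_words s = [skind s, sidx s]"
  by (cases s) auto

lemma skind_pos [simp]: "skind s \<noteq> 0" "0 < skind s"
  by (cases s; simp)+

text \<open>
  The prefix notation is parsed from right to left with a stack of formulas; \<open>pd\<close> collects the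
  terms read since the last symbol that is not a term.
\<close>

type_synonym pstate = "obj list \<times> fm list \<times> trm list \<times> nat list \<times> trm list"

fun pstep :: "symbol \<Rightarrow> pstate option \<Rightarrow> pstate option" where
  "pstep TopS (Some (os, stk, pd, vs, ts)) = Some (ins os (Fm Top), Top # stk, pd, vs, ts)"
| "pstep BotS (Some (os, stk, pd, vs, ts)) = Some (ins os (Fm Bot), Bot # stk, pd, vs, ts)"
| "pstep ConjS (Some (os, B # C # stk, pd, vs, ts)) =
    Some (ins os (Fm (Conj B C)), Conj B C # stk, pd, vs, ts)"
| "pstep DisjS (Some (os, B # C # stk, pd, vs, ts)) =
    Some (ins os (Fm (Disj B C)), Disj B C # stk, pd, vs, ts)"
| "pstep ImpS (Some (os, B # C # stk, pd, vs, ts)) =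
    Some (ins os (Fm (Imp B C)), Imp B C # stk, pd, vs, ts)"
| "pstep AllS (Some (os, B # stk, [Var x], vs, ts)) =
    Some (ins os (Fm (All x B)), All x B # stk, [], vs @ [x], ts)"
| "pstep ExS (Some (os, B # stk, [Var x], vs, ts)) =
    Some (ins os (Fm (Ex x B)), Ex x B # stk, [], vs @ [x], ts)"
| "pstep (VarS x) (Some (os, stk, pd, vs, ts)) =
    Some (ins os (Args (Var x # pd)), stk, Var x # pd, vs, ts @ [Var x])"
| "pstep (CstS c) (Some (os, stk, pd, vs, ts)) =
    Some (ins os (Args (Cst c # pd)), stk, Cst c # pd, vs, ts @ [Cst c])"
| "pstep (RelS R) (Some (os, stk, pd, vs, ts)) =
    Some (ins os (Fm (Rel R pd)), Rel R pd # stk, [], vs, ts)"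
| "pstep Comma (Some (os, stk, pd, vs, ts)) = Some (os, stk, pd, vs, ts)"
| "pstep _ _ = None"

lemma fold_pstep_None [simp]: "fold pstep ss None = None"
  by (induction ss) auto

fun asubs :: "trm list \<Rightarrow> obj set" where
  "asubs [] = {}"
| "asubs (t # ts) = insert (Args (t # ts)) (asubs ts)"

text \<open>\<open>Args [Var x]\<close> is listed for a binder because the parser reads the variable
  as a pending term before it meets the quantifier symbol. Each symbol still accounts for at most
  one object, which is what \<open>card_subs\<close> needs.\<close>

fun subs :: "fm \<Rightarrow> obj set" where
  "subs Top = {Fm Top}"
| "subs Bot = {Fm Bot}"
| "subs (Rel R ts) = insert (Fm (Rel R ts)) (asubs ts)"
| "subs (Conj B C) = insert (Fm (Conj B C)) (subs B \<union> subs C)"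
| "subs (Disj B C) = insert (Fm (Disj B C)) (subs B \<union> subs C)"
| "subs (Imp B C) = insert (Fm (Imp B C)) (subs B \<union> subs C)"
| "subs (All x B) = {Fm (All x B), Args [Var x]} \<union> subs B"
| "subs (Ex x B) = {Fm (Ex x B), Args [Var x]} \<union> subs B"

lemma finite_asubs [simp]: "finite (asubs ts)"
  by (induction ts) auto

lemma finite_subs [simp]: "finite (subs B)"
  by (induction B) auto

lemma card_insert_le_Suc: "card S \<le> n \<Longrightarrow> card (insert a S) \<le> Suc n"
  by (cases "finite S") (auto simp: card_insert_if)

lemma card_asubs: "card (asubs ts) \<le> length ts"
  by (induction ts) (auto simp: card_insert_le_Suc)

lemma card_subs: "card (subs B) \<le> fm_length B"
proof (induction B)
  case (Rel R ts)
  then show ?case using card_asubs[of ts] by (simp add: fm_length_def card_insert_le_Suc)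
next
  case (Conj B C)
  then show ?case using card_Un_le[of "subs B" "subs C"]
    by (auto simp: fm_length_def intro!: card_insert_le_Suc)
next
  case (Disj B C)
  then show ?case using card_Un_le[of "subs B" "subs C"]
    by (auto simp: fm_length_def intro!: card_insert_le_Suc)
next
  case (Imp B C)
  then show ?case using card_Un_le[of "subs B" "subs C"]
    by (auto simp: fm_length_def intro!: card_insert_le_Suc)
qed (auto simp: fm_length_def intro!: card_insert_le_Suc)

lemma Fm_in_subs: "Fm B \<in> subs B"
  by (cases B) auto

lemma parse_terms:
  "\<exists>os'. fold pstep (map trm_symbol (rev ts)) (Some (os, stk, pd, vs, us)) =
     Some (os', stk, ts @ pd, vs, us @ rev ts) \<and>
     (pd = [] \<longrightarrow> set os' = set os \<union> asubs ts)"
proof (induction ts)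
  case Nil
  then show ?case by simp
next
  case (Cons t ts)
  then obtain os' where "fold pstep (map trm_symbol (rev ts)) (Some (os, stk, pd, vs, us)) =
     Some (os', stk, ts @ pd, vs, us @ rev ts)" "pd = [] \<longrightarrow> set os' = set os \<union> asubs ts" by auto
  then show ?case by (cases t) auto
qed

definition grows :: "fm \<Rightarrow> obj list \<Rightarrow> nat list \<Rightarrow> trm list \<Rightarrow> obj list \<Rightarrow> nat list \<Rightarrow> trm list \<Rightarrow> bool" where
  "grows B os vs us os' vs' us' \<longleftrightarrow> set os' = set os \<union> subs B \<and>
     set vs' = set vs \<union> bv B \<and> set us' = set us \<union> trms B \<and>
     length vs' \<le> length vs + fm_length B \<and> length us' \<le> length us + fm_length B"

lemma parse_fm:
  "\<exists>os' vs' us'. fold pstep (rev (fm_string B)) (Some (os, stk, [], vs, us)) =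
     Some (os', B # stk, [], vs', us') \<and> grows B os vs us os' vs' us'"
proof (induction B arbitrary: os stk vs us)
  case (Rel R ts)
  then show ?case using parse_terms[of ts os stk "[]" vs us]
    by (auto simp: rev_map fm_length_def grows_def)
next
  case (Conj B C)
  obtain os1 vs1 us1 where
    1: "fold pstep (rev (fm_string C)) (Some (os, stk, [], vs, us)) = Some (os1, C # stk, [], vs1, us1)"
      "grows C os vs us os1 vs1 us1"
    using Conj.IH(2) by blast
  obtain os2 vs2 us2 where "fold pstep (rev (fm_string B)) (Some (os1, C # stk, [], vs1, us1)) =
        Some (os2, B # C # stk, [], vs2, us2)" "grows B os1 vs1 us1 os2 vs2 us2"
    using Conj.IH(1) by blast
  with 1 show ?case by (auto simp: fm_length_def grows_def)
next
  case (Disj B C)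
  obtain os1 vs1 us1 where
    1: "fold pstep (rev (fm_string C)) (Some (os, stk, [], vs, us)) = Some (os1, C # stk, [], vs1, us1)"
      "grows C os vs us os1 vs1 us1"
    using Disj.IH(2) by blast
  obtain os2 vs2 us2 where "fold pstep (rev (fm_string B)) (Some (os1, C # stk, [], vs1, us1)) =
        Some (os2, B # C # stk, [], vs2, us2)" "grows B os1 vs1 us1 os2 vs2 us2"
    using Disj.IH(1) by blast
  with 1 show ?case by (auto simp: fm_length_def grows_def)
next
  case (Imp B C)
  obtain os1 vs1 us1 where
    1: "fold pstep (rev (fm_string C)) (Some (os, stk, [], vs, us)) = Some (os1, C # stk, [], vs1, us1)"
      "grows C os vs us os1 vs1 us1"
    using Imp.IH(2) by blast
  obtain os2 vs2 us2 where "fold pstep (rev (fm_string B)) (Some (os1, C # stk, [], vs1, us1)) =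
        Some (os2, B # C # stk, [], vs2, us2)" "grows B os1 vs1 us1 os2 vs2 us2"
    using Imp.IH(1) by blast
  with 1 show ?case by (auto simp: fm_length_def grows_def)
next
  case (All x B)
  obtain os1 vs1 us1 where
    "fold pstep (rev (fm_string B)) (Some (os, stk, [], vs, us)) = Some (os1, B # stk, [], vs1, us1)"
      "grows B os vs us os1 vs1 us1"
    using All.IH by blast
  then show ?case by (simp add: fm_length_def insert_commute grows_def)
next
  case (Ex x B)
  obtain os1 vs1 us1 where
    "fold pstep (rev (fm_string B)) (Some (os, stk, [], vs, us)) = Some (os1, B # stk, [], vs1, us1)"
      "grows B os vs us os1 vs1 us1"
    using Ex.IH by blast
  then show ?case by (simp add: fm_length_def insert_commute grows_def)
qed (auto simp: fm_length_def grows_def)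

lemma parse_hyps:
  "\<exists>os' vs' us'. fold pstep (rev (concat (map (\<lambda>B. fm_string B @ [Comma]) hs)))
       (Some (os, stk, [], vs, us)) = Some (os', hs @ stk, [], vs', us') \<and>
     set os' = set os \<union> (\<Union>B\<in>set hs. subs B) \<and>
     set vs' = set vs \<union> (\<Union>B\<in>set hs. bv B) \<and> set us' = set us \<union> (\<Union>B\<in>set hs. trms B) \<and>
     length vs' \<le> length vs + sum_list (map fm_length hs) \<and>
     length us' \<le> length us + sum_list (map fm_length hs)"
proof (induction hs)
  case Nil
  then show ?case by simp
next
  case (Cons B hs)
  from Cons.IH obtain os1 vs1 us1 where
    1: "fold pstep (rev (concat (map (\<lambda>B. fm_string B @ [Comma]) hs)))
       (Some (os, stk, [], vs, us)) = Some (os1, hs @ stk, [], vs1, us1)"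
     "set os1 = set os \<union> (\<Union>B\<in>set hs. subs B)"
     "set vs1 = set vs \<union> (\<Union>B\<in>set hs. bv B)" "set us1 = set us \<union> (\<Union>B\<in>set hs. trms B)"
     "length vs1 \<le> length vs + sum_list (map fm_length hs)"
     "length us1 \<le> length us + sum_list (map fm_length hs)"
    by (elim HOL.exE HOL.conjE) (rule that)
  obtain os2 vs2 us2 where
    2: "fold pstep (rev (fm_string B)) (Some (os1, hs @ stk, [], vs1, us1)) =
        Some (os2, B # hs @ stk, [], vs2, us2)" "grows B os1 vs1 us1 os2 vs2 us2"
    using parse_fm by blast
  have "fold pstep (rev (concat (map (\<lambda>B. fm_string B @ [Comma]) (B # hs))))
       (Some (os, stk, [], vs, us)) = Some (os2, (B # hs) @ stk, [], vs2, us2)"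
    using 1(1) 2(1) by simp
  then show ?case
    by (intro HOL.exI[of _ os2] HOL.exI[of _ vs2] HOL.exI[of _ us2]) (use 1(2-) 2(2) in \<open>auto simp: grows_def\<close>)
qed

lemma parse_instance:
  "\<exists>os vs us. fold pstep (rev (instance_string hs Q)) (Some (base, [], [], [], [])) =
      Some (os, hs @ [Q], [], vs, us) \<and>
     set os = set base \<union> (\<Union>B\<in>insert Q (set hs). subs B) \<and>
     set vs = (\<Union>B\<in>insert Q (set hs). bv B) \<and> set us = (\<Union>B\<in>insert Q (set hs). trms B) \<and>
     length vs \<le> fm_length Q + sum_list (map fm_length hs) \<and>
     length us \<le> fm_length Q + sum_list (map fm_length hs)"
proof -
  obtain os1 vs1 us1 where
    1: "fold pstep (rev (fm_string Q)) (Some (base, [], [], [], [])) = Some (os1, [Q], [], vs1, us1)"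
      "grows Q base [] [] os1 vs1 us1"
    using parse_fm by blast
  from parse_hyps[of hs os1 "[Q]" vs1 us1] obtain os2 vs2 us2 where
    2: "fold pstep (rev (concat (map (\<lambda>B. fm_string B @ [Comma]) hs)))
       (Some (os1, [Q], [], vs1, us1)) = Some (os2, hs @ [Q], [], vs2, us2)"
     "set os2 = set os1 \<union> (\<Union>B\<in>set hs. subs B)"
     "set vs2 = set vs1 \<union> (\<Union>B\<in>set hs. bv B)" "set us2 = set us1 \<union> (\<Union>B\<in>set hs. trms B)"
     "length vs2 \<le> length vs1 + sum_list (map fm_length hs)"
     "length us2 \<le> length us1 + sum_list (map fm_length hs)"
    by (elim HOL.exE HOL.conjE) (rule that)
  have "fold pstep (rev (instance_string hs Q)) (Some (base, [], [], [], [])) =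
      Some (os2, hs @ [Q], [], vs2, us2)"
    unfolding instance_string_def rev_append fold_append comp_def 1(1) 2(1) ..
  then show ?thesis
    by (intro HOL.exI[of _ os2] HOL.exI[of _ vs2] HOL.exI[of _ us2]) (use 1 2 in \<open>auto simp: grows_def\<close>)
qed

text \<open>
  The pairs \<open>(x, t)\<close> are applied one after the other, but every formula that arises is obtained from
  a subformula of the instance by one simultaneous substitution; this is what bounds their number.
\<close>

fun inst_trm :: "(nat \<Rightarrow> trm) \<Rightarrow> trm \<Rightarrow> trm" where
  "inst_trm \<rho> (Var x) = \<rho> x"
| "inst_trm \<rho> (Cst c) = Cst c"

fun inst :: "(nat \<Rightarrow> trm) \<Rightarrow> fm \<Rightarrow> fm" where
  "inst \<rho> Top = Top"
| "inst \<rho> Bot = Bot"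
| "inst \<rho> (Rel R ts) = Rel R (map (inst_trm \<rho>) ts)"
| "inst \<rho> (Conj B C) = Conj (inst \<rho> B) (inst \<rho> C)"
| "inst \<rho> (Disj B C) = Disj (inst \<rho> B) (inst \<rho> C)"
| "inst \<rho> (Imp B C) = Imp (inst \<rho> B) (inst \<rho> C)"
| "inst \<rho> (All y B) = All y (inst (\<rho>(y := Var y)) B)"
| "inst \<rho> (Ex y B) = Ex y (inst (\<rho>(y := Var y)) B)"

text \<open>This is the simultaneous counterpart of \<open>substitutable\<close>. As there, only
  variables free below the quantifier matter; the values of \<rho> at other variables may well be
  the bound variable, since later pairs continue to change them.\<close>

fun capture_free :: "(nat \<Rightarrow> trm) \<Rightarrow> fm \<Rightarrow> bool" where
  "capture_free \<rho> (Conj B C) = (capture_free \<rho> B \<and> capture_free \<rho> C)"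
| "capture_free \<rho> (Disj B C) = (capture_free \<rho> B \<and> capture_free \<rho> C)"
| "capture_free \<rho> (Imp B C) = (capture_free \<rho> B \<and> capture_free \<rho> C)"
| "capture_free \<rho> (All y B) = ((\<forall>z \<in> fv B - {y}. \<rho> z \<noteq> Var y) \<and> capture_free (\<rho>(y := Var y)) B)"
| "capture_free \<rho> (Ex y B) = ((\<forall>z \<in> fv B - {y}. \<rho> z \<noteq> Var y) \<and> capture_free (\<rho>(y := Var y)) B)"
| "capture_free \<rho> _ = True"

lemma inst_trm_Var [simp]: "inst_trm Var t = t"
  by (cases t) auto

lemma inst_Var [simp]: "inst Var B = B"
  by (induction B) (auto intro: map_idI)

lemma capture_free_Var [simp]: "capture_free Var B"
  by (induction B) auto

lemma inst_capture_free_cong: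
  "(\<And>z. z \<in> fv B \<Longrightarrow> \<rho> z = \<rho>' z) \<Longrightarrow> inst \<rho> B = inst \<rho>' B \<and> capture_free \<rho> B = capture_free \<rho>' B"
proof (induction B arbitrary: \<rho> \<rho>')
  case (Rel R ts)
  have "inst_trm \<rho> t = inst_trm \<rho>' t" if "t \<in> set ts" for t
    using Rel[of "case t of Var x \<Rightarrow> x"] that by (cases t) auto
  then show ?case by simp
next
  case (All y B)
  have "inst (\<rho>(y := Var y)) B = inst (\<rho>'(y := Var y)) B \<and>
      capture_free (\<rho>(y := Var y)) B = capture_free (\<rho>'(y := Var y)) B"
    by (rule All.IH) (use All.prems in auto)
  then show ?case using All.prems by auto
next
  case (Ex y B)
  have "inst (\<rho>(y := Var y)) B = inst (\<rho>'(y := Var y)) B \<and>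
      capture_free (\<rho>(y := Var y)) B = capture_free (\<rho>'(y := Var y)) B"
    by (rule Ex.IH) (use Ex.prems in auto)
  then show ?case using Ex.prems by auto
next
  case (Conj B C)
  show ?case using Conj.IH[of \<rho> \<rho>'] Conj.prems by simp
next
  case (Disj B C)
  show ?case using Disj.IH[of \<rho> \<rho>'] Disj.prems by simp
next
  case (Imp B C)
  show ?case using Imp.IH[of \<rho> \<rho>'] Imp.prems by simp
qed auto

abbreviation subst_trm :: "nat \<Rightarrow> trm \<Rightarrow> trm \<Rightarrow> trm" where
  "subst_trm x t s \<equiv> (if s = Var x then t else s)"

lemma fv_inst: "capture_free \<rho> B \<Longrightarrow> x \<in> fv (inst \<rho> B) \<longleftrightarrow> (\<exists>z \<in> fv B. \<rho> z = Var x)"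
proof (induction B arbitrary: \<rho>)
  case (Rel R ts)
  have "Var x \<in> inst_trm \<rho> ` set ts \<longleftrightarrow> (\<exists>z. Var z \<in> set ts \<and> \<rho> z = Var x)"
  proof
    assume "Var x \<in> inst_trm \<rho> ` set ts"
    then obtain t where t: "t \<in> set ts" "inst_trm \<rho> t = Var x" by (elim imageE) simp
    have "\<exists>z. t = Var z" using t(2) by (cases t) auto
    with t show "\<exists>z. Var z \<in> set ts \<and> \<rho> z = Var x" by auto
  qed force
  then show ?case by simp
next
  case (All y B)
  have "capture_free (\<rho>(y := Var y)) B" using All.prems by simp
  from All.IH[OF this]
  have "x \<in> fv (inst (\<rho>(y := Var y)) B) \<longleftrightarrow> (\<exists>z\<in>fv B. (\<rho>(y := Var y)) z = Var x)" .
  then show ?case using All.prems by auto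
next
  case (Ex y B)
  have "capture_free (\<rho>(y := Var y)) B" using Ex.prems by simp
  from Ex.IH[OF this]
  have "x \<in> fv (inst (\<rho>(y := Var y)) B) \<longleftrightarrow> (\<exists>z\<in>fv B. (\<rho>(y := Var y)) z = Var x)" .
  then show ?case using Ex.prems by auto
qed auto

text \<open>One argument serves both quantifiers. If \<open>x\<close> is not free in the
  instantiated quantified formula, the substitution is vacuous and the composed environment agrees
  with the old one on the free variables of \<open>B\<close>. Otherwise \<open>x\<close> differs
  from \<open>y\<close>, and composing with the substitution commutes with resetting
  \<open>y\<close>.\<close>

lemma subst_inst_binder:
  assumes IH: "\<And>\<rho>. capture_free \<rho> B \<Longrightarrow> substitutable t x (inst \<rho> B) \<Longrightarrow>
      subst x t (inst \<rho> B) = inst (\<lambda>z. subst_trm x t (\<rho> z)) B \<and>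
      capture_free (\<lambda>z. subst_trm x t (\<rho> z)) B"
    and cf: "\<forall>z \<in> fv B - {y}. \<rho> z \<noteq> Var y" "capture_free (\<rho>(y := Var y)) B"
    and s: "x \<notin> fv (inst (\<rho>(y := Var y)) B) - {y} \<or>
      t \<noteq> Var y \<and> substitutable t x (inst (\<rho>(y := Var y)) B)"
  defines "\<sigma> \<equiv> \<lambda>z. subst_trm x t (\<rho> z)"
  shows "(if y = x then inst (\<rho>(y := Var y)) B else subst x t (inst (\<rho>(y := Var y)) B)) =
      inst (\<sigma>(y := Var y)) B" (is ?A)
    and "(\<forall>z \<in> fv B - {y}. \<sigma> z \<noteq> Var y) \<and> capture_free (\<sigma>(y := Var y)) B" (is ?B)
proof -
  let ?\<rho> = "\<rho>(y := Var y)"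
  have "?A \<and> ?B"
  proof (cases "x \<in> fv (inst ?\<rho> B) - {y}")
    case False
    have eq: "(\<sigma>(y := Var y)) z = ?\<rho> z" if "z \<in> fv B" for z
      using False cf that fv_inst[OF cf(2), of x] by (auto simp: \<sigma>_def)
    have "y \<noteq> x \<Longrightarrow> subst x t (inst ?\<rho> B) = inst ?\<rho> B" using False by (simp add: subst_notin_fv)
    moreover have "\<forall>z \<in> fv B - {y}. \<sigma> z \<noteq> Var y" using eq cf(1) by fastforce
    moreover have "inst (\<sigma>(y := Var y)) B = inst ?\<rho> B \<and>
        capture_free (\<sigma>(y := Var y)) B = capture_free ?\<rho> B"
      by (rule inst_capture_free_cong) (rule eq)
    ultimately show ?thesis using cf(2) by auto
  next
    case True
    then have t: "t \<noteq> Var y" "substitutable t x (inst ?\<rho> B)" "y \<noteq> x" using s by auto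
    have eq: "(\<lambda>z. subst_trm x t (?\<rho> z)) = \<sigma>(y := Var y)" using t(3) by (auto simp: \<sigma>_def)
    show ?thesis using IH[OF cf(2) t(2)] cf(1) t unfolding eq by (auto simp: \<sigma>_def)
  qed
  then show ?A ?B by auto
qed

lemma subst_inst:
  "capture_free \<rho> B \<Longrightarrow> substitutable t x (inst \<rho> B) \<Longrightarrow>
     subst x t (inst \<rho> B) = inst (\<lambda>z. subst_trm x t (\<rho> z)) B \<and>
     capture_free (\<lambda>z. subst_trm x t (\<rho> z)) B"
proof (induction B arbitrary: \<rho>)
  case (Rel R ts)
  have "subst_trm x t (inst_trm \<rho> s) = inst_trm (\<lambda>z. subst_trm x t (\<rho> z)) s" for s
    by (cases s) auto
  then show ?case by simp
next
  case (All y B)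
  have cf: "\<forall>z \<in> fv B - {y}. \<rho> z \<noteq> Var y" "capture_free (\<rho>(y := Var y)) B"
    and s: "x \<notin> fv (inst (\<rho>(y := Var y)) B) - {y} \<or>
      t \<noteq> Var y \<and> substitutable t x (inst (\<rho>(y := Var y)) B)"
    using All.prems by auto
  show ?case using subst_inst_binder[OF All.IH cf s] by auto
next
  case (Ex y B)
  have cf: "\<forall>z \<in> fv B - {y}. \<rho> z \<noteq> Var y" "capture_free (\<rho>(y := Var y)) B"
    and s: "x \<notin> fv (inst (\<rho>(y := Var y)) B) - {y} \<or>
      t \<noteq> Var y \<and> substitutable t x (inst (\<rho>(y := Var y)) B)"
    using Ex.prems by auto
  show ?case using subst_inst_binder[OF Ex.IH cf s] by auto
qed auto

section \<open>Counting the instances\<close>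

definition envs :: "nat set \<Rightarrow> trm set \<Rightarrow> (nat \<Rightarrow> trm) set" where
  "envs V T = {\<rho>. (\<forall>x\<in>V. \<rho> x \<in> T) \<and> (\<forall>x. x \<notin> V \<longrightarrow> \<rho> x = Var x)}"

definition universe :: "nat set \<Rightarrow> trm set \<Rightarrow> obj set \<Rightarrow> obj set" where
  "universe V T S = {Fail} \<union>
     {Fm (inst \<rho> B) | \<rho> B. \<rho> \<in> envs V T \<and> capture_free \<rho> B \<and> Fm B \<in> S} \<union>
     {Args (map (inst_trm \<rho>) ts) | \<rho> ts. \<rho> \<in> envs V T \<and> Args ts \<in> S}"

lemma envs_image: "envs V T \<subseteq> (\<lambda>g x. if x \<in> V then g x else Var x) ` (V \<rightarrow>\<^sub>E T)"
proof
  fix \<rho> assume "\<rho> \<in> envs V T"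
  then have "\<rho> = (\<lambda>x. if x \<in> V then (restrict \<rho> V) x else Var x)" "restrict \<rho> V \<in> V \<rightarrow>\<^sub>E T"
    by (auto simp: envs_def)
  then show "\<rho> \<in> (\<lambda>g x. if x \<in> V then g x else Var x) ` (V \<rightarrow>\<^sub>E T)" by blast
qed

lemma card_envs:
  assumes "finite V" "finite T"
  shows "finite (envs V T)" "card (envs V T) \<le> card T ^ card V"
proof -
  have f: "finite (V \<rightarrow>\<^sub>E T)" using assms by (simp add: finite_PiE)
  show "finite (envs V T)" using finite_subset[OF envs_image] f by blast
  have "card (envs V T) \<le> card (V \<rightarrow>\<^sub>E T)"
    using surj_card_le[OF f envs_image] .
  then show "card (envs V T) \<le> card T ^ card V" using assms by (simp add: card_PiE)
qed

lemma card_universe: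
  assumes "finite V" "finite T" "finite S"
  shows "finite (universe V T S)" "card (universe V T S) \<le> 1 + card T ^ card V * card S"
proof -
  let ?g = "\<lambda>(\<rho>, ob). case ob of Fail \<Rightarrow> Fail | Fm B \<Rightarrow> Fm (inst \<rho> B)
    | Args ts \<Rightarrow> Args (map (inst_trm \<rho>) ts)"
  have sub: "universe V T S \<subseteq> insert Fail (?g ` (envs V T \<times> S))"
    unfolding universe_def by (force simp: image_iff split: obj.splits)
  have f: "finite (envs V T \<times> S)" using assms card_envs by simp
  then show "finite (universe V T S)" using finite_subset[OF sub] by blast
  have "card (universe V T S) \<le> card (insert Fail (?g ` (envs V T \<times> S)))"
    using card_mono[OF _ sub] f by blast
  also have "\<dots> \<le> Suc (card (?g ` (envs V T \<times> S)))" by (rule card_insert_le_Suc) simp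
  also have "\<dots> \<le> Suc (card (envs V T \<times> S))" using card_image_le[OF f] by simp
  also have "\<dots> \<le> 1 + card T ^ card V * card S"
    using card_envs[OF assms(1,2)] by (simp add: card_cartesian_product)
  finally show "card (universe V T S) \<le> 1 + card T ^ card V * card S" .
qed

locale closed_universe =
  fixes V :: "nat set" and T :: "trm set" and S :: "obj set"
  assumes V_T: "x \<in> V \<Longrightarrow> Var x \<in> T"
begin

lemma S_universe: "S \<subseteq> universe V T S"
proof
  fix ob assume "ob \<in> S"
  moreover have "Var \<in> envs V T" using V_T by (auto simp: envs_def)
  moreover have "ts = map (inst_trm Var) ts" for ts by (simp add: map_idI)
  moreover have "B = inst Var B \<and> capture_free Var B" for B by simp
  ultimately show "ob \<in> universe V T S"
    unfolding universe_def by (cases ob) blast+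
qed

lemma envs_comp: "\<rho> \<in> envs V T \<Longrightarrow> x \<in> V \<Longrightarrow> t \<in> T \<Longrightarrow> (\<lambda>z. subst_trm x t (\<rho> z)) \<in> envs V T"
  by (auto simp: envs_def)

lemma in_universe_Fm: "\<rho> \<in> envs V T \<Longrightarrow> capture_free \<rho> B \<Longrightarrow> Fm B \<in> S \<Longrightarrow> Fm (inst \<rho> B) \<in> universe V T S"
  unfolding universe_def by blast

lemma in_universe_Args: "\<rho> \<in> envs V T \<Longrightarrow> Args ts \<in> S \<Longrightarrow> Args (map (inst_trm \<rho>) ts) \<in> universe V T S"
  unfolding universe_def by blast

lemma universe_osub:
  assumes "ob \<in> universe V T S" "x \<in> V" "t \<in> T"
  shows "osub (x, t) ob \<in> universe V T S"
proof -
  have F: "Fail \<in> universe V T S" unfolding universe_def by blast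
  from assms consider "ob = Fail"
    | \<rho> B where "ob = Fm (inst \<rho> B)" "\<rho> \<in> envs V T" "capture_free \<rho> B" "Fm B \<in> S"
    | \<rho> ts where "ob = Args (map (inst_trm \<rho>) ts)" "\<rho> \<in> envs V T" "Args ts \<in> S"
    unfolding universe_def by blast
  then show ?thesis
  proof cases
    case 2
    then show ?thesis
      using subst_inst[OF 2(3), of t x] in_universe_Fm[OF envs_comp[OF 2(2) assms(2,3)]] F by auto
  next
    case 3
    have "subst_trm x t (inst_trm \<rho> s) = inst_trm (\<lambda>z. subst_trm x t (\<rho> z)) s" for s
      by (cases s) auto
    then show ?thesis using 3 in_universe_Args[OF envs_comp[OF 3(2) assms(2,3)] 3(3)]
      by (simp add: comp_def)
  qed (use F in auto)
qed

lemma universe_wf: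
  assumes "\<And>B. Fm B \<in> S \<Longrightarrow> wf_fm L B" "\<And>t. t \<in> T \<Longrightarrow> wf_trm L t" "Fm C \<in> universe V T S"
  shows "wf_fm L C"
proof -
  from assms(3) obtain \<rho> B where 1: "C = inst \<rho> B" "\<rho> \<in> envs V T" "Fm B \<in> S"
    unfolding universe_def by blast
  have "wf_trm L (\<rho> x)" for x using 1(2) assms(2) by (cases "x \<in> V") (auto simp: envs_def)
  moreover have "wf_fm L B \<Longrightarrow> (\<And>x. wf_trm L (\<rho> x)) \<Longrightarrow> wf_fm L (inst \<rho> B)" for \<rho> B
  proof (induction B arbitrary: \<rho>)
    case (Rel R ts)
    have "wf_trm L (inst_trm \<rho> t)" if "t \<in> set ts" for t using Rel that by (cases t) auto
    then show ?case using Rel by auto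
  qed auto
  ultimately show ?thesis using 1 assms(1) by blast
qed

end

section \<open>Node tables and substitution\<close>

declare One_nat_def [simp del] \<comment> \<open>keeps the register and array index 1 from becoming \<open>Suc 0\<close>\<close>

text \<open>This covers counting loops whose bound register keeps the value \<open>n\<close>, with
  variant \<open>n - i\<close>. The closure loop, whose bound grows while it runs, has to use
  \<open>wp_While\<close> itself.\<close>

lemma wp_for:
  assumes I0: "I 0 v h"
    and I: "\<And>i v h. I i v h \<Longrightarrow> v ri = i \<and> v rn = n \<and> i \<le> n"
    and step: "\<And>i v h. I i v h \<Longrightarrow> i < n \<Longrightarrow>
      wp c (v, h, w) (\<lambda>t (v', h', w'). t \<le> B \<and> w' = w \<and> I (i + 1) v' h')"
    and Q: "\<And>t v' h'. t \<le> (n + 1) * (B + 1) \<Longrightarrow> I n v' h' \<Longrightarrow> Q t (v', h', w)"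
  shows "wp (While (Lt ri rn) c) (v, h, w) Q"
proof -
  define J where "J = (\<lambda>k v' h' w'. w' = w \<and> (\<exists>i. I i v' h' \<and> k = n - i))"
  have "wp (While (Lt ri rn) c) (v, h, w) (\<lambda>t (v', h', w'). t \<le> (n + 1) * (B + 1) \<and>
      \<not> holds (Lt ri rn) v' \<and> (\<exists>k' \<le> n. J k' v' h' w'))"
  proof (rule wp_While)
    show "J n v h w" unfolding J_def using I0 by (auto intro!: HOL.exI[of _ "0::nat"])
  next
    fix k v' h' w' assume "J k v' h' w'" "holds (Lt ri rn) v'"
    then obtain i where i: "w' = w" "I i v' h'" "k = n - i" "i < n" using I by (auto simp: J_def)
    show "wp c (v', h', w') (\<lambda>t (v', h', w'). t \<le> B \<and> (\<exists>k'<k. J k' v' h' w'))"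
      unfolding i(1)
    proof (rule wp_mono[OF step[OF i(2,4)]])
      fix t s' assume a: "case s' of (v', h', w') \<Rightarrow> t \<le> B \<and> w' = w \<and> I (i + 1) v' h'"
      obtain v' h' w' where s: "s' = (v', h', w')" by (cases s')
      have "J (n - (i + 1)) v' h' w'" using a s unfolding J_def by auto
      moreover have "n - (i + 1) < k" using i(3,4) by simp
      ultimately show "case s' of (v', h', w') \<Rightarrow> t \<le> B \<and> (\<exists>k'<k. J k' v' h' w')"
        using a s by auto
    qed
  qed
  then show ?thesis
  proof (rule wp_mono)
    fix t s' assume a: "case s' of (v', h', w') \<Rightarrow> t \<le> (n + 1) * (B + 1) \<and>
      \<not> holds (Lt ri rn) v' \<and> (\<exists>k' \<le> n. J k' v' h' w')"
    obtain v' h' w' where s: "s' = (v', h', w')" by (cases s')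
    then obtain i where i: "w' = w" "I i v' h'" "\<not> v' ri < v' rn" "t \<le> (n + 1) * (B + 1)"
      using a unfolding s J_def by (simp only: prod.case holds.simps) blast
    have "i = n" using I[OF i(2)] i(3) by simp
    then show "Q t s'" using Q[OF i(4)] i(1,2) s by simp
  qed
qed

text \<open>A frame condition: everything outside \<open>S\<close> survives. It is used for
  registers and also for memory, where the values are whole arrays.\<close>

definition agree :: "nat set \<Rightarrow> (nat \<Rightarrow> 'a) \<Rightarrow> (nat \<Rightarrow> 'a) \<Rightarrow> bool" where
  "agree S f g \<longleftrightarrow> (\<forall>r. r \<notin> S \<longrightarrow> g r = f r)"

lemma agreeD: "agree S f g \<Longrightarrow> r \<notin> S \<Longrightarrow> g r = f r"
  by (simp add: agree_def)

lemma agree_upd [simp]: "r \<in> S \<Longrightarrow> agree S f (g(r := a)) \<longleftrightarrow> agree S f g"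
  by (auto simp: agree_def)

lemma agree_refl [simp]: "agree S f f"
  by (simp add: agree_def)

lemma agree_trans: "agree S f g \<Longrightarrow> agree T g k \<Longrightarrow> S \<subseteq> U \<Longrightarrow> T \<subseteq> U \<Longrightarrow> agree U f k"
  unfolding agree_def by (metis subsetD)

lemma agree_mono: "agree S f g \<Longrightarrow> S \<subseteq> U \<Longrightarrow> agree U f g"
  by (auto simp: agree_def)

text \<open>
  Allocation of the scalars: 0 answer; 1 number of nodes; 2, 3 temporary; 4 result of a node lookup,
  5 to 7 the triple looked up; 8 number of symbols; 9 the fresh variable; 10 stack height; 11 pending
  argument list; 12 number of binders; 13 number of terms; 14 number of pairs \<open>(x, t)\<close>; 15 current
  node, 16 current pair; 17 to 19 the triple of the current node (or the current symbol); 20 to 22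
  the current pair; 23, 24 its effect on the two children; 26 number of clauses; 27 round; 28 size of
  the substitution table.

  Allocation of the arrays: 0 to 2 nodes; 3, 4 symbols; 5 stack; 6 binders; 7, 8 terms; 9 to 11 pairs;
  12 start of the row of a node in the substitution table 13; 14 to 16 clauses; 17 marks.
\<close>

definition nodes :: "(nat \<Rightarrow> nat) \<Rightarrow> (nat \<Rightarrow> nat \<Rightarrow> nat) \<Rightarrow> obj list \<Rightarrow> bool" where
  "nodes v h os \<longleftrightarrow> okl os \<and> v 1 = length os \<and>
     (\<forall>i < length os. (h 0 i, h 1 i, h 2 i) = code os (os ! i))"

text \<open>It writes register 3 back to itself, so even an idle branch counts as an update of this
  temporary register.\<close>

abbreviation nop :: cmd where "nop \<equiv> AddC 3 0"

text \<open>The scan has no early exit. Since the table has no repetitions there is at most one hit,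
  and register 4, preset to the length of the table, keeps this value as the sign that the object is
  new.\<close>

definition search_cmd :: cmd where
  "search_cmd = While (Lt 2 1)
     (Get 3 0 2 ;; If (Ne 3 5) nop (Get 3 1 2 ;; If (Ne 3 6) nop
       (Get 3 2 2 ;; If (Ne 3 7) nop (Mov 4 2))) ;; AddC 2 1)"

definition mk_cmd :: cmd where
  "mk_cmd = Const 2 0 ;; Mov 4 1 ;; search_cmd ;;
     If (Ne 4 1) nop (Put 0 1 5 ;; Put 1 1 6 ;; Put 2 1 7 ;; AddC 1 1)"

lemma wp_search:
  assumes n: "nodes v h os" and c: "children ob \<subseteq> set os" "code os ob = (v 5, v 6, v 7)"
    and init: "v 2 = 0" "v 4 = length os"
  shows "wp search_cmd (v, h, w) (\<lambda>t (v', h', w'). t \<le> (length os + 1) * 9 \<and> h' = h \<and> w' = w \<and>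
     agree {2, 3, 4} v v' \<and>
     v' 4 = (if ob \<in> set os then ix os ob else length os))"
proof -
  define I where "I = (\<lambda>j v' h'. h' = h \<and> agree {2, 3, 4} v v' \<and> v' 2 = j \<and> j \<le> length os \<and>
     v' 4 = (if ob \<in> set (take j os) then ix os ob else length os))"
  have okl: "okl os" and v1: "v 1 = length os"
    and nd: "\<And>i. i < length os \<Longrightarrow> (h 0 i, h 1 i, h 2 i) = code os (os ! i)"
    using n by (auto simp: nodes_def)
  show ?thesis
    unfolding search_cmd_def
  proof (rule wp_for[where I = I and n = "length os" and B = 8])
    show "I 0 v h" using init by (simp add: I_def)
  next
    fix j v' h' assume "I j v' h'"
    then show "v' 2 = j \<and> v' 1 = length os \<and> j \<le> length os"
      using v1 agreeD[of "{2, 3, 4}" v v' 1] by (simp add: I_def)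
  next
    fix j v' h'
    assume I: "I j v' h'" and j: "j < length os"
    have fr: "h' = h" "agree {2, 3, 4} v v'" "v' 2 = j"
      and k: "v' 4 = (if ob \<in> set (take j os) then ix os ob else length os)" using I by (auto simp: I_def)
    note fv = agreeD[OF fr(2)]
    have ch: "children (os ! j) \<subseteq> set os" using okl j okl_children by auto
    have eq: "(h 0 j, h 1 j, h 2 j) = (v 5, v 6, v 7) \<longleftrightarrow> os ! j = ob"
      using nd[OF j] c(2) code_inj[OF ch c(1)] by simp
    have tk: "take (j + 1) os = take j os @ [os ! j]"
      using take_Suc_conv_app_nth[OF j] by (simp add: Suc_eq_plus1)
    have dis: "distinct os" using okl by (simp add: okl_def)
    have ix: "ix os (os ! j) = j" using ix_nth[OF dis j] .
    have nin: "ob \<notin> set (take j os)" if "os ! j = ob"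
    proof
      assume "ob \<in> set (take j os)"
      then obtain i where "i < j" "os ! i = ob" using j by (auto simp: in_set_conv_nth)
      then show False using dis that j by (auto simp: distinct_conv_nth)
    qed
    have step: "I (j + 1) v'' h"
      if "v'' 2 = j + 1" "agree {2, 3, 4} v v''" "v'' 4 = (if os ! j = ob then j else v' 4)" for v''
      unfolding I_def using that k j tk ix nin fr by auto
    show "wp (Get 3 0 2 ;; If (Ne 3 5) nop (Get 3 1 2 ;; If (Ne 3 6) nop
       (Get 3 2 2 ;; If (Ne 3 7) nop (Mov 4 2))) ;; AddC 2 1) (v', h', w)
       (\<lambda>t (v', h', w'). t \<le> 8 \<and> w' = w \<and> I (j + 1) v' h')"
      using eq fv[of 5] fv[of 6] fv[of 7] fr(2)
      by (auto simp: fr(1,3) intro!: step)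
  next
    fix t v' h' assume "t \<le> (length os + 1) * (8 + 1)" "I (length os) v' h'"
    then show "case (v', h', w) of (v', h', w') \<Rightarrow> t \<le> (length os + 1) * 9 \<and> h' = h \<and> w' = w \<and>
     agree {2, 3, 4} v v' \<and> v' 4 = (if ob \<in> set os then ix os ob else length os)"
      by (simp add: I_def)
  qed
qed

lemma nodes_ins:
  assumes n: "nodes v h os" and c: "children ob \<subseteq> set os" "ob \<notin> set os"
    and h': "h' 0 = (h 0)(length os := a)" "h' 1 = (h 1)(length os := b)" "h' 2 = (h 2)(length os := d)"
    and abd: "(a, b, d) = code os ob" and v': "v' 1 = length os + 1"
  shows "nodes v' h' (ins os ob)"
proof -
  have okl: "okl os" using n by (simp add: nodes_def)
  have i: "ins os ob = os @ [ob]" using c(2) by (simp add: ins_def)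
  have "(h' 0 i, h' 1 i, h' 2 i) = code (os @ [ob]) ((os @ [ob]) ! i)" if "i < length (os @ [ob])" for i
  proof (cases "i < length os")
    case True
    then have "children (os ! i) \<subseteq> set os" using okl okl_children by auto
    then show ?thesis using True n h' by (simp add: nodes_def nth_append code_append)
  next
    case False
    then show ?thesis using that h' abd c(1) by (simp add: nth_append code_append less_Suc_eq)
  qed
  then show ?thesis using okl_ins[OF okl c(1)] v' unfolding nodes_def i by simp
qed

lemma wp_mk:
  assumes n: "nodes v h os" and c: "children ob \<subseteq> set os" "code os ob = (v 5, v 6, v 7)"
    and Q: "\<And>t v' h'. t \<le> 9 * length os + 17 \<Longrightarrow> nodes v' h' (ins os ob) \<Longrightarrow>
      v' 4 = ix (ins os ob) ob \<Longrightarrow> agree {1, 2, 3, 4} v v' \<Longrightarrow> agree {0, 1, 2} h h' \<Longrightarrow> Q t (v', h', w)"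
  shows "wp mk_cmd (v, h, w) Q"
proof -
  have v1: "v 1 = length os" using n by (simp add: nodes_def)
  let ?v = "v(2 := 0, 4 := v 1)"
  have n': "nodes ?v h os" using n by (simp add: nodes_def)
  show ?thesis unfolding mk_cmd_def
  proof (simp, rule wp_mono[OF wp_search[OF n' c(1)]])
    show "code os ob = (?v 5, ?v 6, ?v 7)" using c(2) by simp
  next
    fix t s'
    assume a: "case s' of (v', h', w') \<Rightarrow> t \<le> (length os + 1) * 9 \<and> h' = h \<and> w' = w \<and>
     agree {2, 3, 4} ?v v' \<and> v' 4 = (if ob \<in> set os then ix os ob else length os)"
    obtain v' where s: "s' = (v', h, w)" using a by (cases s') auto
    have f': "agree {1, 2, 3, 4} v v'" using a s agree_trans[of "{2, 4}" v ?v "{2, 3, 4}" v' "{1, 2, 3, 4}"] by simp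
    have f: "r \<notin> {2, 3, 4} \<Longrightarrow> v' r = v r" for r
      using a s agreeD[of "{2, 3, 4}" ?v v' r] by auto
    have t: "t \<le> (length os + 1) * 9"
      and r: "v' 4 = (if ob \<in> set os then ix os ob else length os)"
      using a s by auto
    have v'1: "v' 1 = length os" using f[of 1] v1 by simp
    show "wp (If (Ne 4 1) nop (Put 0 1 5 ;; Put 1 1 6 ;; Put 2 1 7 ;; AddC 1 1)) s'
      (\<lambda>t'. Q (1 + (1 + (t + t'))))"
    proof (cases "ob \<in> set os")
      case True
      then have i: "ins os ob = os" by (simp add: ins_def)
      have "v' 4 \<noteq> v' 1" using True r ix_less[OF True] v'1 by simp
      moreover have "nodes (v'(3 := v' 3)) h os" using n f[of 1] by (simp add: nodes_def)
      ultimately show ?thesis using True r t f' by (auto simp: s i intro!: Q)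
    next
      case False
      have "nodes (v'(1 := v' 1 + 1)) (h(0 := (h 0)(v' 1 := v' 5), 1 := (h 1)(v' 1 := v' 6), 2 := (h 2)(v' 1 := v' 7))) (ins os ob)"
        by (rule nodes_ins[OF n c(1) False]) (use c(2) v'1 f in auto)
      moreover have "ix (ins os ob) ob = length os" using False by (simp add: ins_def ix_new)
      ultimately show ?thesis using False r t f v'1 f' by (auto simp: s intro!: Q)
    qed
  qed (use v1 in auto)
qed

fun tcode :: "trm \<Rightarrow> nat \<times> nat" where
  "tcode (Var x) = (8, x)"
| "tcode (Cst c) = (9, c)"

section \<open>Applying a pair to a node\<close>

definition clear_cmd :: cmd where
  "clear_cmd = Const 5 0 ;; Const 6 0 ;; Const 7 0"

definition bin_cmd :: cmd where
  "bin_cmd = Mov 6 23 ;; If (NeC 23 0) (If (NeC 24 0) nop clear_cmd) clear_cmd"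

definition quant_cmd :: cmd where
  "quant_cmd = If (Ne 18 20)
     (If (NeC 24 0)
       (If (NeC 21 8) nop (If (Ne 22 18) nop (If (Ne 24 19) clear_cmd nop)))
       clear_cmd)
     (Mov 7 19)"

text \<open>Both components of the current triple are looked up as if they were node numbers. Where
  a component is a variable, an index or a dummy 0, the word found is meaningless, and the case
  distinction on the kind discards it.\<close>

definition sub_cmd :: cmd where
  "sub_cmd = Get 20 9 16 ;; Get 21 10 16 ;; Get 22 11 16 ;;
     Get 25 12 18 ;; Plus 25 25 16 ;; Get 23 13 25 ;;
     Get 25 12 19 ;; Plus 25 25 16 ;; Get 24 13 25 ;;
     Mov 5 17 ;; Mov 6 18 ;; Mov 7 24 ;;
     If (NeC 17 8) (If (NeC 17 9) (If (NeC 17 10) (If (NeC 17 3) (If (NeC 17 4) (If (NeC 17 5)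
       (If (NeC 17 6) (If (NeC 17 7) (Mov 7 19) quant_cmd) quant_cmd)
       bin_cmd) bin_cmd) bin_cmd) nop) nop) (If (Ne 18 20) nop (Mov 5 21 ;; Mov 6 22))"

text \<open>Capture can happen only for \<open>t = Var y\<close>, and then \<open>x\<close> is free
  in \<open>B\<close> exactly when the substituted body is a different node. So
  \<open>quant_cmd\<close> decides substitutability from the result for the body, without any record
  of free variables.\<close>

lemma substitutable_binder:
  assumes "y \<noteq> x"
  shows "x \<notin> fv B - {y} \<or> t \<noteq> Var y \<and> substitutable t x B \<longleftrightarrow>
     substitutable t x B \<and> (t = Var y \<longrightarrow> subst x t B = B)"
  using assms notin_fv_if_subst_eq[of x t B] subst_notin_fv[of x B t] substitutable_notin_fv[of x B t]
  by auto

lemma wp_sub: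
  fixes v h os ob p
  defines "B1 \<equiv> \<lambda>ob'. h 13 (h 12 (ix os ob') + v 16)"
  assumes okl: "okl os" and ob: "ob \<in> set os" and code: "code os ob = (v 17, v 18, v 19)"
    and p: "(h 9 (v 16), h 10 (v 16), h 11 (v 16)) = (x, tcode t)"
    and ch: "\<And>c. c \<in> children ob \<Longrightarrow> osub (x, t) c \<in> set os \<and> B1 c = ix os (osub (x, t) c)"
    and Q: "\<And>tm v'. tm \<le> 30 \<Longrightarrow> children (osub (x, t) ob) \<subseteq> set os \<Longrightarrow>
       code os (osub (x, t) ob) = (v' 5, v' 6, v' 7) \<Longrightarrow>
       agree {3, 5, 6, 7, 20, 21, 22, 23, 24, 25} v v' \<Longrightarrow>
       v' 20 = x \<Longrightarrow> v' 22 = snd (tcode t) \<Longrightarrow>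
       (\<And>B y. ob = Fm (All y B) \<or> ob = Fm (Ex y B) \<Longrightarrow> v' 24 = ix os (osub (x, t) (Fm B))) \<Longrightarrow> Q tm (v', h, w)"
  shows "wp sub_cmd (v, h, w) Q"
proof -
  define D where "D = osub (x, t) ob"
  have Q': "Q tm (v', h, w)" if "tm \<le> 30" "children D \<subseteq> set os"
       "code os D = (v' 5, v' 6, v' 7)"
       "agree {3, 5, 6, 7, 20, 21, 22, 23, 24, 25} v v'"
       "v' 20 = x" "v' 22 = snd (tcode t)"
       "\<forall>B y. ob = Fm (All y B) \<or> ob = Fm (Ex y B) \<longrightarrow> v' 24 = ix os (osub (x, t) (Fm B))" for tm v'
    using that Q unfolding D_def by blast
  have p': "h 9 (v 16) = x" "h 10 (v 16) = fst (tcode t)" "h 11 (v 16) = snd (tcode t)"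
    using p arg_cong[of _ _ fst] arg_cong[of _ _ snd] by (cases t; simp)+
  have och: "children ob \<subseteq> set os" using okl_children[OF okl ob] .
  note defs = sub_cmd_def quant_cmd_def bin_cmd_def clear_cmd_def
  have z: "ix os o' = 0 \<longleftrightarrow> o' = Fail" if "o' \<in> set os" for o' using ix_eq_0[OF okl that] .
  consider (Fail) "ob = Fail" | (Top) "ob = Fm Top" | (Bot) "ob = Fm Bot"
    | (Rel) R ts where "ob = Fm (Rel R ts)" | (Conj) B C where "ob = Fm (Conj B C)"
    | (Disj) B C where "ob = Fm (Disj B C)" | (Imp) B C where "ob = Fm (Imp B C)"
    | (All) y B where "ob = Fm (All y B)" | (Ex) y B where "ob = Fm (Ex y B)"
    | (Nil) "ob = Args []" | (Cst) c ts where "ob = Args (Cst c # ts)"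
    | (Var) y ts where "ob = Args (Var y # ts)"
    by (cases "(os, ob)" rule: code.cases) auto
  then show ?thesis
  proof cases
    case Fail
    then show ?thesis using code p' by (auto simp: defs D_def intro!: Q')
  next
    case Top
    then show ?thesis using code p' by (auto simp: defs D_def intro!: Q')
  next
    case Bot
    then show ?thesis using code p' by (auto simp: defs D_def intro!: Q')
  next
    case Nil
    then show ?thesis using code p' by (auto simp: defs D_def intro!: Q')
  next
    case (Rel R ts)
    have c: "v 17 = 10" "v 18 = R" "v 19 = ix os (Args ts)" using code Rel by auto
    have "osub (x, t) (Args ts) \<in> set os" "B1 (Args ts) = ix os (osub (x, t) (Args ts))"
      using ch[of "Args ts"] Rel by auto
    then show ?thesis using c p' by (auto simp: defs D_def Rel B1_def intro!: Q')
  next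
    case (Cst d ts)
    have c: "v 17 = 9" "v 18 = d" "v 19 = ix os (Args ts)" using code Cst by auto
    have "osub (x, t) (Args ts) \<in> set os" "B1 (Args ts) = ix os (osub (x, t) (Args ts))"
      using ch[of "Args ts"] Cst by auto
    then show ?thesis using c p' by (auto simp: defs D_def Cst B1_def intro!: Q')
  next
    case (Var y ts)
    have c: "v 17 = 8" "v 18 = y" "v 19 = ix os (Args ts)" using code Var by auto
    have "osub (x, t) (Args ts) \<in> set os" "B1 (Args ts) = ix os (osub (x, t) (Args ts))"
      using ch[of "Args ts"] Var by auto
    then show ?thesis using c p' by (cases t) (auto simp: defs D_def Var B1_def intro!: Q')
  next
    case (Conj B C)
    have c: "v 17 = 3" "v 18 = ix os (Fm B)" "v 19 = ix os (Fm C)" using code Conj by auto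
    have "osub (x, t) (Fm B) \<in> set os" "B1 (Fm B) = ix os (osub (x, t) (Fm B))"
      "osub (x, t) (Fm C) \<in> set os" "B1 (Fm C) = ix os (osub (x, t) (Fm C))"
      using ch[of "Fm B"] ch[of "Fm C"] Conj by auto
    then show ?thesis using c p'
      by (auto simp: defs D_def Conj B1_def z okl_ix[OF okl] intro!: Q' split: if_splits)
  next
    case (Disj B C)
    have c: "v 17 = 4" "v 18 = ix os (Fm B)" "v 19 = ix os (Fm C)" using code Disj by auto
    have "osub (x, t) (Fm B) \<in> set os" "B1 (Fm B) = ix os (osub (x, t) (Fm B))"
      "osub (x, t) (Fm C) \<in> set os" "B1 (Fm C) = ix os (osub (x, t) (Fm C))"
      using ch[of "Fm B"] ch[of "Fm C"] Disj by auto
    then show ?thesis using c p'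
      by (auto simp: defs D_def Disj B1_def z okl_ix[OF okl] intro!: Q' split: if_splits)
  next
    case (Imp B C)
    have c: "v 17 = 5" "v 18 = ix os (Fm B)" "v 19 = ix os (Fm C)" using code Imp by auto
    have "osub (x, t) (Fm B) \<in> set os" "B1 (Fm B) = ix os (osub (x, t) (Fm B))"
      "osub (x, t) (Fm C) \<in> set os" "B1 (Fm C) = ix os (osub (x, t) (Fm C))"
      using ch[of "Fm B"] ch[of "Fm C"] Imp by auto
    then show ?thesis using c p'
      by (auto simp: defs D_def Imp B1_def z okl_ix[OF okl] intro!: Q' split: if_splits)
  next
    case (All y B)
    have c: "v 17 = 6" "v 18 = y" "v 19 = ix os (Fm B)" using code All by auto
    have m: "osub (x, t) (Fm B) \<in> set os" "B1 (Fm B) = ix os (osub (x, t) (Fm B))" "Fm B \<in> set os"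
      using ch[of "Fm B"] All och by auto
    have q: "D = (if y = x then ob else if substitutable t x B \<and> (t = Var y \<longrightarrow> subst x t B = B)
       then Fm (All y (subst x t B)) else Fail)"
      using substitutable_binder[of y x B t] by (auto simp: All D_def)
    have e: "substitutable t x B \<Longrightarrow> ix os (Fm (subst x t B)) = ix os (Fm B) \<longleftrightarrow> subst x t B = B"
      using m ix_inj[of "Fm (subst x t B)" os "Fm B"] by auto
    have e0: "substitutable t x B \<Longrightarrow> ix os (Fm (subst x t B)) \<noteq> 0" using m z by auto
    show ?thesis
    proof (cases "substitutable t x B")
      case True
      then show ?thesis using c p' m e e0
        by (cases t) (auto simp: defs q B1_def All intro!: Q')
    next
      case False
      then show ?thesis using c p' m okl_ix(1)[OF okl]
        by (auto simp: defs q B1_def All intro!: Q')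
    qed
  next
    case (Ex y B)
    have c: "v 17 = 7" "v 18 = y" "v 19 = ix os (Fm B)" using code Ex by auto
    have m: "osub (x, t) (Fm B) \<in> set os" "B1 (Fm B) = ix os (osub (x, t) (Fm B))" "Fm B \<in> set os"
      using ch[of "Fm B"] Ex och by auto
    have q: "D = (if y = x then ob else if substitutable t x B \<and> (t = Var y \<longrightarrow> subst x t B = B)
       then Fm (Ex y (subst x t B)) else Fail)"
      using substitutable_binder[of y x B t] by (auto simp: Ex D_def)
    have e: "substitutable t x B \<Longrightarrow> ix os (Fm (subst x t B)) = ix os (Fm B) \<longleftrightarrow> subst x t B = B"
      using m ix_inj[of "Fm (subst x t B)" os "Fm B"] by auto
    have e0: "substitutable t x B \<Longrightarrow> ix os (Fm (subst x t B)) \<noteq> 0" using m z by auto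
    show ?thesis
    proof (cases "substitutable t x B")
      case True
      then show ?thesis using c p' m e e0
        by (cases t) (auto simp: defs q B1_def Ex intro!: Q')
    next
      case False
      then show ?thesis using c p' m okl_ix(1)[OF okl]
        by (auto simp: defs q B1_def Ex intro!: Q')
    qed
  qed
qed

section \<open>The clause list and the substitution table\<close>

definition clauses_at :: "(nat \<Rightarrow> nat) \<Rightarrow> (nat \<Rightarrow> nat \<Rightarrow> nat) \<Rightarrow> obj list \<Rightarrow> (obj \<times> obj \<times> obj) list \<Rightarrow> bool" where
  "clauses_at v h os cl \<longleftrightarrow> v 26 = length cl \<and>
     (\<forall>j < length cl. case cl ! j of (p, q, c) \<Rightarrow> {p, q, c} \<subseteq> set os \<and>
       h 14 j = ix os p \<and> h 15 j = ix os q \<and> h 16 j = ix os c)"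

definition emit :: "nat \<Rightarrow> nat \<Rightarrow> nat \<Rightarrow> cmd" where
  "emit p q c = Put 14 26 p ;; Put 15 26 q ;; Put 16 26 c ;; AddC 26 1"

lemma wp_emit:
  assumes "clauses_at v h os cl" "{p, q, c} \<subseteq> set os" "v rp = ix os p" "v rq = ix os q" "v rc = ix os c"
    and Q: "\<And>h'. clauses_at (v(26 := v 26 + 1)) h' os (cl @ [(p, q, c)]) \<Longrightarrow> agree {14, 15, 16} h h' \<Longrightarrow>
      Q 4 (v(26 := v 26 + 1), h', w)"
  shows "wp (emit rp rq rc) (v, h, w) Q"
proof -
  let ?h = "h(14 := (h 14)(v 26 := v rp), 15 := (h 15)(v 26 := v rq), 16 := (h 16)(v 26 := v rc))"
  have "clauses_at (v(26 := v 26 + 1)) ?h os (cl @ [(p, q, c)])"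
    using assms(1-5) unfolding clauses_at_def by (auto simp: nth_append less_Suc_eq split: prod.splits)
  moreover have "agree {14, 15, 16} h ?h" by simp
  ultimately show ?thesis using Q by (simp add: emit_def)
qed

lemma clauses_at_cong:
  assumes "clauses_at v h os cl" "v' 26 = v 26" "h' 14 = h 14" "h' 15 = h 15" "h' 16 = h 16"
  shows "clauses_at v' h' (ins os ob) cl"
proof -
  obtain zs where "ins os ob = os @ zs" using ins_extends by blast
  then show ?thesis using assms unfolding clauses_at_def by (auto simp: ix_append split: prod.splits)
qed

definition rows :: "(nat \<Rightarrow> nat \<Rightarrow> nat) \<Rightarrow> (nat \<times> trm) list \<Rightarrow> nat \<Rightarrow> nat \<Rightarrow> obj list \<Rightarrow> bool" where
  "rows h prs i n os \<longleftrightarrow> (\<forall>k < i. h 12 k + length prs \<le> n \<and>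
     (\<forall>d < length prs. osub (prs ! d) (os ! k) \<in> set os \<and>
        h 13 (h 12 k + d) = ix os (osub (prs ! d) (os ! k))))"

definition row_prefix :: "(nat \<Rightarrow> nat \<Rightarrow> nat) \<Rightarrow> (nat \<times> trm) list \<Rightarrow> nat \<Rightarrow> nat \<Rightarrow> nat \<Rightarrow> obj list \<Rightarrow> bool" where
  "row_prefix h prs i n ci os \<longleftrightarrow> h 12 i + ci = n \<and>
     (\<forall>d < ci. osub (prs ! d) (os ! i) \<in> set os \<and> h 13 (h 12 i + d) = ix os (osub (prs ! d) (os ! i)))"

lemma rows_put:
  assumes "rows h prs i n os" "i \<le> length os" "h' 12 = h 12" "h' 13 = (h 13)(n := a)"
  shows "rows h' prs i (n + 1) (ins os ob)"
proof -
  obtain zs where z: "ins os ob = os @ zs" using ins_extends by blast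
  have "h' 12 k + length prs \<le> n + 1 \<and> (\<forall>d < length prs. osub (prs ! d) ((os @ zs) ! k) \<in> set (os @ zs) \<and>
        h' 13 (h' 12 k + d) = ix (os @ zs) (osub (prs ! d) ((os @ zs) ! k)))" if "k < i" for k
  proof -
    have k: "h 12 k + length prs \<le> n" "\<And>d. d < length prs \<Longrightarrow> osub (prs ! d) (os ! k) \<in> set os \<and>
        h 13 (h 12 k + d) = ix os (osub (prs ! d) (os ! k))" "(os @ zs) ! k = os ! k"
      using assms(1,2) that by (auto simp: rows_def nth_append)
    show ?thesis using k assms(3,4) by (auto simp: ix_append)
  qed
  then show ?thesis unfolding rows_def z by blast
qed

lemma row_prefix_put:
  assumes "row_prefix h prs i n ci os" "i < length os" "h' 12 = h 12" "h' 13 = (h 13)(n := a)"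
    and "ob = osub (prs ! ci) (os ! i)" "a = ix (ins os ob) ob"
  shows "row_prefix h' prs i (n + 1) (ci + 1) (ins os ob)"
proof -
  obtain zs where z: "ins os ob = os @ zs" using ins_extends by blast
  have ob: "ob \<in> set (os @ zs)" using set_ins[of os ob] z by auto
  have k: "h 12 i + ci = n" "\<And>d. d < ci \<Longrightarrow> osub (prs ! d) (os ! i) \<in> set os \<and>
        h 13 (h 12 i + d) = ix os (osub (prs ! d) (os ! i))" "(os @ zs) ! i = os ! i"
    using assms(1,2) by (auto simp: row_prefix_def nth_append)
  have "osub (prs ! d) ((os @ zs) ! i) \<in> set (os @ zs) \<and>
      h' 13 (h' 12 i + d) = ix (os @ zs) (osub (prs ! d) ((os @ zs) ! i))" if "d < ci + 1" for d
  proof (cases "d = ci")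
    case True
    then show ?thesis using k assms ob z by simp
  next
    case False
    then have "d < ci" using that by simp
    from k(2)[OF this] \<open>d < ci\<close> show ?thesis using k(1,3) assms(3,4) by (auto simp: ix_append)
  qed
  then show ?thesis using k(1) assms(3) unfolding row_prefix_def z by simp
qed

definition pairs_at :: "(nat \<Rightarrow> nat \<Rightarrow> nat) \<Rightarrow> (nat \<times> trm) list \<Rightarrow> bool" where
  "pairs_at h prs \<longleftrightarrow> (\<forall>d < length prs. (h 9 d, h 10 d, h 11 d) = (fst (prs ! d), tcode (snd (prs ! d))))"

text \<open>Both quantifiers emit one clause unconditionally and a second one under the test for
  vacuity; only the registers and objects involved differ.\<close>

lemma wp_emit_two:
  assumes cl: "clauses_at v h os cl"
    and 1: "{p, q, c} \<subseteq> set os" "v rp = ix os p" "v rq = ix os q" "v rc = ix os c"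
    and 2: "{p', q', c'} \<subseteq> set os" "v rp' = ix os p'" "v rq' = ix os q'" "v rc' = ix os c'"
    and r: "rp' \<noteq> 26" "rq' \<noteq> 26" "rc' \<noteq> 26"
    and b: "b \<longleftrightarrow> v 22 = v 9 \<and> v 24 = v 19"
    and Q: "\<And>tm v' h'. tm \<le> 11 \<Longrightarrow> clauses_at v' h' os (cl @ (p, q, c) # (if b then [(p', q', c')] else [])) \<Longrightarrow>
      agree {3, 26} v v' \<Longrightarrow> agree {14, 15, 16} h h' \<Longrightarrow> Q tm (v', h', w)"
  shows "wp (emit rp rq rc ;; If (Ne 22 9) nop (If (Ne 24 19) nop (emit rp' rq' rc'))) (v, h, w) Q"
  unfolding wp_Seq
proof (rule wp_emit[OF cl 1], goal_cases)
  case (1 h')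
  let ?v = "v(26 := v 26 + 1)"
  have nop: "clauses_at (?v(3 := a)) h' os (cl @ [(p, q, c)])" for a
    using 1(1) by (simp add: clauses_at_def)
  show ?case
  proof (cases b)
    case False
    then show ?thesis using b nop[of "v 3"] 1 by (auto intro!: Q)
  next
    case True
    have "wp (emit rp' rq' rc') (?v, h', w) (\<lambda>t. Q (4 + (t + 1 + 1)))"
    proof (rule wp_emit[OF 1(1) 2(1)], goal_cases)
      case (4 h'')
      show ?case
        by (rule Q) (use True 4(1) agree_trans[OF 1(2) 4(2)] in auto)
    qed (use 2 r in auto)
    then show ?thesis using True b by simp
  qed
qed

text \<open>A nonzero register 24 says that the term is substitutable, as node 0 is
  \<open>Fail\<close>. That the term is \<open>Var f\<close> is recognised by its index alone,
  without its kind: \<open>f\<close> exceeds every index occurring in the instance, including those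
  of constants.\<close>

definition quant_emit :: cmd where
  "quant_emit = If (NeC 17 6)
     (If (NeC 17 7) nop
       (If (Ne 18 20) nop (If (NeC 24 0)
         (emit 24 24 15 ;; If (Ne 22 9) nop (If (Ne 24 19) nop (emit 15 15 19))) nop)))
     (If (Ne 18 20) nop (If (NeC 24 0)
         (emit 15 15 24 ;; If (Ne 22 9) nop (If (Ne 24 19) nop (emit 19 19 15))) nop))"

lemma wp_quant_emit:
  assumes n: "okl os" and cl: "clauses_at v h os cl" and ob: "ob \<in> set os"
    and code: "code os ob = (v 17, v 18, v 19)" and i: "v 15 = ix os ob"
    and v: "v 20 = x" "v 22 = snd (tcode t)" "v 9 = f" and f: "snd (tcode t) = f \<Longrightarrow> t = Var f"
    and s: "\<And>B y. ob = Fm (All y B) \<or> ob = Fm (Ex y B) \<Longrightarrow>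
      osub (x, t) (Fm B) \<in> set os \<and> v 24 = ix os (osub (x, t) (Fm B))"
    and Q: "\<And>tm v' h'. tm \<le> 15 \<Longrightarrow> clauses_at v' h' os (cl @ rules1 f (x, t) ob) \<Longrightarrow>
      agree {3, 26} v v' \<Longrightarrow> agree {14, 15, 16} h h' \<Longrightarrow> Q tm (v', h', w)"
  shows "wp quant_emit (v, h, w) Q"
proof -
  have ff: "snd (tcode t) = f \<longleftrightarrow> t = Var f" using f by auto
  have nop: "clauses_at (v(3 := a)) h os cl" for a using cl by (simp add: clauses_at_def)
  consider (All) y B where "ob = Fm (All y B)" | (Ex) y B where "ob = Fm (Ex y B)"
    | (other) "rules1 f (x, t) ob = []" "v 17 \<noteq> 6" "v 17 \<noteq> 7"
    using code by (cases "(os, ob)" rule: code.cases) auto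
  then show ?thesis
  proof cases
    case other
    then show ?thesis using nop cl by (auto simp: quant_emit_def intro!: Q)
  next
    case (All y B)
    have c: "v 17 = 6" "v 18 = y" "v 19 = ix os (Fm B)" "Fm B \<in> set os"
      using code All okl_children[OF n ob] by auto
    show ?thesis
    proof (cases "y = x \<and> substitutable t x B")
      case False
      then show ?thesis using c v nop cl s[of y B] ix_eq_0[OF n] okl_ix(1)[OF n] All
        by (auto simp: quant_emit_def intro!: Q split: if_splits)
    next
      case True
      have m: "Fm (subst x t B) \<in> set os" "v 24 = ix os (Fm (subst x t B))" "v 24 \<noteq> 0"
        using s[of y B] True All ix_eq_0[OF n, of "Fm (subst x t B)"] by auto
      have e: "v 24 = v 19 \<longleftrightarrow> subst x t B = B" using m c ix_inj[of "Fm (subst x t B)" os "Fm B"] by auto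
      have "wp (emit 15 15 24 ;; If (Ne 22 9) nop (If (Ne 24 19) nop (emit 19 19 15))) (v, h, w) (\<lambda>t. Q (t + 1 + 1 + 1))"
        by (rule wp_emit_two[OF cl, of ob ob "Fm (subst x t B)" _ _ _ "Fm B" "Fm B" ob, where b = "t = Var f \<and> subst x t B = B"])
          (use ob m c i v ff e True All in \<open>auto intro!: Q\<close>)
      then show ?thesis
        using c(1,2) v m(3) True by (simp add: quant_emit_def del: wp_Seq)
    qed
  next
    case (Ex y B)
    have c: "v 17 = 7" "v 18 = y" "v 19 = ix os (Fm B)" "Fm B \<in> set os"
      using code Ex okl_children[OF n ob] by auto
    show ?thesis
    proof (cases "y = x \<and> substitutable t x B")
      case False
      then show ?thesis using c v nop cl s[of y B] ix_eq_0[OF n] okl_ix(1)[OF n] Ex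
        by (auto simp: quant_emit_def intro!: Q split: if_splits)
    next
      case True
      have m: "Fm (subst x t B) \<in> set os" "v 24 = ix os (Fm (subst x t B))" "v 24 \<noteq> 0"
        using s[of y B] True Ex ix_eq_0[OF n, of "Fm (subst x t B)"] by auto
      have e: "v 24 = v 19 \<longleftrightarrow> subst x t B = B" using m c ix_inj[of "Fm (subst x t B)" os "Fm B"] by auto
      have "wp (emit 24 24 15 ;; If (Ne 22 9) nop (If (Ne 24 19) nop (emit 15 15 19))) (v, h, w) (\<lambda>t. Q (t + 1 + 1 + 1 + 1))"
        by (rule wp_emit_two[OF cl, of "Fm (subst x t B)" "Fm (subst x t B)" ob _ _ _ ob ob "Fm B", where b = "t = Var f \<and> subst x t B = B"])
          (use ob m c i v ff e True Ex in \<open>auto intro!: Q\<close>)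
      then show ?thesis
        using c(1,2) v m(3) True by (simp add: quant_emit_def del: wp_Seq)
    qed
  qed
qed

section \<open>The closure loop\<close>

text \<open>Register 25 is loaded with 1, the number of \<open>Fm Top\<close>, because
  \<open>emit\<close> takes all three entries from registers.\<close>

definition node_emit :: cmd where
  "node_emit = If (NeC 17 3) (If (NeC 17 4) (If (NeC 17 5) nop
      (emit 19 19 15 ;; emit 18 15 19 ;; If (Ne 18 19) nop (Const 25 1 ;; emit 25 25 15)))
      (emit 18 18 15 ;; emit 19 19 15 ;; If (Ne 18 19) nop (emit 15 15 18)))
      (emit 18 19 15 ;; emit 15 15 18 ;; emit 15 15 19)"

lemma wp_If_False: "\<not> holds b v \<Longrightarrow> wp d (v, h, w) (\<lambda>t. Q (t + 1)) \<Longrightarrow> wp (If b c d) (v, h, w) Q"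
  by simp

lemma clauses_at_upd: "clauses_at v h os cl \<Longrightarrow> r \<noteq> 26 \<Longrightarrow> clauses_at (v(r := a)) h os cl"
  by (simp add: clauses_at_def)

lemma wp_node_emit:
  assumes n: "okl os" and cl: "clauses_at v h os cl" and ob: "ob \<in> set os"
    and code: "code os ob = (v 17, v 18, v 19)" and i: "v 15 = ix os ob"
    and Q: "\<And>tm v' h'. tm \<le> 20 \<Longrightarrow> clauses_at v' h' os (cl @ rules0 ob) \<Longrightarrow>
      agree {3, 25, 26} v v' \<Longrightarrow> agree {14, 15, 16} h h' \<Longrightarrow> Q tm (v', h', w)"
  shows "wp node_emit (v, h, w) Q"
proof -
  have sub: "children ob \<subseteq> set os" using okl_children[OF n ob] .
  note ag = agree_trans[of "{14, 15, 16}" _ _ "{14, 15, 16}" _ "{14, 15, 16}", OF _ _ subset_refl subset_refl]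
  consider (Conj) B C where "ob = Fm (Conj B C)" | (Disj) B C where "ob = Fm (Disj B C)"
    | (Imp) B C where "ob = Fm (Imp B C)"
    | (other) "rules0 ob = []" "v 17 \<noteq> 3" "v 17 \<noteq> 4" "v 17 \<noteq> 5"
    using code by (cases "(os, ob)" rule: code.cases) auto
  then show ?thesis
  proof cases
    case other
    then show ?thesis using cl clauses_at_upd[OF cl] by (auto simp: node_emit_def intro!: Q)
  next
    case (Conj B C)
    have c: "v 17 = 3" "v 18 = ix os (Fm B)" "v 19 = ix os (Fm C)" "Fm B \<in> set os" "Fm C \<in> set os"
      using code sub Conj by auto
    have "wp (emit 18 19 15 ;; emit 15 15 18 ;; emit 15 15 19) (v, h, w) (\<lambda>t. Q (t + 1))"
      unfolding wp_Seq
    proof (rule wp_emit[OF cl, of "Fm B" "Fm C" ob], goal_cases)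
      case (5 h1)
      show ?case
      proof (rule wp_emit[OF 5(1), of ob ob "Fm B"], goal_cases)
        case (5 h2)
        show ?case
        proof (rule wp_emit[OF 5(1), of ob ob "Fm C"], goal_cases)
          case (5 h3)
          then show ?case using ag[OF ag] \<open>agree {14, 15, 16} h h1\<close> \<open>agree {14, 15, 16} h1 h2\<close>
            by (intro Q) (auto simp: Conj)
        qed (use c i ob in auto)
      qed (use c i ob in auto)
    qed (use c i ob in auto)
    then show ?thesis using c(1) by (simp add: node_emit_def del: wp_Seq)
  next
    case (Disj B C)
    have c: "v 17 = 4" "v 18 = ix os (Fm B)" "v 19 = ix os (Fm C)" "Fm B \<in> set os" "Fm C \<in> set os"
      using code sub Disj by auto
    have e: "v 18 = v 19 \<longleftrightarrow> B = C" using c ix_inj[of "Fm B" os "Fm C"] by auto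
    have "wp (emit 18 18 15 ;; emit 19 19 15 ;; If (Ne 18 19) nop (emit 15 15 18)) (v, h, w) (\<lambda>t. Q (t + 1 + 1))"
      unfolding wp_Seq
    proof (rule wp_emit[OF cl, of "Fm B" "Fm B" ob], goal_cases)
      case (5 h1)
      show ?case
      proof (rule wp_emit[OF 5(1), of "Fm C" "Fm C" ob], goal_cases)
        case (5 h2)
        have a2: "agree {14, 15, 16} h h2" using ag \<open>agree {14, 15, 16} h h1\<close> 5(2) by blast
        show ?case
        proof (cases "B = C")
          case False
          then show ?thesis using 5 a2 e clauses_at_upd[OF 5(1), of 3] by (auto simp: Disj intro!: Q)
        next
          case True
          show ?thesis
          proof (rule wp_If_False[OF _ wp_emit[OF 5(1), of ob ob "Fm B"]], goal_cases)
            case (6 h3)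
            then show ?case using ag[OF a2 6(2)] True
              by (intro Q) (auto simp: Disj)
          qed (use c i ob e True in auto)
        qed
      qed (use c i ob in auto)
    qed (use c i ob in auto)
    then show ?thesis using c(1) by (simp add: node_emit_def del: wp_Seq)
  next
    case (Imp B C)
    have c: "v 17 = 5" "v 18 = ix os (Fm B)" "v 19 = ix os (Fm C)" "Fm B \<in> set os" "Fm C \<in> set os"
      using code sub Imp by auto
    have e: "v 18 = v 19 \<longleftrightarrow> B = C" using c ix_inj[of "Fm B" os "Fm C"] by auto
    have "wp (emit 19 19 15 ;; emit 18 15 19 ;; If (Ne 18 19) nop (Const 25 1 ;; emit 25 25 15)) (v, h, w)
        (\<lambda>t. Q (t + 1 + 1 + 1))"
      unfolding wp_Seq
    proof (rule wp_emit[OF cl, of "Fm C" "Fm C" ob], goal_cases)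
      case (5 h1)
      show ?case
      proof (rule wp_emit[OF 5(1), of "Fm B" ob "Fm C"], goal_cases)
        case (5 h2)
        have a2: "agree {14, 15, 16} h h2" using ag \<open>agree {14, 15, 16} h h1\<close> 5(2) by blast
        show ?case
        proof (cases "B = C")
          case False
          then show ?thesis using 5 a2 e clauses_at_upd[OF 5(1), of 3] by (auto simp: Imp intro!: Q)
        next
          case True
          show ?thesis
          proof (rule wp_If_False, goal_cases)
            case 2
            show ?case unfolding wp_Seq wp_simps(1)
            proof (rule wp_emit[OF clauses_at_upd[OF 5(1)], of 25 "Fm Top" "Fm Top" ob], goal_cases)
              case (6 h3)
              then show ?case using ag[OF a2 6(2)] True
                by (intro Q) (auto simp: Imp)
            qed (use c i ob okl_ix[OF n] okl_in[OF n] in auto)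
          qed (use True e in auto)
        qed
      qed (use c i ob in auto)
    qed (use c i ob in auto)
    then show ?thesis using c(1) by (simp add: node_emit_def del: wp_Seq)
  qed
qed

definition pair_cmd :: cmd where
  "pair_cmd = sub_cmd ;; mk_cmd ;; Put 13 28 4 ;; AddC 28 1 ;; quant_emit ;; AddC 16 1"

definition node_cmd :: cmd where
  "node_cmd = Get 17 0 15 ;; Get 18 1 15 ;; Get 19 2 15 ;; Put 12 15 28 ;; node_emit ;; Const 16 0 ;;
     While (Lt 16 14) pair_cmd ;; AddC 15 1"

definition closure_cmd :: cmd where
  "closure_cmd = Const 15 0 ;; Const 28 0 ;; While (Lt 15 1) node_cmd"

abbreviation work_regs :: "nat set" where
  "work_regs \<equiv> {1, 2, 3, 4, 5, 6, 7, 15, 16, 17, 18, 19, 20, 21, 22, 23, 24, 25, 26, 28}"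

abbreviation work_arrs :: "nat set" where
  "work_arrs \<equiv> {0, 1, 2, 12, 13, 14, 15, 16}"

text \<open>The program does not know \<open>U\<close>. It is a finite set, closed under the pairs,
  that confines the growing table; its cardinality limits the number of iterations and the cost of
  each lookup.\<close>

locale closure =
  fixes f :: nat and prs :: "(nat \<times> trm) list" and U :: "obj set" and hyp :: "(obj \<times> obj \<times> obj) list"
  assumes finite_U: "finite U"
    and osub_U: "ob \<in> U \<Longrightarrow> p \<in> set prs \<Longrightarrow> osub p ob \<in> U"
    and fresh_prs: "p \<in> set prs \<Longrightarrow> snd (tcode (snd p)) = f \<Longrightarrow> snd p = Var f"
begin

definition common :: "(nat \<Rightarrow> nat) \<Rightarrow> (nat \<Rightarrow> nat \<Rightarrow> nat) \<Rightarrow> obj list \<Rightarrow> bool" where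
  "common v h os \<longleftrightarrow> nodes v h os \<and> set os \<subseteq> U \<and> v 14 = length prs \<and> v 9 = f \<and> pairs_at h prs"

definition inner where
  "inner i cl v h os ci \<longleftrightarrow> common v h os \<and> i < length os \<and> v 15 = i \<and> v 16 = ci \<and> ci \<le> length prs \<and>
     code os (os ! i) = (v 17, v 18, v 19) \<and> rows h prs i (v 28) os \<and> row_prefix h prs i (v 28) ci os \<and>
     clauses_at v h os (cl @ concat (map (\<lambda>p. rules1 f p (os ! i)) (take ci prs)))"

definition node_clauses :: "obj \<Rightarrow> (obj \<times> obj \<times> obj) list" where
  "node_clauses ob = rules0 ob @ concat (map (\<lambda>p. rules1 f p ob) prs)"

definition outer where
  "outer v h os i \<longleftrightarrow> common v h os \<and> i \<le> length os \<and> v 15 = i \<and> rows h prs i (v 28) os \<and>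
     clauses_at v h os (hyp @ concat (map node_clauses (take i os)))"

lemma length_le: "common v h os \<Longrightarrow> length os \<le> card U"
  using card_mono[OF finite_U, of "set os"]
  by (auto simp: common_def nodes_def okl_def distinct_card)

lemma wp_pair:
  assumes I: "inner i cl v h os ci" and ci: "ci < length prs"
    and Q: "\<And>t v' h' zs. t \<le> 9 * card U + 70 \<Longrightarrow> inner i cl v' h' (os @ zs) (ci + 1) \<Longrightarrow>
      agree work_regs v v' \<Longrightarrow> agree work_arrs h h' \<Longrightarrow> Q t (v', h', w)"
  shows "wp pair_cmd (v, h, w) Q"
proof -
  obtain x t where p: "prs ! ci = (x, t)" by (cases "prs ! ci")
  let ?ob = "os ! i"
  have c: "common v h os" "i < length os" "v 15 = i" "v 16 = ci" "code os ?ob = (v 17, v 18, v 19)"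
    "rows h prs i (v 28) os" "row_prefix h prs i (v 28) ci os"
    "clauses_at v h os (cl @ concat (map (\<lambda>p. rules1 f p ?ob) (take ci prs)))"
    using I by (auto simp: inner_def)
  have n: "nodes v h os" "set os \<subseteq> U" "v 14 = length prs" "v 9 = f" "pairs_at h prs"
    using c(1) by (auto simp: common_def)
  have okl: "okl os" and dis: "distinct os" using n(1) by (auto simp: nodes_def okl_def)
  have obs: "?ob \<in> set os" using c(2) by simp
  \<comment> \<open>Children have smaller numbers than their parent, so their rows are already
    complete and the results for them can be read off.\<close>
  have ch: "osub (x, t) d \<in> set os \<and> h 13 (h 12 (ix os d) + v 16) = ix os (osub (x, t) d)"
    if "d \<in> children ?ob" for d
  proof -
    have "ix os d < i" using okl_child_less[OF okl c(2) that] .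
    moreover have "d \<in> set os" using okl_children[OF okl obs] that by auto
    moreover have "\<forall>d'<length prs. osub (prs ! d') (os ! ix os d) \<in> set os \<and>
        h 13 (h 12 (ix os d) + d') = ix os (osub (prs ! d') (os ! ix os d))"
      using c(6) calculation(1) by (simp add: rows_def)
    ultimately show ?thesis using ci p nth_ix[of d os] c(4) by fastforce
  qed
  have pr: "(h 9 (v 16), h 10 (v 16), h 11 (v 16)) = (x, tcode t)"
    using n(5) ci p c(4) by (simp add: pairs_at_def)
  have len: "length os \<le> card U" using length_le[OF c(1)] .
  let ?o = "osub (x, t) ?ob"
  have mem: "(x, t) \<in> set prs" using ci p nth_mem[of ci prs] by simp
  have oU: "?o \<in> U" using osub_U[OF _ mem] obs n(2) by auto
  obtain zs where zs: "ins os ?o = os @ zs" using ins_extends by blast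
  have nth: "(os @ zs) ! i = ?ob" using c(2) by (simp add: nth_append)
  show ?thesis unfolding pair_cmd_def wp_Seq
  proof (rule wp_sub[OF okl obs c(5) pr ch], goal_cases)
    case (2 t1 v1)
    have f1: "r \<notin> {3, 5, 6, 7, 20, 21, 22, 23, 24, 25} \<Longrightarrow> v1 r = v r" for r using agreeD[OF 2(4)] .
    have n1: "nodes v1 h os" using n(1) f1[of 1] by (simp add: nodes_def)
    show ?case
    proof (rule wp_mk[OF n1 2(2,3)], goal_cases)
      case (1 t2 v2 h2)
      have f2: "r \<notin> {1, 2, 3, 4} \<Longrightarrow> v2 r = v1 r" for r using agreeD[OF 1(4)] .
      have g2: "r \<notin> {0, 1, 2} \<Longrightarrow> h2 r = h r" for r using agreeD[OF 1(5)] .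
      let ?v3 = "v2(28 := v2 28 + 1)" and ?h3 = "h2(13 := (h2 13)(v2 28 := v2 4))"
      let ?cl = "cl @ concat (map (\<lambda>p. rules1 f p ?ob) (take ci prs))"
      have cl3: "clauses_at ?v3 ?h3 (ins os ?o) ?cl"
        by (rule clauses_at_cong[OF c(8)]) (use f1 f2 g2 in auto)
      have okl3: "okl (ins os ?o)" using 1(2) by (simp add: nodes_def)
      have "children ?ob \<subseteq> set os" using okl_children[OF okl obs] .
      then have code3: "code (ins os ?o) ?ob = (?v3 17, ?v3 18, ?v3 19)"
        using c(5) f1 f2 unfolding zs by (simp add: code_append)
      have ix3: "?v3 15 = ix (ins os ?o) ?ob"
        using c(2,3) f1 f2 obs ix_nth[OF dis c(2)] unfolding zs by (simp add: ix_append)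
      have s3: "osub (x, t) (Fm B) \<in> set (ins os ?o) \<and> ?v3 24 = ix (ins os ?o) (osub (x, t) (Fm B))"
        if "?ob = Fm (All y B) \<or> ?ob = Fm (Ex y B)" for B y
      proof -
        have "Fm B \<in> children ?ob" using that by auto
        then have "osub (x, t) (Fm B) \<in> set os" using ch by blast
        then show ?thesis using 2(7)[OF that] f2[of 24] unfolding zs by (simp add: ix_append)
      qed
      have "wp quant_emit (?v3, ?h3, w) (\<lambda>tm s'. wp (AddC 16 1) s' (\<lambda>t'. Q (t1 + (t2 + (1 + (1 + (tm + t')))))))"
      proof (rule wp_quant_emit[where f = f, OF okl3 cl3 _ code3 ix3 _ _ _ _ s3], goal_cases)
        case (7 tm v4 h4)
        have f4: "r \<notin> {3, 26} \<Longrightarrow> v4 r = ?v3 r" for r using agreeD[OF 7(3)] .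
        have g4: "r \<notin> {14, 15, 16} \<Longrightarrow> h4 r = ?h3 r" for r using agreeD[OF 7(4)] .
        let ?v5 = "v4(16 := v4 16 + 1)"
        have "nodes ?v5 h4 (ins os ?o)" using 1(2) f4[of 1] g4[of 0] g4[of 1] g4[of 2]
          by (simp add: nodes_def)
        moreover have "pairs_at h4 prs" using n(5) g4 g2 by (simp add: pairs_at_def)
        ultimately have cm: "common ?v5 h4 (os @ zs)"
          using n oU f1 f2 f4 set_ins[of os ?o] unfolding common_def zs by auto
        have "rows h4 prs i (v 28 + 1) (ins os ?o)"
          by (rule rows_put[OF c(6), where a = "v2 4"]) (use c(2) g2 g4 f1 f2 in auto)
        then have r: "rows h4 prs i (?v5 28) (os @ zs)" using f1 f2 f4 zs by simp
        have "row_prefix h4 prs i (v 28 + 1) (ci + 1) (ins os ?o)"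
          by (rule row_prefix_put[OF c(7), where a = "v2 4" and ob = ?o]) (use c(2) g2 g4 f1 f2 p 1(3) in auto)
        then have rp: "row_prefix h4 prs i (?v5 28) (ci + 1) (os @ zs)" using f1 f2 f4 zs by simp
        have "take (ci + 1) prs = take ci prs @ [(x, t)]"
          using take_Suc_conv_app_nth[OF ci] p by (simp add: Suc_eq_plus1)
        then have cl5: "clauses_at ?v5 h4 (os @ zs)
            (cl @ concat (map (\<lambda>p. rules1 f p ((os @ zs) ! i)) (take (ci + 1) prs)))"
          using 7(2) zs unfolding nth by (auto simp: clauses_at_def)
        have in5: "inner i cl ?v5 h4 (os @ zs) (ci + 1)"
          unfolding inner_def using cm r rp cl5 c(2,3,4) ci code3 f1 f2 f4 nth zs by auto
        have a5: "agree work_regs v ?v5"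
        proof -
          have "agree work_regs v v2" using 2(4) 1(4) by (rule agree_trans) auto
          moreover have "agree work_regs v2 ?v3" by simp
          moreover have "agree work_regs ?v3 v4" using 7(3) by (rule agree_mono) auto
          ultimately have "agree work_regs v v4" unfolding agree_def by simp
          then show ?thesis by simp
        qed
        have b5: "agree work_arrs h h4"
        proof -
          have "agree work_arrs h h2" using 1(5) by (rule agree_mono) auto
          moreover have "agree work_arrs h2 ?h3" by simp
          moreover have "agree work_arrs ?h3 h4" using 7(4) by (rule agree_mono) auto
          ultimately show ?thesis unfolding agree_def by simp
        qed
        have "t1 + (t2 + (1 + (1 + (tm + 1)))) \<le> 9 * card U + 70" using 2(1) 1(1) 7(1) len by simp
        from Q[OF this in5 a5 b5] show ?case by simp
      qed (use obs 2(5,6) f1 f2 n(4) fresh_prs[OF mem] in auto)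
      then show ?case by simp
    qed
  qed auto
qed

lemma wp_pairs:
  assumes I: "inner i cl v h os 0"
    and Q: "\<And>t v' h' zs. t \<le> (length prs + 1) * (9 * card U + 71) \<Longrightarrow>
      inner i cl v' h' (os @ zs) (length prs) \<Longrightarrow>
      agree work_regs v v' \<Longrightarrow> agree work_arrs h h' \<Longrightarrow> Q t (v', h', w)"
  shows "wp (While (Lt 16 14) pair_cmd) (v, h, w) Q"
proof -
  define I where "I = (\<lambda>ci v' h'. agree work_regs v v' \<and> agree work_arrs h h' \<and>
     (\<exists>zs. inner i cl v' h' (os @ zs) ci))"
  show ?thesis
  proof (rule wp_for[where I = I and n = "length prs" and B = "9 * card U + 70"])
    show "I 0 v h" unfolding I_def using assms(1) by (auto intro!: HOL.exI[of _ "[]"])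
  next
    fix ci v' h' assume "I ci v' h'"
    then show "v' 16 = ci \<and> v' 14 = length prs \<and> ci \<le> length prs"
      by (auto simp: I_def inner_def common_def)
  next
    fix ci v' h' assume "I ci v' h'" and ci: "ci < length prs"
    then obtain zs where 1: "agree work_regs v v'" "agree work_arrs h h'" "inner i cl v' h' (os @ zs) ci"
      by (auto simp: I_def)
    show "wp pair_cmd (v', h', w) (\<lambda>t (v', h', w'). t \<le> 9 * card U + 70 \<and> w' = w \<and> I (ci + 1) v' h')"
    proof (rule wp_pair[OF 1(3) ci], goal_cases)
      case (1 t v'' h'' zs')
      then show ?case
        using agree_trans[OF \<open>agree work_regs v v'\<close> 1(3) subset_refl subset_refl]
          agree_trans[OF \<open>agree work_arrs h h'\<close> 1(4) subset_refl subset_refl]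
        by (auto simp: I_def intro!: HOL.exI[of _ "zs @ zs'"])
    qed
  next
    fix t v' h' assume 1: "t \<le> (length prs + 1) * (9 * card U + 70 + 1)" "I (length prs) v' h'"
    have "9 * card U + 70 + 1 = 9 * card U + 71" by simp
    with 1(1) have "t \<le> (length prs + 1) * (9 * card U + 71)" by (simp only:)
    then show "Q t (v', h', w)" using 1(2) Q unfolding I_def by blast
  qed
qed

lemma wp_node:
  assumes I: "outer v h os i" and i: "i < length os"
    and Q: "\<And>t v' h' zs. t \<le> 30 + (length prs + 1) * (9 * card U + 71) \<Longrightarrow>
      outer v' h' (os @ zs) (i + 1) \<Longrightarrow>
      agree work_regs v v' \<Longrightarrow> agree work_arrs h h' \<Longrightarrow> Q t (v', h', w)"
  shows "wp node_cmd (v, h, w) Q"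
proof -
  let ?ob = "os ! i"
  have c: "common v h os" "v 15 = i" "rows h prs i (v 28) os"
    "clauses_at v h os (hyp @ concat (map node_clauses (take i os)))"
    using I by (auto simp: outer_def)
  have n: "nodes v h os" "set os \<subseteq> U" "v 14 = length prs" "v 9 = f" "pairs_at h prs"
    using c(1) by (auto simp: common_def)
  have okl: "okl os" and dis: "distinct os" using n(1) by (auto simp: nodes_def okl_def)
  have obs: "?ob \<in> set os" using i by simp
  have code: "code os ?ob = (h 0 i, h 1 i, h 2 i)" using n(1) i by (simp add: nodes_def)
  let ?v1 = "v(17 := h 0 i, 18 := h 1 i, 19 := h 2 i)"
  let ?h1 = "h(12 := (h 12)(i := v 28))"
  let ?cl = "hyp @ concat (map node_clauses (take i os))"
  have cl1: "clauses_at ?v1 ?h1 os ?cl" using c(4) by (simp add: clauses_at_def)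
  have "wp node_emit (?v1, ?h1, w)
      (\<lambda>t s'. wp (Const 16 0) s' (\<lambda>t' s''. wp (While (Lt 16 14) pair_cmd) s''
         (\<lambda>t'' s'''. wp (AddC 15 1) s''' (\<lambda>t'''. Q (1 + (1 + (1 + (1 + (t + (t' + (t'' + t'''))))))))))) "
  proof (rule wp_node_emit[OF okl cl1 obs], goal_cases)
    case 1
    then show ?case using code by simp
  next
    case 2
    then show ?case using c(2) ix_nth[OF dis i] by simp
  next
    case (3 t v2 h2)
    have f2: "r \<notin> {3, 25, 26} \<Longrightarrow> v2 r = ?v1 r" for r using agreeD[OF 3(3)] .
    have g2: "r \<notin> {14, 15, 16} \<Longrightarrow> h2 r = ?h1 r" for r using agreeD[OF 3(4)] .
    let ?v3 = "v2(16 := 0)"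
    have "nodes ?v3 h2 os" using n(1) f2 g2 by (simp add: nodes_def)
    moreover have "pairs_at h2 prs" using n(5) g2 by (simp add: pairs_at_def)
    ultimately have cm: "common ?v3 h2 os" using n f2 by (simp add: common_def)
    have r3: "rows h2 prs i (?v3 28) os" using c(3) f2 g2 by (simp add: rows_def)
    have p3: "row_prefix h2 prs i (?v3 28) 0 os" using f2 g2 by (simp add: row_prefix_def)
    have cl3: "clauses_at ?v3 h2 os (?cl @ rules0 ?ob)" using 3(2) by (simp add: clauses_at_def)
    have in3: "inner i (?cl @ rules0 ?ob) ?v3 h2 os 0"
      unfolding inner_def using cm r3 p3 cl3 i f2 c(2) code by simp
    have "wp (While (Lt 16 14) pair_cmd) (?v3, h2, w) (\<lambda>t'' s'''. wp (AddC 15 1) s'''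
       (\<lambda>t'''. Q (1 + (1 + (1 + (1 + (t + (1 + (t'' + t'''))))))))) "
    proof (rule wp_pairs[OF in3], goal_cases)
      case (1 t4 v4 h4 zs)
      let ?v5 = "v4(15 := v4 15 + 1)"
      have in4: "common v4 h4 (os @ zs)" "i < length (os @ zs)" "v4 15 = i" "rows h4 prs i (v4 28) (os @ zs)"
        "row_prefix h4 prs i (v4 28) (length prs) (os @ zs)"
        "clauses_at v4 h4 (os @ zs) ((?cl @ rules0 ?ob) @ concat (map (\<lambda>p. rules1 f p ((os @ zs) ! i)) prs))"
        using 1(2) by (auto simp: inner_def)
      have nth: "(os @ zs) ! i = ?ob" using i by (simp add: nth_append)
      have tk: "take (i + 1) (os @ zs) = take i os @ [?ob]"
        using take_Suc_conv_app_nth[of i "os @ zs"] i nth by (simp add: Suc_eq_plus1)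
      have "rows h4 prs (i + 1) (?v5 28) (os @ zs)"
        using in4(4,5) by (auto simp: rows_def row_prefix_def less_Suc_eq Suc_eq_plus1[symmetric])
      moreover have "clauses_at ?v5 h4 (os @ zs) (hyp @ concat (map node_clauses (take (i + 1) (os @ zs))))"
        using in4(6) nth unfolding tk by (simp add: clauses_at_def node_clauses_def)
      moreover have "common ?v5 h4 (os @ zs)" using in4(1) by (simp add: common_def nodes_def)
      ultimately have o5: "outer ?v5 h4 (os @ zs) (i + 1)"
        unfolding outer_def using in4(2,3) by simp
      have a5: "agree work_regs v ?v5"
      proof -
        have "agree work_regs v ?v1" by simp
        moreover have "agree work_regs ?v1 v2" using 3(3) by (rule agree_mono) auto
        moreover have "agree work_regs v2 ?v3" by simp
        ultimately have "agree work_regs v v4" using 1(3) unfolding agree_def by simp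
        then show ?thesis by simp
      qed
      have b5: "agree work_arrs h h4"
      proof -
        have "agree work_arrs h ?h1" by simp
        moreover have "agree work_arrs ?h1 h2" using 3(4) by (rule agree_mono) auto
        ultimately show ?thesis using 1(4) unfolding agree_def by simp
      qed
      have "1 + (1 + (1 + (1 + (t + (1 + (t4 + 1)))))) \<le> 30 + (length prs + 1) * (9 * card U + 71)"
        using 3(1) 1(1) by simp
      from Q[OF this o5 a5 b5] show ?case by simp
    qed
    then show ?case by simp
  qed
  then show ?thesis unfolding node_cmd_def by (simp add: c(2))
qed

definition closure_time :: nat where
  "closure_time = (card U + 1) * (31 + (length prs + 1) * (9 * card U + 71)) + 2"

text \<open>The table is its own work list: the pointer in register 15 chases an end that moves as
  results are appended. When it arrives, every node has a full row, so the table is closed under all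
  pairs.\<close>

lemma wp_closure:
  assumes c: "common v h os" and cl: "clauses_at v h os hyp"
    and Q: "\<And>t v' h' zs. t \<le> closure_time \<Longrightarrow> outer v' h' (os @ zs) (length (os @ zs)) \<Longrightarrow>
      agree work_regs v v' \<Longrightarrow> agree work_arrs h h' \<Longrightarrow> Q t (v', h', w)"
  shows "wp closure_cmd (v, h, w) Q"
proof -
  let ?v = "v(15 := 0, 28 := 0)"
  \<comment> \<open>The variant cannot refer to the current length of the table, which grows; it
    measures the distance of the pointer from the fixed bound \<open>card U\<close>.\<close>
  define J where "J = (\<lambda>k v' h' w'. w' = w \<and> agree work_regs v v' \<and> agree work_arrs h h' \<and>
     (\<exists>zs i. outer v' h' (os @ zs) i \<and> k = card U - i))"
  let ?B = "30 + (length prs + 1) * (9 * card U + 71)"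
  have "outer ?v h os 0" using c cl by (simp add: outer_def common_def nodes_def rows_def clauses_at_def)
  then have J0: "J (card U) ?v h w"
    unfolding J_def by (auto intro!: HOL.exI[of _ "[]"] HOL.exI[of _ "0::nat"])
  have "wp (While (Lt 15 1) node_cmd) (?v, h, w) (\<lambda>t (v', h', w'). t \<le> (card U + 1) * (?B + 1) \<and>
     \<not> holds (Lt 15 1) v' \<and> (\<exists>k' \<le> card U. J k' v' h' w'))"
  proof (rule wp_While, rule J0)
    fix k v' h' w' assume J: "J k v' h' w'" and b: "holds (Lt 15 1) v'"
    then obtain zs i where 1: "w' = w" "agree work_regs v v'" "agree work_arrs h h'"
      "outer v' h' (os @ zs) i" "k = card U - i" by (auto simp: J_def)
    have i: "i < length (os @ zs)" using b 1(4) by (auto simp: outer_def common_def nodes_def)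
    have le: "length (os @ zs) \<le> card U" using length_le[of v' h' "os @ zs"] 1(4) by (simp add: outer_def)
    show "wp node_cmd (v', h', w') (\<lambda>t (v', h', w'). t \<le> ?B \<and> (\<exists>k'<k. J k' v' h' w'))"
    proof (rule wp_node[OF 1(4) i], goal_cases)
      case (1 t v'' h'' zs')
      have "J (card U - (i + 1)) v'' h'' w'"
        unfolding J_def using \<open>w' = w\<close> agree_trans[OF \<open>agree work_regs v v'\<close> 1(3) subset_refl subset_refl]
          agree_trans[OF \<open>agree work_arrs h h'\<close> 1(4) subset_refl subset_refl] 1(2)
        by (auto intro!: HOL.exI[of _ "zs @ zs'"] HOL.exI[of _ "i + 1"])
      moreover have "card U - (i + 1) < k" using i le \<open>k = _\<close> by simp
      ultimately show ?case using 1(1) by auto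
    qed
  qed
  then have "wp (While (Lt 15 1) node_cmd) (?v, h, w) (\<lambda>t. Q (1 + (1 + t)))"
  proof (rule wp_mono)
    fix t s' assume a: "case s' of (v', h', w') \<Rightarrow> t \<le> (card U + 1) * (?B + 1) \<and>
     \<not> holds (Lt 15 1) v' \<and> (\<exists>k' \<le> card U. J k' v' h' w')"
    obtain v' h' w' where s: "s' = (v', h', w')" by (cases s')
    obtain zs i where 1: "w' = w" "agree work_regs v v'" "agree work_arrs h h'"
      "outer v' h' (os @ zs) i" "\<not> v' 15 < v' 1" "t \<le> (card U + 1) * (?B + 1)"
      using a unfolding s J_def by auto
    have "i = length (os @ zs)" using 1(4,5) by (auto simp: outer_def common_def nodes_def)
    then have "outer v' h' (os @ zs) (length (os @ zs))" using 1(4) by simp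
    moreover have "?B + 1 = 31 + (length prs + 1) * (9 * card U + 71)" by simp
    with 1(6) have "t \<le> (card U + 1) * (31 + (length prs + 1) * (9 * card U + 71))" by (simp only:)
    then have "1 + (1 + t) \<le> closure_time" unfolding closure_time_def by linarith
    ultimately show "Q (1 + (1 + t)) s'" using Q 1(1,2,3) s by blast
  qed
  then show ?thesis unfolding closure_cmd_def by simp
qed

end

section \<open>Reading and parsing the input\<close>

lemma wp_While_True:
  "holds b v \<Longrightarrow> wp (c ;; While b c) (v, h, w) (\<lambda>t. Q (t + 1)) \<Longrightarrow> wp (While b c) (v, h, w) Q"
proof -
  assume b: "holds b v" and "wp (c ;; While b c) (v, h, w) (\<lambda>t. Q (t + 1))"
  then obtain t s' where 1: "run (c ;; While b c) (v, h, w) t s'" "Q (t + 1) s'"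
    unfolding wp_def by blast
  from 1(1) obtain t1 t2 s1 where "run c (v, h, w) t1 s1" "run (While b c) s1 t2 s'" "t = t1 + t2"
    by (auto elim: run_SeqE)
  then show ?thesis using run.intros(13)[OF b, of c h w t1 s1 t2 s'] 1(2) unfolding wp_def by blast
qed

lemma wp_While_False: "\<not> holds b v \<Longrightarrow> Q 1 (v, h, w) \<Longrightarrow> wp (While b c) (v, h, w) Q"
  unfolding wp_def by (blast intro: run.intros)

definition tokens_at :: "(nat \<Rightarrow> nat \<Rightarrow> nat) \<Rightarrow> symbol list \<Rightarrow> bool" where
  "tokens_at h ss \<longleftrightarrow> (\<forall>j < length ss. h 3 j = skind (ss ! j) \<and> h 4 j = sidx (ss ! j))"

definition read_body :: cmd where
  "read_body = In 3 ;; Put 3 8 2 ;; Put 4 8 3 ;; Plus 9 9 3 ;; AddC 8 1 ;; In 2"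

text \<open>Register 9 accumulates 1 plus the sum of all indices on the tape. This exceeds each of
  them, so it yields a fresh variable without computing a maximum.\<close>

definition read_cmd :: cmd where
  "read_cmd = Const 9 1 ;; In 2 ;; While (NeC 2 0) read_body"

text \<open>At the head of the loop the kind of the next symbol is already in register 2, which is
  why only the tail of its encoding is left on the tape. At the end of the input this word is the
  default 0, which no symbol has as its kind.\<close>

lemma wp_read_loop:
  assumes "tokens_at h ss'" "v 8 = length ss'" "v 2 = (case ss of [] \<Rightarrow> 0 | s # _ \<Rightarrow> skind s)"
    "w = tl (concat (map symbol_words ss))"
    and Q: "\<And>t v' h' w'. t \<le> 7 * length ss + 1 \<Longrightarrow> tokens_at h' (ss' @ ss) \<Longrightarrow> v' 8 = length (ss' @ ss) \<Longrightarrow>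
      v' 9 = v 9 + sum_list (map sidx ss) \<Longrightarrow> agree {2, 3, 8, 9} v v' \<Longrightarrow> agree {3, 4} h h' \<Longrightarrow>
      Q t (v', h', w')"
  shows "wp (While (NeC 2 0) read_body) (v, h, w) Q"
  using assms
proof (induction ss arbitrary: v h w ss' Q)
  case Nil
  show ?case by (rule wp_While_False, use Nil.prems(3) in simp, rule Nil.prems(5)) (use Nil.prems in auto)
next
  case (Cons s ss)
  let ?v = "v(3 := sidx s, 9 := v 9 + sidx s, 8 := v 8 + 1, 2 := (case ss of [] \<Rightarrow> 0 | s # _ \<Rightarrow> skind s))"
  let ?h = "h(3 := (h 3)(length ss' := skind s), 4 := (h 4)(length ss' := sidx s))"
  have w: "w = sidx s # concat (map symbol_words ss)" using Cons.prems(4) by (simp add: symbol_words_eq[of s])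
  have c: "(case concat (map symbol_words ss) of [] \<Rightarrow> 0 | a # _ \<Rightarrow> a) = (case ss of [] \<Rightarrow> 0 | s # _ \<Rightarrow> skind s)"
    by (cases ss) (simp_all add: symbol_words_eq)
  have v2: "v 2 = skind s" using Cons.prems(3) by simp
  have "wp (While (NeC 2 0) read_body) (?v, ?h, tl (concat (map symbol_words ss))) (\<lambda>t. Q (Suc (Suc (Suc (Suc (Suc (Suc (t + 1))))))))"
  proof (rule Cons.IH[of _ "ss' @ [s]"])
    show "tokens_at ?h (ss' @ [s])"
      using Cons.prems(1) by (auto simp: tokens_at_def nth_append less_Suc_eq)
  next
    fix t v' h' w'
    assume 5: "t \<le> 7 * length ss + 1" "tokens_at h' ((ss' @ [s]) @ ss)" "v' 8 = length ((ss' @ [s]) @ ss)"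
      "v' 9 = ?v 9 + sum_list (map sidx ss)" "agree {2, 3, 8, 9} ?v v'" "agree {3, 4} ?h h'"
    have "agree {2, 3, 8, 9} v v'" using 5(5) by (auto simp: agree_def)
    moreover have "agree {3, 4} h h'" using 5(6) by (auto simp: agree_def)
    ultimately show "Q (Suc (Suc (Suc (Suc (Suc (Suc (t + 1))))))) (v', h', w')" using 5(1-4) by (intro Cons.prems(5)) auto
  qed (use Cons.prems(2) in auto)
  then show ?case
    by (intro wp_While_True) (simp_all add: v2 read_body_def w c Cons.prems(2) algebra_simps)
qed

lemma wp_read:
  assumes "v 8 = 0" "w = concat (map symbol_words ss)"
    and Q: "\<And>t v' h' w'. t \<le> 7 * length ss + 3 \<Longrightarrow> tokens_at h' ss \<Longrightarrow> v' 8 = length ss \<Longrightarrow>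
      v' 9 = 1 + sum_list (map sidx ss) \<Longrightarrow> agree {2, 3, 8, 9} v v' \<Longrightarrow> agree {3, 4} h h' \<Longrightarrow>
      Q t (v', h', w')"
  shows "wp read_cmd (v, h, w) Q"
proof -
  have c: "(case concat (map symbol_words ss) of [] \<Rightarrow> 0 | a # _ \<Rightarrow> a) = (case ss of [] \<Rightarrow> 0 | s # _ \<Rightarrow> skind s)"
    by (cases ss) (simp_all add: symbol_words_eq)
  let ?v = "v(9 := 1, 2 := (case ss of [] \<Rightarrow> 0 | s # _ \<Rightarrow> skind s))"
  have "wp (While (NeC 2 0) read_body) (?v, h, tl w) (\<lambda>t. Q (1 + (1 + t)))"
  proof (rule wp_read_loop[of _ "[]" _ ss], goal_cases)
    case (5 t v' h' w')
    then show ?case by (intro Q) (auto simp: agree_def)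
  qed (use assms in \<open>auto simp: tokens_at_def\<close>)
  then show ?thesis by (simp add: read_cmd_def assms(2) c)
qed

text \<open>The head of \<open>stk\<close> is the top of the stack, which in the array is the last
  used cell; hence the reversal. The bottom keeps cell 0 throughout.\<close>

definition parse_at :: "(nat \<Rightarrow> nat) \<Rightarrow> (nat \<Rightarrow> nat \<Rightarrow> nat) \<Rightarrow> pstate \<Rightarrow> bool" where
  "parse_at v h = (\<lambda>(os, stk, pd, vs, ts). nodes v h os \<and>
     v 10 = length stk \<and> (\<forall>j < length stk. Fm (rev stk ! j) \<in> set os \<and> h 5 j = ix os (Fm (rev stk ! j))) \<and>
     Args pd \<in> set os \<and> v 11 = ix os (Args pd) \<and>
     v 12 = length vs \<and> (\<forall>j < length vs. h 6 j = vs ! j) \<and>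
     v 13 = length ts \<and> (\<forall>j < length ts. (h 7 j, h 8 j) = tcode (ts ! j)))"

definition push_cmd :: cmd where
  "push_cmd = Put 5 10 4 ;; AddC 10 1"

definition atom_cmd :: cmd where
  "atom_cmd = Mov 5 17 ;; Const 6 0 ;; Const 7 0 ;; mk_cmd ;; push_cmd"

definition term_cmd :: cmd where
  "term_cmd = Mov 5 17 ;; Mov 6 18 ;; Mov 7 11 ;; mk_cmd ;; Mov 11 4 ;; Put 7 13 17 ;; Put 8 13 18 ;; AddC 13 1"

definition rel_cmd :: cmd where
  "rel_cmd = Mov 5 17 ;; Mov 6 18 ;; Mov 7 11 ;; Const 11 3 ;; mk_cmd ;; push_cmd"

definition binary_cmd :: cmd where
  "binary_cmd = Mov 5 17 ;; SubC 10 1 ;; Get 6 5 10 ;; SubC 10 1 ;; Get 7 5 10 ;; mk_cmd ;; push_cmd"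

text \<open>The bound variable is recovered from the pending list \<open>[Var x]\<close>: the second
  component of its node is \<open>x\<close>. Afterwards the pending list is reset to node 3, the
  empty one.\<close>

definition binder_cmd :: cmd where
  "binder_cmd = Mov 5 17 ;; Get 6 1 11 ;; Put 6 12 6 ;; AddC 12 1 ;; Const 11 3 ;; SubC 10 1 ;; Get 7 5 10 ;;
     mk_cmd ;; push_cmd"

definition token_cmd :: cmd where
  "token_cmd = If (NeC 17 11) (If (NeC 17 8) (If (NeC 17 9) (If (NeC 17 10) (If (NeC 17 1) (If (NeC 17 2)
     (If (NeC 17 6) (If (NeC 17 7) binary_cmd binder_cmd) binder_cmd)
     atom_cmd) atom_cmd) rel_cmd) term_cmd) term_cmd) nop"

abbreviation parse_regs :: "nat set" where
  "parse_regs \<equiv> {1, 2, 3, 4, 5, 6, 7, 8, 10, 11, 12, 13, 17, 18}"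

abbreviation token_regs :: "nat set" where
  "token_regs \<equiv> {1, 2, 3, 4, 5, 6, 7, 10, 11, 12, 13}"

abbreviation parse_arrs :: "nat set" where
  "parse_arrs \<equiv> {0, 1, 2, 5, 6, 7, 8}"

lemma parse_atD:
  assumes "parse_at v h (os, stk, pd, vs, ts)"
  shows "nodes v h os" "v 10 = length stk"
    "\<And>j. j < length stk \<Longrightarrow> Fm (rev stk ! j) \<in> set os \<and> h 5 j = ix os (Fm (rev stk ! j))"
    "Args pd \<in> set os" "v 11 = ix os (Args pd)" "v 12 = length vs" "\<And>j. j < length vs \<Longrightarrow> h 6 j = vs ! j"
    "v 13 = length ts" "\<And>j. j < length ts \<Longrightarrow> (h 7 j, h 8 j) = tcode (ts ! j)"
    "okl os"
  using assms by (auto simp: parse_at_def nodes_def)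

lemma wp_mk_push:
  assumes P: "parse_at v h (os, stk, pd, vs, ts)"
    and c: "children (Fm B) \<subseteq> set os" "code os (Fm B) = (v 5, v 6, v 7)"
    and Q: "\<And>t t' v' h'. t + t' \<le> 9 * length os + 19 \<Longrightarrow>
      parse_at v' h' (ins os (Fm B), B # stk, pd, vs, ts) \<Longrightarrow>
      agree {1, 2, 3, 4, 10} v v' \<Longrightarrow> agree {0, 1, 2, 5} h h' \<Longrightarrow> Q t t' (v', h', w)"
  shows "wp mk_cmd (v, h, w) (\<lambda>t s'. wp push_cmd s' (Q t))"
proof (rule wp_mk[OF parse_atD(1)[OF P] c], goal_cases)
  case (1 t v' h')
  note P = parse_atD[OF P]
  have f: "r \<notin> {1, 2, 3, 4} \<Longrightarrow> v' r = v r" for r using agreeD[OF 1(4)] .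
  have g: "r \<notin> {0, 1, 2} \<Longrightarrow> h' r = h r" for r using agreeD[OF 1(5)] .
  obtain zs where zs: "ins os (Fm B) = os @ zs" using ins_extends by blast
  let ?v = "v'(10 := v' 10 + 1)" and ?h = "h'(5 := (h' 5)(v' 10 := v' 4))"
  have "nodes ?v ?h (os @ zs)" using 1(2) zs by (simp add: nodes_def)
  moreover have "Fm (rev (B # stk) ! j) \<in> set (os @ zs) \<and> ?h 5 j = ix (os @ zs) (Fm (rev (B # stk) ! j))"
    if "j < length (B # stk)" for j
  proof (cases "j < length stk")
    case True
    then show ?thesis using P(2) P(3)[OF True] f g by (simp add: nth_append ix_append)
  next
    case False
    then have "j = length stk" using that by simp
    moreover have "Fm B \<in> set (os @ zs)" using set_ins[of os "Fm B"] zs by simp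
    ultimately show ?thesis using P(2) f 1(3) zs by (simp add: nth_append)
  qed
  ultimately have "parse_at ?v ?h (ins os (Fm B), B # stk, pd, vs, ts)"
    unfolding parse_at_def zs using P f g by (auto simp: ix_append)
  moreover have "agree {1, 2, 3, 4, 10} v ?v" using 1(4) by (auto simp: agree_def)
  moreover have "agree {0, 1, 2, 5} h ?h" using 1(5) by (auto simp: agree_def)
  moreover have "t + (1 + 1) \<le> 9 * length os + 19" using 1(1) by simp
  ultimately show ?case unfolding push_cmd_def by (simp del: One_nat_def) (auto intro: Q)
qed

lemma wp_atom:
  assumes P: "parse_at v h (os, stk, pd, vs, ts)" and B: "code os (Fm B) = (v 17, 0, 0)" "B \<in> {Top, Bot}"
    and Q: "\<And>t v' h'. t \<le> 9 * length os + 30 \<Longrightarrow> parse_at v' h' (ins os (Fm B), B # stk, pd, vs, ts) \<Longrightarrow>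
      agree token_regs v v' \<Longrightarrow> agree parse_arrs h h' \<Longrightarrow> Q t (v', h', w)"
  shows "wp atom_cmd (v, h, w) Q"
  unfolding atom_cmd_def wp_Seq wp_simps
proof (rule wp_mk_push[where B = B and stk = stk and os = os and pd = pd and vs = vs and ts = ts], goal_cases)
  case 1
  show ?case using P by (simp add: parse_at_def nodes_def)
next
  case (4 t t' v' h')
  then show ?case by (intro Q) (auto simp: agree_def)
qed (use B in auto)

lemma wp_rel:
  assumes P: "parse_at v h (os, stk, pd, vs, ts)" and v: "v 17 = 10" "v 18 = R"
    and Q: "\<And>t v' h'. t \<le> 9 * length os + 30 \<Longrightarrow>
      parse_at v' h' (ins os (Fm (Rel R pd)), Rel R pd # stk, [], vs, ts) \<Longrightarrow>
      agree token_regs v v' \<Longrightarrow> agree parse_arrs h h' \<Longrightarrow> Q t (v', h', w)"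
  shows "wp rel_cmd (v, h, w) Q"
proof -
  note D = parse_atD[OF P]
  let ?v = "v(5 := v 17, 6 := v 18, 7 := v 11, 11 := 3)"
  have P': "parse_at ?v h (os, stk, [], vs, ts)"
    using D okl_ix[OF D(10)] okl_in[OF D(10)] by (simp add: parse_at_def nodes_def)
  have "wp (Mov 5 17 ;; Mov 6 18 ;; Mov 7 11 ;; Const 11 3 ;; mk_cmd ;; push_cmd) (v, h, w) Q"
    unfolding wp_Seq wp_simps
  proof (rule wp_mk_push[where B = "Rel R pd" and stk = stk and os = os and pd = "[]" and vs = vs and ts = ts], goal_cases)
    case 1
    show ?case using P' by simp
  next
    case (4 t t' v' h')
    then show ?case by (intro Q) (auto simp: agree_def)
  qed (use D v in auto)
  then show ?thesis unfolding rel_cmd_def .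
qed

lemma wp_binary:
  assumes P: "parse_at v h (os, B # C # stk, pd, vs, ts)"
    and D: "(v 17, D) \<in> {(3, Conj B C), (4, Disj B C), (5, Imp B C)}"
    and Q: "\<And>t v' h'. t \<le> 9 * length os + 30 \<Longrightarrow> parse_at v' h' (ins os (Fm D), D # stk, pd, vs, ts) \<Longrightarrow>
      agree token_regs v v' \<Longrightarrow> agree parse_arrs h h' \<Longrightarrow> Q t (v', h', w)"
  shows "wp binary_cmd (v, h, w) Q"
proof -
  note P' = parse_atD[OF P]
  have m: "Fm C \<in> set os" "h 5 (length stk) = ix os (Fm C)" "Fm B \<in> set os" "h 5 (Suc (length stk)) = ix os (Fm B)"
    using P'(3)[of "length stk"] P'(3)[of "Suc (length stk)"] by (auto simp: nth_append)
  have tl: "Fm (rev stk ! j) \<in> set os \<and> h 5 j = ix os (Fm (rev stk ! j))" if "j < length stk" for j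
    using P'(3)[of j] that by (simp add: nth_append)
  have v10: "v 10 = Suc (Suc (length stk))" using P'(2) by simp
  show ?thesis
    unfolding binary_cmd_def wp_Seq wp_simps
  proof (rule wp_mk_push[where B = D and stk = stk and os = os and pd = pd and vs = vs and ts = ts], goal_cases)
    case 1
    show ?case using P' tl v10 by (simp add: parse_at_def nodes_def)
  next
    case 2
    show ?case using D m by auto
  next
    case 3
    show ?case using D m v10 by auto
  next
    case (4 t t' v' h')
    then show ?case by (intro Q) (auto simp: agree_def)
  qed
qed

lemma wp_binder:
  assumes P: "parse_at v h (os, B # stk, [Var x], vs, ts)"
    and D: "(v 17, D) \<in> {(6, All x B), (7, Ex x B)}"
    and Q: "\<And>t v' h'. t \<le> 9 * length os + 30 \<Longrightarrow> parse_at v' h' (ins os (Fm D), D # stk, [], vs @ [x], ts) \<Longrightarrow>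
      agree token_regs v v' \<Longrightarrow> agree parse_arrs h h' \<Longrightarrow> Q t (v', h', w)"
  shows "wp binder_cmd (v, h, w) Q"
proof -
  note P' = parse_atD[OF P]
  have m: "Fm B \<in> set os" "h 5 (length stk) = ix os (Fm B)"
    using P'(3)[of "length stk"] by (auto simp: nth_append)
  have tl: "Fm (rev stk ! j) \<in> set os \<and> h 5 j = ix os (Fm (rev stk ! j))" if "j < length stk" for j
    using P'(3)[of j] that by (simp add: nth_append)
  have v10: "v 10 = Suc (length stk)" using P'(2) by simp
  have "v 11 < length os" "os ! v 11 = Args [Var x]" using P'(4,5) ix_less nth_ix by auto
  then have x: "h 1 (v 11) = x" using P'(1) by (auto simp: nodes_def)
  have vs: "((h 6)(length vs := x)) j = (vs @ [x]) ! j" if "j < length (vs @ [x])" for j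
    using P'(7) that by (auto simp: nth_append less_Suc_eq)
  show ?thesis
    unfolding binder_cmd_def wp_Seq wp_simps
  proof (rule wp_mk_push[where B = D and stk = stk and os = os and pd = "[]" and vs = "vs @ [x]" and ts = ts], goal_cases)
    case 1
    show ?case using P' tl v10 x vs okl_ix[OF P'(10)] okl_in[OF P'(10)]
      by (simp add: parse_at_def nodes_def)
  next
    case 2
    show ?case using D m by auto
  next
    case 3
    show ?case using D m v10 x by auto
  next
    case (4 t t' v' h')
    have "agree parse_arrs h h'" using 4(4) by (auto simp: agree_def)
    then show ?case using 4 by (intro Q) (auto simp: agree_def)
  qed
qed

lemma wp_term:
  assumes P: "parse_at v h (os, stk, pd, vs, ts)" and v: "(v 17, v 18) = tcode t"
    and Q: "\<And>n v' h'. n \<le> 9 * length os + 30 \<Longrightarrow>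
      parse_at v' h' (ins os (Args (t # pd)), stk, t # pd, vs, ts @ [t]) \<Longrightarrow>
      agree token_regs v v' \<Longrightarrow> agree parse_arrs h h' \<Longrightarrow> Q n (v', h', w)"
  shows "wp term_cmd (v, h, w) Q"
proof -
  note P' = parse_atD[OF P]
  show ?thesis
    unfolding term_cmd_def wp_Seq wp_simps
  proof (rule wp_mk[where os = os and ob = "Args (t # pd)"], goal_cases)
    case 1
    show ?case using P'(1) by (simp add: nodes_def)
  next
    case 2
    show ?case using P'(4) by simp
  next
    case 3
    show ?case using v P'(5) by (cases t) auto
  next
    case (4 n v' h')
    let ?v0 = "v(5 := v 17, 6 := v 18, 7 := v 11)"
    have f: "r \<notin> {1, 2, 3, 4, 5, 6, 7} \<Longrightarrow> v' r = v r" for r using agreeD[OF 4(4), of r] by auto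
    have g: "r \<notin> {0, 1, 2} \<Longrightarrow> h' r = h r" for r using agreeD[OF 4(5)] .
    obtain zs where zs: "ins os (Args (t # pd)) = os @ zs" using ins_extends by blast
    have mem: "Args (t # pd) \<in> set (os @ zs)" using set_ins[of os "Args (t # pd)"] zs by simp
    let ?v = "v'(11 := v' 4, 13 := v' 13 + 1)"
    let ?h = "h'(7 := (h' 7)(v' 13 := v' 17), 8 := (h' 8)(v' 13 := v' 18))"
    have nd: "nodes ?v ?h (os @ zs)" using 4(2) zs by (simp add: nodes_def)
    have "(?h 7 j, ?h 8 j) = tcode ((ts @ [t]) ! j)" if "j < length (ts @ [t])" for j
      using that P'(8,9) f g v by (auto simp: nth_append less_Suc_eq)
    then have "parse_at ?v ?h (ins os (Args (t # pd)), stk, t # pd, vs, ts @ [t])"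
      unfolding parse_at_def zs using nd P' f g mem 4(3) zs by (auto simp: ix_append)
    moreover have "agree token_regs v ?v" using 4(4) by (auto simp: agree_def)
    moreover have "agree parse_arrs h ?h" using 4(5) by (auto simp: agree_def)
    ultimately show ?case using 4(1) by (auto intro: Q)
  qed
qed

lemma wp_token:
  assumes P: "parse_at v h st" and s: "pstep s (Some st) = Some st'" and v: "v 17 = skind s" "v 18 = sidx s"
    and Q: "\<And>t v' h'. t \<le> 9 * length (fst st) + 40 \<Longrightarrow> parse_at v' h' st' \<Longrightarrow>
      agree token_regs v v' \<Longrightarrow> agree parse_arrs h h' \<Longrightarrow> Q t (v', h', w)"
  shows "wp token_cmd (v, h, w) Q"
proof -
  obtain os stk pd vs ts where st: "st = (os, stk, pd, vs, ts)" by (cases st)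
  note P = P[unfolded st]
  have Q': "Q t (v', h', w)" if "t \<le> 9 * length os + 40" "parse_at v' h' st'"
      "agree token_regs v v'" "agree parse_arrs h h'" for t v' h'
    using Q that st by simp
  show ?thesis
  proof (cases s)
    case TopS
    then show ?thesis using v s
      by (simp add: token_cmd_def st, intro wp_atom[OF P, of Top]) (auto intro!: Q')
  next
    case BotS
    then show ?thesis using v s
      by (simp add: token_cmd_def st, intro wp_atom[OF P, of Bot]) (auto intro!: Q')
  next
    case ConjS
    then obtain B C stk' where "stk = B # C # stk'" "st' = (ins os (Fm (Conj B C)), Conj B C # stk', pd, vs, ts)"
      using s st by (cases "(ConjS, Some st)" rule: pstep.cases) auto
    then show ?thesis using v ConjS P
      by (simp add: token_cmd_def, intro wp_binary[of _ _ _ B C stk' pd vs ts "Conj B C"]) (auto intro!: Q')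
  next
    case DisjS
    then obtain B C stk' where "stk = B # C # stk'" "st' = (ins os (Fm (Disj B C)), Disj B C # stk', pd, vs, ts)"
      using s st by (cases "(DisjS, Some st)" rule: pstep.cases) auto
    then show ?thesis using v DisjS P
      by (simp add: token_cmd_def, intro wp_binary[of _ _ _ B C stk' pd vs ts "Disj B C"]) (auto intro!: Q')
  next
    case ImpS
    then obtain B C stk' where "stk = B # C # stk'" "st' = (ins os (Fm (Imp B C)), Imp B C # stk', pd, vs, ts)"
      using s st by (cases "(ImpS, Some st)" rule: pstep.cases) auto
    then show ?thesis using v ImpS P
      by (simp add: token_cmd_def, intro wp_binary[of _ _ _ B C stk' pd vs ts "Imp B C"]) (auto intro!: Q')
  next
    case AllS
    then obtain B stk' x where "stk = B # stk'" "pd = [Var x]"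
        "st' = (ins os (Fm (All x B)), All x B # stk', [], vs @ [x], ts)"
      using s st by (cases "(AllS, Some st)" rule: pstep.cases) auto
    then show ?thesis using v AllS P
      by (simp add: token_cmd_def, intro wp_binder[of _ _ _ B stk' x vs ts "All x B"]) (auto intro!: Q')
  next
    case ExS
    then obtain B stk' x where "stk = B # stk'" "pd = [Var x]"
        "st' = (ins os (Fm (Ex x B)), Ex x B # stk', [], vs @ [x], ts)"
      using s st by (cases "(ExS, Some st)" rule: pstep.cases) auto
    then show ?thesis using v ExS P
      by (simp add: token_cmd_def, intro wp_binder[of _ _ _ B stk' x vs ts "Ex x B"]) (auto intro!: Q')
  next
    case (VarS x)
    then show ?thesis using v s
      by (simp add: token_cmd_def st, intro wp_term[OF P, of "Var x"]) (auto intro!: Q')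
  next
    case (CstS x)
    then show ?thesis using v s
      by (simp add: token_cmd_def st, intro wp_term[OF P, of "Cst x"]) (auto intro!: Q')
  next
    case (RelS R)
    then show ?thesis using v s
      by (simp add: token_cmd_def st, intro wp_rel[OF P]) (auto intro!: Q')
  next
    case Comma
    then have "parse_at (v(3 := v 3)) h st'" using P s by (simp add: st)
    then show ?thesis using v Comma by (auto simp: token_cmd_def intro!: Q')
  qed
qed

text \<open>The first assignments lay out \<open>base\<close>. Only three kinds have to be written,
  because the memory is initially 0 and \<open>Fail\<close> has the triple of zeros.\<close>

definition parse_cmd :: cmd where
  "parse_cmd = Const 2 1 ;; Put 0 2 2 ;; Const 2 2 ;; Put 0 2 2 ;; Const 2 3 ;; Const 3 11 ;; Put 0 2 3 ;;
     Const 1 4 ;; Const 11 3 ;;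
     While (NeC 8 0) (SubC 8 1 ;; Get 17 3 8 ;; Get 18 4 8 ;; token_cmd)"

lemma pstep_length: "pstep s (Some st) = Some st' \<Longrightarrow> length (fst st) \<le> length (fst st')"
  by (cases "(s, Some st)" rule: pstep.cases) (auto simp: ins_def)

lemma fold_pstep_length: "fold pstep ss (Some st) = Some st' \<Longrightarrow> length (fst st) \<le> length (fst st')"
proof (induction ss arbitrary: st)
  case (Cons s ss)
  then obtain st1 where 1: "pstep s (Some st) = Some st1" by (cases "pstep s (Some st)") auto
  then show ?case using Cons pstep_length[OF 1] by fastforce
qed simp

text \<open>Symbols are taken from the end of the array, hence the reverse induction. Each lookup is
  charged at the final size of the table, which by \<open>fold_pstep_length\<close> is never
  exceeded on the way.\<close>

lemma wp_parse_loop: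
  assumes "parse_at v h st" "tokens_at h ss" "v 8 = length ss" "fold pstep (rev ss) (Some st) = Some st'"
    and Q: "\<And>t v' h'. t \<le> length ss * (9 * length (fst st') + 50) + 1 \<Longrightarrow> parse_at v' h' st' \<Longrightarrow>
      agree parse_regs v v' \<Longrightarrow> agree parse_arrs h h' \<Longrightarrow> Q t (v', h', w)"
  shows "wp (While (NeC 8 0) (SubC 8 1 ;; Get 17 3 8 ;; Get 18 4 8 ;; token_cmd)) (v, h, w) Q"
  using assms
proof (induction ss arbitrary: v h st Q rule: rev_induct)
  case Nil
  show ?case
    by (rule wp_While_False, use Nil.prems(3) in simp, rule Nil.prems(5)) (use Nil.prems(1,4) in auto)
next
  case (snoc s ss)
  obtain st1 where 1: "pstep s (Some st) = Some st1" using snoc.prems(4)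
    by (cases "pstep s (Some st)") auto
  have 2: "fold pstep (rev ss) (Some st1) = Some st'" using snoc.prems(4) 1 by simp
  have len: "length (fst st) \<le> length (fst st')"
    using pstep_length[OF 1] fold_pstep_length[OF 2] by simp
  have v8: "v 8 = Suc (length ss)" using snoc.prems(3) by simp
  have tok: "h 3 (length ss) = skind s" "h 4 (length ss) = sidx s"
    using snoc.prems(2) by (auto simp: tokens_at_def nth_append)
  let ?v = "v(8 := length ss, 17 := skind s, 18 := sidx s)"
  have P: "parse_at ?v h st" using snoc.prems(1) by (auto simp: parse_at_def nodes_def)
  let ?W = "While (NeC 8 0) (SubC 8 1 ;; Get 17 3 8 ;; Get 18 4 8 ;; token_cmd)"
  have "wp token_cmd (?v, h, w) (\<lambda>t s'. wp ?W s' (\<lambda>t'. Q (1 + (1 + (1 + t)) + t' + 1)))"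
  proof (rule wp_token[OF P 1])
    fix t v' h'
    assume 3: "t \<le> 9 * length (fst st) + 40" "parse_at v' h' st1" "agree token_regs ?v v'" "agree parse_arrs h h'"
    have v'8: "v' 8 = length ss"
      using agreeD[OF 3(3), of 8] by simp
    show "wp ?W (v', h', w) (\<lambda>t'. Q (1 + (1 + (1 + t)) + t' + 1))"
    proof (rule snoc.IH[OF 3(2) _ v'8 2])
      show "tokens_at h' ss" using snoc.prems(2) agreeD[OF 3(4)]
        by (auto simp: tokens_at_def nth_append)
    next
      fix t' v'' h''
      assume 4: "t' \<le> length ss * (9 * length (fst st') + 50) + 1" "parse_at v'' h'' st'"
        "agree parse_regs v' v''" "agree parse_arrs h' h''"
      have "agree parse_regs v v''" using 3(3) 4(3) by (auto simp: agree_def)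
      moreover have "agree parse_arrs h h''" using 3(4) 4(4) by (auto simp: agree_def)
      ultimately show "Q (1 + (1 + (1 + t)) + t' + 1) (v'', h'', w)"
        using 4 3(1) len by (intro snoc.prems(5)) auto
    qed
  qed (use v8 in auto)
  then show ?case
    by (intro wp_While_True) (simp_all add: v8 tok)
qed

lemma wp_parse:
  assumes h: "\<And>a. a \<in> {0, 1, 2} \<Longrightarrow> h a = (\<lambda>_. 0)" and v: "v 10 = 0" "v 12 = 0" "v 13 = 0"
    and t: "tokens_at h ss" "v 8 = length ss" "fold pstep (rev ss) (Some (base, [], [], [], [])) = Some st'"
    and Q: "\<And>t v' h'. t \<le> length ss * (9 * length (fst st') + 50) + 10 \<Longrightarrow> parse_at v' h' st' \<Longrightarrow>
      agree parse_regs v v' \<Longrightarrow> agree parse_arrs h h' \<Longrightarrow> Q t (v', h', w)"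
  shows "wp parse_cmd (v, h, w) Q"
proof -
  let ?v = "v(2 := 3, 3 := 11, 1 := 4, 11 := 3)"
  let ?h = "h(0 := (h 0)(1 := 1, 2 := 2, 3 := 11))"
  have "nodes ?v ?h base"
    using okl_base h by (auto simp: nodes_def base_def less_Suc_eq numeral_eq_Suc nth_Cons')
  then have P: "parse_at ?v ?h (base, [], [], [], [])"
    using v okl_ix[OF okl_base] okl_in[OF okl_base] by (simp add: parse_at_def)
  have "wp (While (NeC 8 0) (SubC 8 1 ;; Get 17 3 8 ;; Get 18 4 8 ;; token_cmd)) (?v, ?h, w)
      (\<lambda>t. Q (1 + (1 + (1 + (1 + (1 + (1 + (1 + (1 + (1 + t))))))))))"
  proof (rule wp_parse_loop[OF P _ _ t(3)])
    fix t v' h'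
    assume 1: "t \<le> length ss * (9 * length (fst st') + 50) + 1" "parse_at v' h' st'"
      "agree parse_regs ?v v'" "agree parse_arrs ?h h'"
    have "agree parse_regs v v'" using 1(3) by (auto simp: agree_def)
    moreover have "agree parse_arrs h h'" using 1(4) by (auto simp: agree_def)
    ultimately show "Q (1 + (1 + (1 + (1 + (1 + (1 + (1 + (1 + (1 + t))))))))) (v', h', w)" using 1 by (intro Q) auto
  qed (use t in \<open>auto simp: tokens_at_def\<close>)
  then show ?thesis by (simp add: parse_cmd_def)
qed

section \<open>Pairs, hypotheses, and Horn saturation\<close>

definition terms_at :: "(nat \<Rightarrow> nat \<Rightarrow> nat) \<Rightarrow> trm list \<Rightarrow> bool" where
  "terms_at h ts \<longleftrightarrow> (\<forall>j < length ts. (h 7 j, h 8 j) = tcode (ts ! j))"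

lemma product_snoc: "List.product (xs @ [x]) ys = List.product xs ys @ map (Pair x) ys"
  by (induction xs) auto

definition pairs_body :: cmd where
  "pairs_body = Get 21 7 16 ;; Get 22 8 16 ;; Put 9 14 20 ;; Put 10 14 21 ;; Put 11 14 22 ;;
     AddC 14 1 ;; AddC 16 1"

definition pairs_row :: cmd where
  "pairs_row = Get 20 6 15 ;; Const 16 0 ;; While (Lt 16 13) pairs_body ;; AddC 15 1"

text \<open>Binders and terms are listed with repetitions, which are not removed: the length of the
  list of pairs only enters a polynomial factor, while the number of nodes depends on the sets
  \<open>V\<close> and \<open>T\<close>.\<close>

definition pairs_cmd :: cmd where
  "pairs_cmd = Const 17 8 ;; Put 7 13 17 ;; Put 8 13 9 ;; AddC 13 1 ;; Const 15 0 ;; Const 14 0 ;;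
     While (Lt 15 12) pairs_row"

lemma wp_pairs_inner:
  assumes p: "pairs_at h prs" "v 14 = length prs" and ts: "terms_at h ts" "v 13 = length ts"
    and v: "v 16 = 0" "v 20 = x"
    and Q: "\<And>t v' h'. t \<le> (length ts + 1) * 8 \<Longrightarrow> pairs_at h' (prs @ map (Pair x) ts) \<Longrightarrow>
      v' 14 = length prs + length ts \<Longrightarrow> agree {14, 16, 21, 22} v v' \<Longrightarrow> agree {9, 10, 11} h h' \<Longrightarrow>
      Q t (v', h', w)"
  shows "wp (While (Lt 16 13) pairs_body) (v, h, w) Q"
proof -
  define I where "I = (\<lambda>i v' h'. v' 16 = i \<and> i \<le> length ts \<and> agree {14, 16, 21, 22} v v' \<and>
    agree {9, 10, 11} h h' \<and> v' 14 = length prs + i \<and> pairs_at h' (prs @ map (Pair x) (take i ts)))"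
  show ?thesis
  proof (rule wp_for[where I = I and n = "length ts" and B = 7])
    show "I 0 v h" using p v by (simp add: I_def)
  next
    fix i v' h' assume a: "I i v' h'"
    then have "v' 13 = v 13" using agreeD[of "{14, 16, 21, 22}" v v' 13] by (simp add: I_def)
    then show "v' 16 = i \<and> v' 13 = length ts \<and> i \<le> length ts" using a ts by (simp add: I_def)
  next
    fix i v' h' assume a: "I i v' h'" and i: "i < length ts"
    have fr: "agree {14, 16, 21, 22} v v'" "agree {9, 10, 11} h h'" "v' 16 = i" "v' 14 = length prs + i"
      "pairs_at h' (prs @ map (Pair x) (take i ts))"
      using a by (auto simp: I_def)
    have v20: "v' 20 = x" using agreeD[OF fr(1), of 20] v by simp
    have t: "(h' 7 i, h' 8 i) = tcode (ts ! i)"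
      using agreeD[OF fr(2), of 7] agreeD[OF fr(2), of 8] ts(1) i by (simp add: terms_at_def)
    have tk: "take (i + 1) ts = take i ts @ [ts ! i]"
      using take_Suc_conv_app_nth[OF i] by (simp add: Suc_eq_plus1)
    let ?h = "h'(9 := (h' 9)(length prs + i := x), 10 := (h' 10)(length prs + i := h' 7 i),
       11 := (h' 11)(length prs + i := h' 8 i))"
    have "pairs_at ?h (prs @ map (Pair x) (take (i + 1) ts))"
      using fr(5) i t unfolding tk
      by (auto simp: pairs_at_def nth_append less_Suc_eq)
    then have "I (i + 1) (v'(21 := h' 7 i, 22 := h' 8 i, 14 := length prs + i + 1, 16 := i + 1)) ?h"
      using fr(1,2) i by (simp add: I_def)
    then show "wp pairs_body (v', h', w) (\<lambda>t (v', h', w'). t \<le> 7 \<and> w' = w \<and> I (i + 1) v' h')"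
      by (simp add: pairs_body_def fr(3,4) v20)
  next
    fix t v' h' assume "t \<le> (length ts + 1) * (7 + 1)" "I (length ts) v' h'"
    then show "Q t (v', h', w)" by (intro Q) (auto simp: I_def)
  qed
qed

lemma wp_pairs_cmd:
  assumes ts: "terms_at h ts" "v 13 = length ts" and vs: "v 12 = length vs" "\<And>j. j < length vs \<Longrightarrow> h 6 j = vs ! j"
    and f: "v 9 = f"
    and Q: "\<And>t v' h'. t \<le> (length vs + 1) * ((length ts + 2) * 8 + 4) + 6 \<Longrightarrow>
      pairs_at h' (List.product vs (ts @ [Var f])) \<Longrightarrow>
      v' 14 = length (List.product vs (ts @ [Var f])) \<Longrightarrow>
      agree {13, 14, 15, 16, 17, 20, 21, 22} v v' \<Longrightarrow> agree {7, 8, 9, 10, 11} h h' \<Longrightarrow>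
      Q t (v', h', w)"
  shows "wp pairs_cmd (v, h, w) Q"
proof -
  let ?ts = "ts @ [Var f]"
  let ?v = "v(17 := 8, 13 := length ts + 1, 15 := 0, 14 := 0)"
  let ?h = "h(7 := (h 7)(length ts := 8), 8 := (h 8)(length ts := f))"
  have ts': "terms_at ?h ?ts" using ts by (auto simp: terms_at_def nth_append less_Suc_eq)
  define I where "I = (\<lambda>i v' h'. v' 15 = i \<and> i \<le> length vs \<and> agree {14, 15, 16, 20, 21, 22} ?v v' \<and>
    agree {9, 10, 11} ?h h' \<and> v' 14 = length (List.product (take i vs) ?ts) \<and>
    pairs_at h' (List.product (take i vs) ?ts))"
  have "wp (While (Lt 15 12) pairs_row) (?v, ?h, w) (\<lambda>t. Q (1 + (1 + (1 + (1 + (1 + (1 + t)))))))"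
  proof (rule wp_for[where I = I and n = "length vs" and B = "(length ts + 2) * 8 + 3"])
    show "I 0 ?v ?h" by (simp add: I_def pairs_at_def)
  next
    fix i v' h' assume a: "I i v' h'"
    then have "v' 12 = v 12" using agreeD[of "{14, 15, 16, 20, 21, 22}" ?v v' 12] by (simp add: I_def)
    then show "v' 15 = i \<and> v' 12 = length vs \<and> i \<le> length vs" using a vs by (simp add: I_def)
  next
    fix i v' h' assume a: "I i v' h'" and i: "i < length vs"
    have fr: "agree {14, 15, 16, 20, 21, 22} ?v v'" "agree {9, 10, 11} ?h h'" "v' 15 = i"
      "v' 14 = length (List.product (take i vs) ?ts)" "pairs_at h' (List.product (take i vs) ?ts)"
      using a by (auto simp: I_def)
    have v13: "v' 13 = length ?ts" using agreeD[OF fr(1), of 13] by simp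
    have t': "terms_at h' ?ts" using ts' agreeD[OF fr(2), of 7] agreeD[OF fr(2), of 8]
      by (simp add: terms_at_def)
    have x: "h' 6 i = vs ! i" using agreeD[OF fr(2), of 6] vs(2)[OF i] by simp
    have tk: "take (i + 1) vs = take i vs @ [vs ! i]"
      using take_Suc_conv_app_nth[OF i] by (simp add: Suc_eq_plus1)
    have "wp (While (Lt 16 13) pairs_body) (v'(20 := vs ! i, 16 := 0), h', w)
       (\<lambda>t s'. wp (AddC 15 1) s' (\<lambda>t'. (\<lambda>t (v', h', w'). t \<le> (length ts + 2) * 8 + 3 \<and> w' = w \<and> I (i + 1) v' h')
         (1 + (1 + (t + t')))))"
    proof (rule wp_pairs_inner[where prs = "List.product (take i vs) ?ts" and ts = ?ts and x = "vs ! i"])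
      fix t v'' h''
      assume 1: "t \<le> (length ?ts + 1) * 8" "pairs_at h'' (List.product (take i vs) ?ts @ map (Pair (vs ! i)) ?ts)"
        "v'' 14 = length (List.product (take i vs) ?ts) + length ?ts"
        "agree {14, 16, 21, 22} (v'(20 := vs ! i, 16 := 0)) v''" "agree {9, 10, 11} h' h''"
      have "I (i + 1) (v''(15 := v'' 15 + 1)) h''"
        unfolding I_def tk product_snoc
      proof (intro HOL.conjI)
        show "agree {14, 15, 16, 20, 21, 22} ?v (v''(15 := v'' 15 + 1))"
          using fr(1) 1(4) by (auto simp: agree_def)
        show "agree {9, 10, 11} ?h h''" using fr(2) 1(5) by (auto simp: agree_def)
        show "(v''(15 := v'' 15 + 1)) 15 = i + 1" using agreeD[OF 1(4), of 15] fr(3) by simp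
      qed (use 1(2,3) i in auto)
      then show "wp (AddC 15 1) (v'', h'', w) (\<lambda>t'. (\<lambda>t (v', h', w'). t \<le> (length ts + 2) * 8 + 3 \<and> w' = w \<and>
          I (i + 1) v' h') (1 + (1 + (t + t'))))"
        using 1(1) by simp
    qed (use fr t' v13 in auto)
    then show "wp pairs_row (v', h', w) (\<lambda>t (v', h', w'). t \<le> (length ts + 2) * 8 + 3 \<and> w' = w \<and> I (i + 1) v' h')"
      by (simp add: pairs_row_def fr(3) x)
  next
    fix t v' h' assume 1: "t \<le> (length vs + 1) * ((length ts + 2) * 8 + 3 + 1)" "I (length vs) v' h'"
    have "agree {13, 14, 15, 16, 17, 20, 21, 22} v v'" using 1(2) by (auto simp: I_def agree_def)
    moreover have "agree {7, 8, 9, 10, 11} h h'" using 1(2) by (auto simp: I_def agree_def)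
    moreover have "(length ts + 2) * 8 + 3 + 1 = (length ts + 2) * 8 + 4" by simp
    with 1(1) have "t \<le> (length vs + 1) * ((length ts + 2) * 8 + 4)" by (simp only:)
    ultimately show "Q (1 + (1 + (1 + (1 + (1 + (1 + t)))))) (v', h', w)"
      using 1(2) by (intro Q) (auto simp: I_def)
  qed
  then show ?thesis using ts(2) f by (simp add: pairs_cmd_def)
qed

text \<open>\<open>Q\<close> is parsed first and so lies at the bottom of the stack. Decrementing
  the height and counting from cell 1 therefore visits exactly the hypotheses, in reverse order; the
  premise 1 is the number of \<open>Fm Top\<close>.\<close>

definition hyps_cmd :: cmd where
  "hyps_cmd = Const 26 0 ;; Const 17 1 ;; SubC 10 1 ;; Const 15 0 ;;
     While (Lt 15 10) (AddC 15 1 ;; Get 18 5 15 ;; emit 17 17 18)"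

lemma wp_hyps:
  assumes okl: "okl os" and st: "v 10 = length hs + 1"
     "\<And>j. j < length hs \<Longrightarrow> Fm (hs ! j) \<in> set os \<and> h 5 (j + 1) = ix os (Fm (hs ! j))"
    and Q: "\<And>t v' h'. t \<le> (length hs + 1) * 7 + 4 \<Longrightarrow>
       clauses_at v' h' os (map (\<lambda>B. (Fm Top, Fm Top, Fm B)) hs) \<Longrightarrow>
       agree {10, 15, 17, 18, 26} v v' \<Longrightarrow> agree {14, 15, 16} h h' \<Longrightarrow> Q t (v', h', w)"
  shows "wp hyps_cmd (v, h, w) Q"
proof -
  let ?v = "v(26 := 0, 17 := 1, 10 := length hs, 15 := 0)"
  let ?cl = "\<lambda>i. map (\<lambda>B. (Fm Top, Fm Top, Fm B)) (take i hs)"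
  define I where "I = (\<lambda>i v' h'. v' 15 = i \<and> i \<le> length hs \<and> agree {15, 18, 26} ?v v' \<and>
    agree {14, 15, 16} h h' \<and> clauses_at v' h' os (?cl i))"
  have "wp (While (Lt 15 10) (AddC 15 1 ;; Get 18 5 15 ;; emit 17 17 18)) (?v, h, w)
     (\<lambda>t. Q (1 + (1 + (1 + (1 + t)))))"
  proof (rule wp_for[where I = I and n = "length hs" and B = 6])
    show "I 0 ?v h" by (simp add: I_def clauses_at_def)
  next
    fix i v' h' assume a: "I i v' h'"
    then have "v' 10 = length hs" using agreeD[of "{15, 18, 26}" ?v v' 10] by (simp add: I_def)
    then show "v' 15 = i \<and> v' 10 = length hs \<and> i \<le> length hs" using a by (simp add: I_def)
  next
    fix i v' h' assume a: "I i v' h'" and i: "i < length hs"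
    have fr: "v' 15 = i" "agree {15, 18, 26} ?v v'" "agree {14, 15, 16} h h'" "clauses_at v' h' os (?cl i)"
      using a by (auto simp: I_def)
    have v17: "v' 17 = 1" using agreeD[OF fr(2), of 17] by simp
    let ?B = "hs ! i"
    have B: "Fm ?B \<in> set os" "h' 5 (i + 1) = ix os (Fm ?B)"
      using st(2)[OF i] agreeD[OF fr(3), of 5] by auto
    have tk: "?cl (i + 1) = ?cl i @ [(Fm Top, Fm Top, Fm ?B)]"
      using take_Suc_conv_app_nth[OF i] by (simp add: Suc_eq_plus1)
    have "wp (emit 17 17 18) (v'(15 := i + 1, 18 := ix os (Fm ?B)), h', w)
        (\<lambda>t. (\<lambda>t (v', h', w'). t \<le> 6 \<and> w' = w \<and> I (i + 1) v' h') (1 + (1 + t)))"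
    proof (rule wp_emit[where p = "Fm Top" and q = "Fm Top" and c = "Fm ?B" and os = os and cl = "?cl i"], goal_cases)
      case 1
      show ?case using fr(4) by (simp add: clauses_at_def)
    next
      case (6 h'')
      have "agree {14, 15, 16} h h''" using fr(3) 6(2) by (auto simp: agree_def)
      moreover have "clauses_at (v'(15 := i + 1, 18 := ix os (Fm ?B), 26 := v' 26 + 1)) h'' os (?cl (i + 1))"
        using 6(1) unfolding tk by (simp add: clauses_at_def)
      ultimately show ?case using i fr(2) by (simp add: I_def)
    qed (use B v17 okl_ix[OF okl] okl_in[OF okl] in auto)
    then show "wp (AddC 15 1 ;; Get 18 5 15 ;; emit 17 17 18) (v', h', w)
       (\<lambda>t (v', h', w'). t \<le> 6 \<and> w' = w \<and> I (i + 1) v' h')"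
      by (simp add: fr(1) B(2))
  next
    fix t v' h' assume 1: "t \<le> (length hs + 1) * (6 + 1)" "I (length hs) v' h'"
    have "agree {10, 15, 17, 18, 26} v v'" using 1(2) by (auto simp: I_def agree_def)
    then show "Q (1 + (1 + (1 + (1 + t)))) (v', h', w)" using 1 by (intro Q) (auto simp: I_def)
  qed
  then show ?thesis using st(1) by (simp add: hyps_cmd_def)
qed

section \<open>Horn saturation in rounds\<close>

fun hstep :: "'a \<times> 'a \<times> 'a \<Rightarrow> 'a set \<Rightarrow> 'a set" where
  "hstep (p, q, c) M = (if p \<in> M \<and> q \<in> M then insert c M else M)"

text \<open>Marks are set in place, so later clauses of a round already see the conclusions of
  earlier ones; this is why a round is a fold and not a simultaneous step.\<close>

definition hround :: "('a \<times> 'a \<times> 'a) list \<Rightarrow> 'a set \<Rightarrow> 'a set" where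
  "hround cl = fold hstep cl"

lemma hstep_mono: "M \<subseteq> hstep c M"
  by (cases c) auto

lemma fold_hstep_mono: "M \<subseteq> fold hstep cl M"
proof (induction cl arbitrary: M)
  case (Cons c cl)
  then show ?case using hstep_mono[of M c] by fastforce
qed simp

text \<open>Marks are never removed, so a round that returns \<open>M\<close> cannot have left
  \<open>M\<close> in between; hence every single clause is already satisfied by
  \<open>M\<close>.\<close>

lemma fold_hstep_closed: "fold hstep cl M = M \<Longrightarrow> (p, q, c) \<in> set cl \<Longrightarrow> p \<in> M \<Longrightarrow> q \<in> M \<Longrightarrow> c \<in> M"
proof (induction cl)
  case (Cons d cl)
  have f: "fold hstep cl (hstep d M) = M" using Cons.prems(1) by simp
  have d: "hstep d M = M"
    using fold_hstep_mono[of "hstep d M" cl] hstep_mono[of M d] unfolding f by (rule equalityI)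
  show ?case
  proof (cases "(p, q, c) = d")
    case True
    have "hstep d M = insert c M" unfolding True[symmetric] using Cons.prems(3,4) by simp
    then show ?thesis using d by blast
  next
    case False
    then have "(p, q, c) \<in> set cl" using Cons.prems(2) by simp
    then show ?thesis using Cons.IH[OF f[unfolded d]] Cons.prems(3,4) by blast
  qed
qed simp

lemma fold_hstep_sound:
  "set cl \<subseteq> C \<Longrightarrow> M \<subseteq> {x. horn C b x} \<Longrightarrow> fold hstep cl M \<subseteq> {x. horn C b x}"
proof (induction cl arbitrary: M)
  case (Cons d cl)
  obtain p q c where d: "d = (p, q, c)" by (cases d)
  have "hstep d M \<subseteq> {x. horn C b x}"
    using Cons.prems horn_step[of p q c C b] by (auto simp: d)
  then show ?case using Cons by simp
qed simp

lemma hround_bound: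
  assumes "set cl \<subseteq> S \<times> S \<times> S" "M \<subseteq> S"
  shows "fold hstep cl M \<subseteq> S"
  using assms
proof (induction cl arbitrary: M)
  case (Cons d cl)
  then have "hstep d M \<subseteq> S" by (cases d) auto
  then show ?case using Cons by simp
qed simp

text \<open>A round that adds nothing reaches the closure, so \<open>card S\<close> rounds suffice.\<close>

lemma hround_closure:
  assumes S: "finite S" "set cl \<subseteq> S \<times> S \<times> S" "b \<in> S" and n: "card S \<le> n"
  shows "(hround cl ^^ n) {b} = {x. horn (set cl) b x}"
proof
  let ?M = "\<lambda>k. (hround cl ^^ k) {b}"
  have sub: "?M k \<subseteq> S" for k
    by (induction k) (use S hround_bound[OF S(2)] in \<open>auto simp: hround_def\<close>)
  have sound: "?M k \<subseteq> {x. horn (set cl) b x}" for k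
    by (induction k) (use fold_hstep_sound[of cl "set cl"] in \<open>auto simp: hround_def intro: horn_base\<close>)
  show "?M n \<subseteq> {x. horn (set cl) b x}" by (rule sound)
  have grow: "k < card (?M k) \<or> (\<exists>j < k. hround cl (?M j) = ?M j)" for k
  proof (induction k)
    case (Suc k)
    show ?case
    proof (cases "\<exists>j < Suc k. hround cl (?M j) = ?M j")
      case False
      then have "k < card (?M k)" "hround cl (?M k) \<noteq> ?M k" using Suc by (auto simp: less_Suc_eq)
      moreover have "?M k \<subseteq> hround cl (?M k)" unfolding hround_def by (rule fold_hstep_mono)
      moreover have "finite (?M (Suc k))" using sub S(1) finite_subset by blast
      ultimately have "card (?M k) < card (?M (Suc k))" by (intro psubset_card_mono) auto
      then show ?thesis using \<open>k < card (?M k)\<close> by auto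
    qed blast
  qed simp
  have "card (?M n) \<le> n" using card_mono[OF S(1) sub[of n]] n by simp
  then obtain j where j: "j < n" "hround cl (?M j) = ?M j" using grow[of n] by auto
  have "?M (j + d) = ?M j" for d by (induction d) (use j(2) in auto)
  from this[of "n - j"] have eq: "?M n = ?M j" using j(1) by simp
  have mono: "{b} \<subseteq> ?M k" for k
  proof (induction k)
    case (Suc k)
    then show ?case using fold_hstep_mono[of "?M k" cl] by (auto simp: hround_def)
  qed simp
  have "x \<in> ?M n" if "horn (set cl) b x" for x
    using that
  proof induction
    case horn_base
    then show ?case using mono by auto
  next
    case (horn_step p q c)
    have "fold hstep cl (?M j) = ?M j" using j(2) unfolding hround_def .
    from fold_hstep_closed[OF this horn_step(1)] horn_step(4,5) show ?case unfolding eq by blast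
  qed
  then show "{x. horn (set cl) b x} \<subseteq> ?M n" by auto
qed

definition marks_at :: "(nat \<Rightarrow> nat \<Rightarrow> nat) \<Rightarrow> obj list \<Rightarrow> obj set \<Rightarrow> bool" where
  "marks_at h os M \<longleftrightarrow> (\<forall>ob \<in> set os. h 17 (ix os ob) \<noteq> 0 \<longleftrightarrow> ob \<in> M)"

definition clause_cmd :: cmd where
  "clause_cmd = Get 2 14 15 ;; Get 2 17 2 ;; If (NeC 2 0)
     (Get 2 15 15 ;; Get 2 17 2 ;; If (NeC 2 0) (Get 2 16 15 ;; Const 3 1 ;; Put 17 2 3) nop) nop ;; AddC 15 1"

text \<open>The number of rounds is the number of nodes, kept in register 1, so there is no need to
  detect whether a round changed anything.\<close>

definition horn_cmd :: cmd where
  "horn_cmd = Const 2 1 ;; Put 17 2 2 ;; Const 27 0 ;;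
     While (Lt 27 1) (Const 15 0 ;; While (Lt 15 26) clause_cmd ;; AddC 27 1)"

lemma wp_clause:
  assumes cl: "clauses_at v h os cl" and j: "v 15 = j" "j < length cl" and M: "marks_at h os M"
    and Q: "\<And>t h' a b. t \<le> 12 \<Longrightarrow> marks_at h' os (hstep (cl ! j) M) \<Longrightarrow> agree {17} h h' \<Longrightarrow>
       Q t (v(2 := a, 3 := b, 15 := j + 1), h', w)"
  shows "wp clause_cmd (v, h, w) Q"
proof -
  obtain p q c where c: "cl ! j = (p, q, c)" by (cases "cl ! j")
  have m: "p \<in> set os" "q \<in> set os" "c \<in> set os" "h 14 j = ix os p" "h 15 j = ix os q" "h 16 j = ix os c"
    using cl j(2) c by (auto simp: clauses_at_def)
  have Q': "Q t (v(2 := a, 3 := b, 15 := j + 1), h', w)"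
    if "t \<le> 12" "marks_at h' os (if p \<in> M \<and> q \<in> M then insert c M else M)" "agree {17} h h'" for t h' a b
    using that Q c by simp
  have pq: "h 17 (ix os p) \<noteq> 0 \<longleftrightarrow> p \<in> M" "h 17 (ix os q) \<noteq> 0 \<longleftrightarrow> q \<in> M"
    using M m(1,2) unfolding marks_at_def by blast+
  have "(h(17 := (h 17)(ix os c := 1))) 17 (ix os ob) \<noteq> 0 \<longleftrightarrow> ob \<in> insert c M" if "ob \<in> set os" for ob
    using M that ix_inj[OF that m(3)] unfolding marks_at_def by (cases "ob = c") auto
  then have ins: "marks_at (h(17 := (h 17)(ix os c := 1))) os (insert c M)"
    unfolding marks_at_def by blast
  show ?thesis
  proof (cases "p \<in> M")
    case False
    then show ?thesis using pq m j M by (simp add: clause_cmd_def Q')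
  next
    case p: True
    show ?thesis
    proof (cases "q \<in> M")
      case False
      then show ?thesis using p pq m j M by (simp add: clause_cmd_def Q')
    next
      case True
      then show ?thesis using p pq m j ins by (simp add: clause_cmd_def Q')
    qed
  qed
qed

lemma wp_horn:
  assumes cl: "clauses_at v h os cl" and okl: "okl os" and v: "v 1 = length os" and h: "h 17 = (\<lambda>_. 0)"
    and Q: "\<And>t v' h'. t \<le> (length os + 1) * ((length cl + 1) * 13 + 3) + 3 \<Longrightarrow>
      marks_at h' os {ob. horn (set cl) (Fm Top) ob} \<Longrightarrow> agree {2, 3, 15, 27} v v' \<Longrightarrow> agree {17} h h' \<Longrightarrow>
      Q t (v', h', w)"
  shows "wp horn_cmd (v, h, w) Q"
proof -
  let ?v = "v(2 := 1, 27 := 0)" and ?h = "h(17 := (h 17)(1 := 1))"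
  let ?M = "\<lambda>k. (hround cl ^^ k) {Fm Top}"
  define I where "I = (\<lambda>i v' h'. v' 27 = i \<and> i \<le> length os \<and> agree {2, 3, 15, 27} v v' \<and> agree {17} h h' \<and>
    marks_at h' os (?M i))"
  have M0: "marks_at ?h os {Fm Top}"
    using h okl_ix(2)[OF okl] okl_in[OF okl] ix_inj[of _ os "Fm Top"] by (auto simp: marks_at_def)
  have "wp (While (Lt 27 1) (Const 15 0 ;; While (Lt 15 26) clause_cmd ;; AddC 27 1)) (?v, ?h, w)
     (\<lambda>t. Q (1 + (1 + (1 + t))))"
  proof (rule wp_for[where I = I and n = "length os" and B = "(length cl + 1) * 13 + 2"])
    show "I 0 ?v ?h" using M0 by (simp add: I_def)
  next
    fix i v' h' assume a: "I i v' h'"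
    then have "v' 1 = v 1" using agreeD[of "{2, 3, 15, 27}" v v' 1] by (simp add: I_def)
    then show "v' 27 = i \<and> v' 1 = length os \<and> i \<le> length os" using a v by (simp add: I_def)
  next
    fix i v' h' assume a: "I i v' h'" and i: "i < length os"
    have fr: "agree {2, 3, 15, 27} v v'" "agree {17} h h'" "v' 27 = i" "marks_at h' os (?M i)"
      using a by (auto simp: I_def)
    define J where "J = (\<lambda>j v'' h''. v'' 15 = j \<and> j \<le> length cl \<and> agree {2, 3, 15} v' v'' \<and> agree {17} h h'' \<and>
      marks_at h'' os (fold hstep (take j cl) (?M i)))"
    have cl': "clauses_at v'' h'' os cl" if "agree {2, 3, 15} v' v''" "agree {17} h h''" for v'' h''
      using cl agreeD[OF that(1), of 26] agreeD[OF fr(1), of 26] agreeD[OF that(2)]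
      by (simp add: clauses_at_def)
    let ?P = "\<lambda>t (v', h', w'). t \<le> (length cl + 1) * 13 + 2 \<and> w' = w \<and> I (i + 1) v' h'"
    have "wp (While (Lt 15 26) clause_cmd) (v'(15 := 0), h', w) (\<lambda>t s'. wp (AddC 27 1) s' (\<lambda>t'. ?P (1 + (t + t'))))"
    proof (rule wp_for[where I = J and n = "length cl" and B = 12])
      show "J 0 (v'(15 := 0)) h'" using fr by (simp add: J_def)
    next
      fix j v'' h'' assume b: "J j v'' h''"
      then have "clauses_at v'' h'' os cl" using cl' by (simp add: J_def)
      then show "v'' 15 = j \<and> v'' 26 = length cl \<and> j \<le> length cl" using b
        by (simp add: J_def clauses_at_def)
    next
      fix j v'' h'' assume b: "J j v'' h''" and j: "j < length cl"
      have g: "v'' 15 = j" "agree {2, 3, 15} v' v''" "agree {17} h h''"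
        "marks_at h'' os (fold hstep (take j cl) (?M i))" using b by (auto simp: J_def)
      have tk: "take (j + 1) cl = take j cl @ [cl ! j]"
        using take_Suc_conv_app_nth[OF j] by (simp add: Suc_eq_plus1)
      show "wp clause_cmd (v'', h'', w) (\<lambda>t (v', h', w'). t \<le> 12 \<and> w' = w \<and> J (j + 1) v' h')"
      proof (rule wp_clause[OF cl'[OF g(2,3)] g(1) j g(4)])
        fix t h3 a b
        assume 1: "t \<le> 12" "marks_at h3 os (hstep (cl ! j) (fold hstep (take j cl) (?M i)))" "agree {17} h'' h3"
        have "agree {17} h h3" using g(3) 1(3) by (auto simp: agree_def)
        then show "case (v''(2 := a, 3 := b, 15 := j + 1), h3, w) of (v', h', w') \<Rightarrow> t \<le> 12 \<and> w' = w \<and> J (j + 1) v' h'"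
          unfolding J_def tk using 1(1,2) g(2) j by simp
      qed
    next
      fix t v'' h'' assume b: "t \<le> (length cl + 1) * (12 + 1)" "J (length cl) v'' h''"
      have g: "agree {2, 3, 15} v' v''" "agree {17} h h''" "marks_at h'' os (fold hstep cl (?M i))"
        using b by (auto simp: J_def)
      have "v'' 27 = i" using agreeD[OF g(1), of 27] fr(3) by simp
      moreover have "agree {2, 3, 15, 27} v v''" using fr(1) g(1) by (auto simp: agree_def)
      moreover have "?M (i + 1) = fold hstep cl (?M i)"
        unfolding Suc_eq_plus1[symmetric] funpow.simps comp_def hround_def ..
      ultimately have "I (i + 1) (v''(27 := v'' 27 + 1)) h''"
        unfolding I_def using i g by simp
      then show "wp (AddC 27 1) (v'', h'', w) (\<lambda>t'. ?P (1 + (t + t')))" using b(1) by simp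
    qed
    then show "wp (Const 15 0 ;; While (Lt 15 26) clause_cmd ;; AddC 27 1) (v', h', w) ?P" by simp
  next
    fix t v' h' assume 1: "t \<le> (length os + 1) * ((length cl + 1) * 13 + 2 + 1)" "I (length os) v' h'"
    have "set cl \<subseteq> set os \<times> set os \<times> set os"
    proof
      fix d assume "d \<in> set cl"
      then obtain j where "j < length cl" "cl ! j = d" by (auto simp: in_set_conv_nth)
      then show "d \<in> set os \<times> set os \<times> set os" using cl by (auto simp: clauses_at_def)
    qed
    then have "?M (length os) = {x. horn (set cl) (Fm Top) x}"
      using okl_in[OF okl] by (intro hround_closure[where S = "set os"]) (auto intro: card_length)
    then have "marks_at h' os {x. horn (set cl) (Fm Top) x}" using 1(2) by (simp add: I_def)
    moreover have "(length cl + 1) * 13 + 2 + 1 = (length cl + 1) * 13 + 3" by simp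
    with 1(1) have "t \<le> (length os + 1) * ((length cl + 1) * 13 + 3)" by (simp only:)
    ultimately show "Q (1 + (1 + (1 + t))) (v', h', w)" using 1(2) by (intro Q) (auto simp: I_def)
  qed
  then show ?thesis by (simp add: horn_cmd_def)
qed

text \<open>Cell 0 of the stack array holds the node of \<open>Q\<close>, and node 2 is
  \<open>Bot\<close>.\<close>

definition answer_cmd :: cmd where
  "answer_cmd = Const 2 0 ;; Get 2 5 2 ;; Get 2 17 2 ;; Const 0 0 ;; If (NeC 2 0) (Const 0 1) nop ;;
     Const 2 2 ;; Get 2 17 2 ;; If (NeC 2 0) (Const 0 1) nop"

lemma wp_answer:
  assumes "marks_at h os M" "Fm Q \<in> set os" "h 5 0 = ix os (Fm Q)" "okl os"
    and R: "\<And>t v'. t \<le> 12 \<Longrightarrow> v' 0 = (if Fm Q \<in> M \<or> Fm Bot \<in> M then 1 else 0) \<Longrightarrow> R t (v', h, w)"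
  shows "wp answer_cmd (v, h, w) R"
proof -
  have m: "h 17 (ix os ob) \<noteq> 0 \<longleftrightarrow> ob \<in> M" if "ob \<in> set os" for ob
    using assms(1) that unfolding marks_at_def by blast
  have "Fm Bot \<in> set os" using okl_in[OF assms(4)] by blast
  from m[OF this] have B: "h 17 2 \<noteq> 0 \<longleftrightarrow> Fm Bot \<in> M" unfolding okl_ix(3)[OF assms(4)] .
  show ?thesis
    by (cases "Fm Q \<in> M"; cases "Fm Bot \<in> M")
      (use m[OF assms(2)] B assms(3) in \<open>simp add: answer_cmd_def; intro R; simp\<close>)+
qed

section \<open>Running time and the theorem\<close>

lemma wf_subs: "Fm C \<in> subs B \<Longrightarrow> wf_fm L B \<Longrightarrow> wf_fm L C"
proof -
  have a: "Fm C \<notin> asubs ts" for ts by (induction ts) auto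
  show "Fm C \<in> subs B \<Longrightarrow> wf_fm L B \<Longrightarrow> wf_fm L C" by (induction B) (use a in auto)
qed

lemma bv_trms: "x \<in> bv B \<Longrightarrow> Var x \<in> trms B"
  by (induction B) auto

lemma wf_trms: "t \<in> trms B \<Longrightarrow> wf_fm L B \<Longrightarrow> wf_trm L t"
  by (induction B) auto

lemma trms_symbols: "t \<in> trms B \<Longrightarrow> trm_symbol t \<in> set (fm_string B)"
  by (induction B) auto

lemma sidx_trm_symbol: "sidx (trm_symbol t) = snd (tcode t)"
  by (cases t) auto

lemma trms_bound:
  assumes "B \<in> insert Q (set hs)" "t \<in> trms B"
  shows "snd (tcode t) < 1 + sum_list (map sidx (instance_string hs Q))"
proof -
  have "trm_symbol t \<in> set (fm_string B)" using assms(2) by (rule trms_symbols)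
  then have "trm_symbol t \<in> set (instance_string hs Q)"
    using assms(1) by (auto simp: instance_string_def)
  then have "sidx (trm_symbol t) \<le> sum_list (map sidx (instance_string hs Q))"
    by (intro member_le_sum_list) auto
  then show ?thesis by (simp add: sidx_trm_symbol)
qed

lemma finite_trms [simp]: "finite (trms B)" and finite_bv [simp]: "finite (bv B)"
  by (induction B) auto

text \<open>Quantifier symbols are not terms, and every formula contains at least one further symbol
  that is not a term. The summand 1 coming from the latter pays for the fresh variable in
  \<open>card_T\<close>.\<close>

lemma card_trms: "card (trms B) + quantifications B + 1 \<le> fm_length B"
proof (induction B)
  case (Rel R ts)
  then show ?case using card_length[of ts] by (simp add: fm_length_def)
next
  case (Conj B C)
  then show ?case using card_Un_le[of "trms B" "trms C"] by (simp add: fm_length_def)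
next
  case (Disj B C)
  then show ?case using card_Un_le[of "trms B" "trms C"] by (simp add: fm_length_def)
next
  case (Imp B C)
  then show ?case using card_Un_le[of "trms B" "trms C"] by (simp add: fm_length_def)
next
  case (All x B)
  then show ?case using card_insert_le_Suc[of "trms B" "card (trms B)" "Var x"] by (simp add: fm_length_def)
next
  case (Ex x B)
  then show ?case using card_insert_le_Suc[of "trms B" "card (trms B)" "Var x"] by (simp add: fm_length_def)
qed (auto simp: fm_length_def)

lemma card_bv: "card (bv B) \<le> quantifications B"
proof (induction B)
  case (Conj B C)
  then show ?case using card_Un_le[of "bv B" "bv C"] by simp
next
  case (Disj B C)
  then show ?case using card_Un_le[of "bv B" "bv C"] by simp
next
  case (Imp B C)
  then show ?case using card_Un_le[of "bv B" "bv C"] by simp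
qed (auto intro: card_insert_le_Suc)

lemma two_quantifications: "2 * quantifications B + 1 \<le> fm_length B"
  by (induction B) (auto simp: fm_length_def)

definition program :: cmd where
  "program = read_cmd ;; parse_cmd ;; pairs_cmd ;; hyps_cmd ;; closure_cmd ;; horn_cmd ;; answer_cmd"

lemma ok_program: "ok_cmd program"
  by (simp add: program_def read_cmd_def read_body_def parse_cmd_def token_cmd_def atom_cmd_def term_cmd_def
    rel_cmd_def binary_cmd_def binder_cmd_def push_cmd_def mk_cmd_def search_cmd_def pairs_cmd_def
    pairs_row_def pairs_body_def hyps_cmd_def emit_def closure_cmd_def node_cmd_def node_emit_def
    pair_cmd_def sub_cmd_def quant_cmd_def bin_cmd_def clear_cmd_def quant_emit_def horn_cmd_def
    clause_cmd_def answer_cmd_def)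

definition program_time :: "nat \<Rightarrow> nat \<Rightarrow> nat" where
  "program_time n N = 5000 * n ^ 2 * N ^ 2"

section \<open>The parameters of an instance\<close>

locale instance_run =
  fixes L :: lang and hs :: "fm list" and Q :: fm
  assumes inst: "qpl_instance L hs Q"
begin

definition "S = insert Q (set hs)"
definition "n = total_length hs Q"
definition "f = 1 + sum_list (map sidx (instance_string hs Q))"
definition "V = (\<Union>B\<in>S. bv B)"
definition "T = insert (Var f) (\<Union>B\<in>S. trms B)"
definition "U = universe V T (set base \<union> (\<Union>B\<in>S. subs B))"

lemma finite_S: "finite S" by (simp add: S_def)

lemma wf: "B \<in> S \<Longrightarrow> wf_fm L B" using inst by (auto simp: qpl_instance_def S_def)

lemma finite_VT: "finite V" "finite T" by (simp_all add: V_def T_def finite_S)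

lemma hs_le: "sum_list (map fm_length hs) \<le> n" "fm_length Q \<le> n" "length hs \<le> n" "1 \<le> n"
proof -
  have d: "distinct hs" using inst by (simp add: qpl_instance_def)
  then have "sum_list (map fm_length hs) = (\<Sum>B\<in>set hs. fm_length B)" by (rule sum_list_distinct_conv_sum_set)
  also have "\<dots> \<le> n" unfolding n_def total_length_def by (rule sum_mono2) auto
  finally show 1: "sum_list (map fm_length hs) \<le> n" .
  have p: "1 \<le> fm_length B" for B using two_quantifications[of B] by simp
  have "length hs = sum_list (map (\<lambda>_. 1) hs)" by (simp add: sum_list_triv)
  also have "\<dots> \<le> sum_list (map fm_length hs)" using p by (intro sum_list_mono) auto
  finally show "length hs \<le> n" using 1 by simp
  show "fm_length Q \<le> n" unfolding n_def total_length_def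
    by (rule member_le_sum) auto
  then show "1 \<le> n" using p[of Q] by simp
qed

text \<open>One \<open>n\<close> is for the hypotheses, one for their separators, and one for
  \<open>Q\<close>, which is written again even if it is also a hypothesis and then counts only once
  in \<open>n\<close>.\<close>

lemma length_string: "length (instance_string hs Q) \<le> 3 * n"
proof -
  have "length (instance_string hs Q) = sum_list (map fm_length hs) + length hs + fm_length Q"
    by (induction hs) (auto simp: instance_string_def fm_length_def)
  then show ?thesis using hs_le by simp
qed

lemma sum_S: "(\<Sum>B\<in>S. fm_length B) = n" "(\<Sum>B\<in>S. quantifications B) = total_quantifications hs Q"
  by (simp_all add: S_def n_def total_length_def total_quantifications_def)

lemma card_S: "1 \<le> card S"
proof -
  have "0 < card S" using finite_S unfolding card_gt_0_iff by (auto simp: S_def)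
  then show ?thesis by simp
qed

lemma card_T: "card T + total_quantifications hs Q \<le> n"
proof -
  have "card (\<Union>B\<in>S. trms B) + total_quantifications hs Q + card S
      \<le> (\<Sum>B\<in>S. card (trms B)) + (\<Sum>B\<in>S. quantifications B) + (\<Sum>B\<in>S. 1)"
    using card_UN_le[OF finite_S, of trms] by (simp add: sum_S(2))
  also have "\<dots> = (\<Sum>B\<in>S. card (trms B) + quantifications B + 1)" by (simp add: sum.distrib)
  also have "\<dots> \<le> n" unfolding sum_S(1)[symmetric] by (rule sum_mono) (rule card_trms)
  finally have "card (\<Union>B\<in>S. trms B) + total_quantifications hs Q + card S \<le> n" .
  moreover have "card T \<le> Suc (card (\<Union>B\<in>S. trms B))" unfolding T_def by (rule card_insert_le_Suc) simp
  ultimately show ?thesis using card_S by simp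
qed

lemma quantifications_less: "2 * total_quantifications hs Q < n"
proof -
  have "2 * total_quantifications hs Q + card S = (\<Sum>B\<in>S. 2 * quantifications B + 1)"
    unfolding sum_S(2)[symmetric] by (simp add: sum.distrib sum_distrib_left)
  also have "\<dots> \<le> n" unfolding sum_S(1)[symmetric] by (rule sum_mono) (rule two_quantifications)
  finally show ?thesis using card_S by simp
qed

lemma card_V: "card V \<le> total_quantifications hs Q"
proof -
  have "card V \<le> (\<Sum>B\<in>S. card (bv B))" unfolding V_def by (rule card_UN_le[OF finite_S])
  also have "\<dots> \<le> (\<Sum>B\<in>S. quantifications B)" by (rule sum_mono) (rule card_bv)
  finally show ?thesis by (simp add: sum_S(2))
qed

lemma card_U: "finite U" "card U \<le> 6 * n * (n - total_quantifications hs Q) ^ total_quantifications hs Q"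
proof -
  let ?q = "total_quantifications hs Q"
  let ?S0 = "set base \<union> (\<Union>B\<in>S. subs B)"
  have fin: "finite ?S0" using finite_S by simp
  show "finite U" unfolding U_def using card_universe(1)[OF finite_VT fin] .
  have "card ?S0 \<le> card (set base) + card (\<Union>B\<in>S. subs B)" by (rule card_Un_le)
  also have "card (\<Union>B\<in>S. subs B) \<le> (\<Sum>B\<in>S. card (subs B))" by (rule card_UN_le[OF finite_S])
  also have "\<dots> \<le> n" unfolding sum_S(1)[symmetric] by (rule sum_mono) (rule card_subs)
  also have "card (set base) \<le> 4" using card_length[of base] by (simp add: base_def)
  finally have S0: "card ?S0 \<le> 5 * n" using hs_le(4) by simp
  have m: "1 \<le> n - ?q" using quantifications_less by simp
  have "card T ^ card V \<le> (n - ?q) ^ card V" using card_T by (intro power_mono) auto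
  also have "\<dots> \<le> (n - ?q) ^ ?q" using m card_V by (rule power_increasing[rotated])
  finally have TV: "card T ^ card V \<le> (n - ?q) ^ ?q" .
  have "card U \<le> 1 + card T ^ card V * card ?S0"
    unfolding U_def using card_universe(2)[OF finite_VT fin] .
  also have "\<dots> \<le> 1 + (n - ?q) ^ ?q * (5 * n)" using mult_mono[OF TV S0] by simp
  \<comment> \<open>The factor 6 collects \<open>Fail\<close>, the four objects of
    \<open>base\<close> and the subobjects of the instance, each contribution being estimated by a
    multiple of \<open>n\<close>.\<close>
  also have "1 \<le> (n - ?q) ^ ?q * n" using m hs_le(4) by (simp add: Suc_le_eq One_nat_def)
  finally show "card U \<le> 6 * n * (n - ?q) ^ ?q" by (simp add: algebra_simps)
qed

sublocale cu: closed_universe V T "set base \<union> (\<Union>B\<in>S. subs B)"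
  by unfold_locales (use bv_trms in \<open>auto simp: V_def T_def\<close>)

lemma fresh: "t \<in> T \<Longrightarrow> snd (tcode t) = f \<Longrightarrow> t = Var f" "f \<notin> V"
proof -
  have b: "snd (tcode t) < f" if "B \<in> S" "t \<in> trms B" for B t
    using trms_bound that unfolding f_def S_def by blast
  show "t \<in> T \<Longrightarrow> snd (tcode t) = f \<Longrightarrow> t = Var f" using b by (fastforce simp: T_def)
  show "f \<notin> V" using b[OF _ bv_trms] by (fastforce simp: V_def)
qed

lemma wf_T: "t \<in> T \<Longrightarrow> wf_trm L t"
  using wf wf_trms by (auto simp: T_def)

lemma wf_U: "Fm B \<in> U \<Longrightarrow> wf_fm L B"
  unfolding U_def
proof (rule cu.universe_wf)
  fix B assume "Fm B \<in> set base \<union> (\<Union>B\<in>S. subs B)"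
  then show "wf_fm L B" using wf_subs[of B _ L] wf by (fastforce simp: base_def)
qed (use wf_T in auto)

lemma closure_locale:
  assumes "set prs = V \<times> T"
  shows "closure f prs U"
proof
  show "finite U" by (rule card_U)
next
  fix ob p assume "ob \<in> U" "p \<in> set prs"
  then show "osub p ob \<in> U" using assms cu.universe_osub[of ob] unfolding U_def by (cases p) auto
next
  fix p assume p: "p \<in> set prs" "snd (tcode (snd p)) = f"
  have "snd p \<in> T" using p(1) unfolding assms by (rule mem_Times_iff[THEN iffD1, THEN conjunct2])
  then show "snd p = Var f" using p(2) by (rule fresh(1))
qed

lemma entailment_locale:
  assumes "okl os" "set base \<union> (\<Union>B\<in>S. subs B) \<subseteq> set os" "set os \<subseteq> U"
    "\<And>ob p. ob \<in> set os \<Longrightarrow> p \<in> V \<times> T \<Longrightarrow> osub p ob \<in> set os"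
  shows "entailment L (set hs) Q V T f (set os)"
proof
  show "Var f \<in> T" by (simp add: T_def)
  show "f \<notin> V" by (rule fresh)
  show "Fm Top \<in> set os" "Fm Bot \<in> set os" using assms(2) by (auto simp: base_def)
  show "Fm Q \<in> set os" using assms(2) Fm_in_subs[of Q] by (auto simp: S_def)
  show "wf_trm L t" if "t \<in> T" for t using wf_T that .
  show "Fm B \<in> set os" if "B \<in> set hs" for B using assms(2) that Fm_in_subs[of B] by (auto simp: S_def)
  show "bv B \<subseteq> V" if "B \<in> insert Q (set hs)" for B using that by (auto simp: V_def S_def)
  show "trms B \<subseteq> T" if "B \<in> insert Q (set hs)" for B using that by (auto simp: T_def S_def)
  show "children ob \<subseteq> set os" if "ob \<in> set os" for ob using okl_children assms(1) that .
  show "osub (x, t) ob \<in> set os" if "ob \<in> set os" "x \<in> V" "t \<in> T" for ob x t using assms(4) that by blast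
  show "wf_fm L B" if "Fm B \<in> set os" for B using wf_U assms(3) that by blast
qed (rule cu.V_T)

end

text \<open>All seven phases are charged against \<open>M\<close>, that is
  \<open>n ^ 2 * N ^ 2\<close>, and add up to \<open>2048 * M\<close>, well below 5000. The dominant
  ones are the closure, with a search for every node and pair, and the saturation, with every clause
  in every round.\<close>

lemma time_bound:
  fixes n N s vs us hs os cl prs :: nat
  assumes n: "1 \<le> n" "1 \<le> N" and s: "s \<le> 3 * n" and vs: "vs \<le> 2 * n" and us: "us \<le> 2 * n" and hs: "hs \<le> n"
    and os: "os0 \<le> N" "os \<le> N" and prs: "prs = vs * (us + 1)" and cl: "cl \<le> hs + N * (3 + 2 * prs)"
    and t: "t1 \<le> 7 * s + 3" "t2 \<le> s * (9 * os0 + 50) + 10" "t3 \<le> (vs + 1) * ((us + 2) * 8 + 4) + 6"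
      "t4 \<le> (hs + 1) * 7 + 4" "t5 \<le> (N + 1) * (31 + (prs + 1) * (9 * N + 71)) + 2"
      "t6 \<le> (os + 1) * ((cl + 1) * 13 + 3) + 3" "t7 \<le> 12"
  shows "t1 + (t2 + (t3 + (t4 + (t5 + (t6 + t7))))) \<le> program_time n N"
proof -
  define a where "a = n * n"
  define M where "M = a * N * N"
  have na: "n \<le> a" using mult_le_mono[OF n(1) order_refl, of n] by (simp add: a_def)
  have aM: "a * N \<le> M" using mult_le_mono[OF order_refl n(2), of "a * N"] by (simp add: M_def)
  have a1: "a \<le> a * N" using mult_le_mono[OF order_refl n(2), of a] by simp
  have nN: "n * N \<le> a * N" using na by (rule mult_le_mono1)
  have a0: "1 \<le> a" using na n(1) by linarith
  have "t1 \<le> 24 * a" using t(1) s na a0 by linarith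
  then have 1: "t1 \<le> 24 * M" using a1 aM by linarith
  have "s * (9 * os0 + 50) \<le> (3 * n) * (59 * N)"
    using s os n(2) by (intro mult_le_mono) linarith+
  also have "(3 * n) * (59 * N) = 177 * (n * N)" by simp
  finally have 2: "t2 \<le> 187 * M" using t(2) nN aM a1 a0 by linarith
  have "(us + 2) * 8 + 4 \<le> 36 * n" using us n(1) by simp
  then have "(vs + 1) * ((us + 2) * 8 + 4) \<le> (3 * n) * (36 * n)"
    using vs n(1) by (intro mult_le_mono) linarith+
  also have "(3 * n) * (36 * n) = 108 * a" by (simp add: a_def)
  finally have "t3 \<le> 114 * a" using t(3) a0 by linarith
  then have 3: "t3 \<le> 114 * M" using a1 aM by linarith
  have "t4 \<le> 24 * a" using t(4) hs na a0 by simp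
  then have 4: "t4 \<le> 24 * M" using a1 aM by linarith
  have "prs \<le> (2 * n) * (3 * n)" unfolding prs using vs us n(1) by (intro mult_le_mono) linarith+
  also have "(2 * n) * (3 * n) = 6 * a" by (simp add: a_def)
  finally have p: "prs + 1 \<le> 7 * a" using a0 by linarith
  have "(prs + 1) * (9 * N + 71) \<le> (7 * a) * (80 * N)" using p n(2) by (intro mult_le_mono) linarith+
  also have "(7 * a) * (80 * N) = 560 * (a * N)" by simp
  finally have "31 + (prs + 1) * (9 * N + 71) \<le> 591 * (a * N)" using a1 a0 by linarith
  then have "(N + 1) * (31 + (prs + 1) * (9 * N + 71)) \<le> (2 * N) * (591 * (a * N))"
    using n(2) by (intro mult_le_mono) linarith+
  also have "(2 * N) * (591 * (a * N)) = 1182 * M" by (simp add: M_def)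
  finally have 5: "t5 \<le> 1184 * M" using t(5) a1 aM a0 by linarith
  have "N * (3 + 2 * prs) \<le> N * (17 * a)" using p a0 by (intro mult_le_mono) linarith+
  also have "N * (17 * a) = 17 * (a * N)" by simp
  finally have "cl + 1 \<le> 19 * (a * N)" using cl hs na a0 a1 by linarith
  moreover have "(y + 1) * 13 + 3 \<le> 250 * x" if "y + 1 \<le> 19 * x" "1 \<le> x" for x y :: nat
  proof -
    have "13 * y + 16 \<le> 250 * x" using that by linarith
    then show ?thesis by simp
  qed
  moreover have "1 \<le> a * N" using a0 a1 by linarith
  ultimately have "(cl + 1) * 13 + 3 \<le> 250 * (a * N)" by blast
  then have "(os + 1) * ((cl + 1) * 13 + 3) \<le> (2 * N) * (250 * (a * N))"
    using os n(2) by (intro mult_le_mono) linarith+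
  also have "(2 * N) * (250 * (a * N)) = 500 * M" by (simp add: M_def)
  finally have 6: "t6 \<le> 503 * M" using t(6) a1 aM a0 by linarith
  have 7: "t7 \<le> 12 * M" using t(7) a0 a1 aM by linarith
  have "program_time n N = 5000 * M" by (simp add: program_time_def M_def a_def power2_eq_square algebra_simps)
  then show ?thesis using 1 2 3 4 5 6 7 by linarith
qed

lemma length_rules0: "length (rules0 ob) \<le> 3"
  by (cases ob rule: rules0.cases) auto

lemma length_rules1: "length (rules1 f p ob) \<le> 2"
  by (cases "(f, p, ob)" rule: rules1.cases) auto

lemma (in closure) length_node_clauses: "length (node_clauses ob) \<le> 3 + 2 * length prs"
proof -
  have "sum_list (map (\<lambda>p. length (rules1 f p ob)) prs) \<le> sum_list (map (\<lambda>_. 2) prs)"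
    by (intro sum_list_mono) (simp add: length_rules1)
  then show ?thesis using length_rules0[of ob]
    by (simp add: node_clauses_def length_concat comp_def sum_list_triv)
qed

lemma (in closure) length_clauses:
  "length (concat (map node_clauses os)) \<le> length os * (3 + 2 * length prs)"
proof -
  have "sum_list (map (\<lambda>ob. length (node_clauses ob)) os) \<le> sum_list (map (\<lambda>_. 3 + 2 * length prs) os)"
    by (intro sum_list_mono) (simp add: length_node_clauses)
  then show ?thesis by (simp add: length_concat comp_def sum_list_triv)
qed

lemma (in closure) set_clauses:
  assumes "set prs = P" "set hyp = (\<lambda>h. (Fm Top, Fm Top, Fm h)) ` H"
  shows "set (hyp @ concat (map node_clauses os)) = clauses H f P (set os)"
  using assms by (auto simp: clauses_def node_clauses_def)

section \<open>The program as a whole\<close>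

context instance_run
begin

lemma program_correct:
  "wp program (\<lambda>_. 0, \<lambda>_ _. 0, encode_instance hs Q)
     (\<lambda>t (v, h, w). t \<le> program_time n (card U) \<and> v 0 = (if qpl L (set hs) Q then 1 else 0))"
proof -
  obtain os0 vs us where ps:
    "fold pstep (rev (instance_string hs Q)) (Some (base, [], [], [], [])) = Some (os0, hs @ [Q], [], vs, us)"
    and os0: "set os0 = set base \<union> (\<Union>B\<in>S. subs B)" and vs: "set vs = (\<Union>B\<in>S. bv B)"
    and us: "set us = (\<Union>B\<in>S. trms B)"
    and len: "length vs \<le> fm_length Q + sum_list (map fm_length hs)"
      "length us \<le> fm_length Q + sum_list (map fm_length hs)"
    using parse_instance[of hs Q, folded S_def] by (elim HOL.exE HOL.conjE) (rule that)
  define prs where "prs = List.product vs (us @ [Var f])"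
  have prs: "set prs = V \<times> T" by (auto simp: prs_def vs us T_def V_def)
  define hyp where "hyp = map (\<lambda>B. (Fm Top, Fm Top, Fm B)) (rev hs)"
  interpret cl: closure f prs U hyp using closure_locale[OF prs] .
  have os0U: "set os0 \<subseteq> U" unfolding os0 U_def by (rule cu.S_universe)
  show ?thesis
    unfolding program_def wp_Seq encode_instance_def
  proof (rule wp_read[where ss = "instance_string hs Q"], goal_cases)
    case (3 t1 v1 h1 w1)
    have f1: "r \<notin> {2, 3, 8, 9} \<Longrightarrow> v1 r = 0" for r using agreeD[OF 3(5)] .
    have g1: "a \<notin> {3, 4} \<Longrightarrow> h1 a = (\<lambda>_. 0)" for a using agreeD[OF 3(6)] .
    show ?case
    proof (rule wp_parse[where ss = "instance_string hs Q" and st' = "(os0, hs @ [Q], [], vs, us)"], goal_cases)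
      case (8 t2 v2 h2)
      have f2: "r \<notin> parse_regs \<Longrightarrow> v2 r = v1 r" for r using agreeD[OF 8(3)] .
      have g2: "a \<notin> parse_arrs \<Longrightarrow> h2 a = h1 a" for a using agreeD[OF 8(4)] .
      note P = parse_atD[OF 8(2)]
      have len0: "length os0 \<le> card U"
        using card_mono[OF card_U(1) os0U] distinct_card[of os0] P(10) by (simp add: okl_def)
      show ?case
      proof (rule wp_pairs_cmd[of h2 us v2 vs f], goal_cases)
        case (6 t3 v3 h3)
        have f3: "r \<notin> {13, 14, 15, 16, 17, 20, 21, 22} \<Longrightarrow> v3 r = v2 r" for r using agreeD[OF 6(4)] .
        have g3: "a \<notin> {7, 8, 9, 10, 11} \<Longrightarrow> h3 a = h2 a" for a using agreeD[OF 6(5)] .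
        show ?case
        proof (rule wp_hyps[of os0 v3 "rev hs"], goal_cases)
          case 2
          show ?case using P(2) f3 by simp
        next
          case (3 j)
          then show ?case using P(3)[of "j + 1"] g3 by simp
        next
          case (4 t4 v4 h4)
          have f4: "r \<notin> {10, 15, 17, 18, 26} \<Longrightarrow> v4 r = v3 r" for r using agreeD[OF 4(3)] .
          have g4: "a \<notin> {14, 15, 16} \<Longrightarrow> h4 a = h3 a" for a using agreeD[OF 4(4)] .
          have "nodes v4 h4 os0" using P(1) f3 f4 g3 g4 by (simp add: nodes_def)
          moreover have "pairs_at h4 prs" using 6(2) g4 by (simp add: pairs_at_def prs_def)
          moreover have "v4 9 = f" using f4 f3 f2 \<open>v1 9 = _\<close> by (simp add: f_def)
          moreover have "v4 14 = length prs" using f4 6(3) by (simp add: prs_def)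
          ultimately have c4: "cl.common v4 h4 os0" using os0U by (simp add: cl.common_def)
          have cl4: "clauses_at v4 h4 os0 hyp" using 4(2) by (simp add: hyp_def)
          show ?case
          proof (rule cl.wp_closure[OF c4 cl4], goal_cases)
            case (1 t5 v5 h5 zs)
            let ?os = "os0 @ zs"
            let ?cl = "hyp @ concat (map cl.node_clauses ?os)"
            have g5: "a \<notin> work_arrs \<Longrightarrow> h5 a = h4 a" for a using agreeD[OF 1(4)] .
            have o5: "cl.common v5 h5 ?os" "rows h5 prs (length ?os) (v5 28) ?os"
                "clauses_at v5 h5 ?os ?cl"
              using 1(2) by (auto simp: cl.outer_def)
            have n5: "nodes v5 h5 ?os" "set ?os \<subseteq> U" "okl ?os" using o5(1) by (auto simp: cl.common_def nodes_def)
            have h17: "h5 17 = (\<lambda>_. 0)" using g5 g4 g3 g2 g1 by simp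
            have closed: "\<And>ob p. ob \<in> set ?os \<Longrightarrow> p \<in> V \<times> T \<Longrightarrow> osub p ob \<in> set ?os"
            proof -
              fix ob p assume "ob \<in> set ?os" "p \<in> V \<times> T"
              then obtain k d where "k < length ?os" "?os ! k = ob" "d < length prs" "prs ! d = p"
                unfolding prs[symmetric] in_set_conv_nth by blast
              then show "osub p ob \<in> set ?os" using o5(2) unfolding rows_def by blast
            qed
            have "set base \<union> (\<Union>B\<in>S. subs B) \<subseteq> set ?os" unfolding os0[symmetric] by simp
            \<comment> \<open>The finished table itself takes the place of \<open>W\<close>; it
              contains the subobjects of the instance and is closed under children and pairs, so the
              logical characterisation applies to the clauses actually emitted.\<close>
            from entailment_locale[OF n5(3) this n5(2) closed]
            interpret en: entailment L "set hs" Q V T f "set ?os" .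
            have sc: "set ?cl = clauses (set hs) f (V \<times> T) (set ?os)"
              by (rule cl.set_clauses[OF prs]) (simp add: hyp_def)
            show ?case
            proof (rule wp_horn[OF o5(3) n5(3) _ h17], goal_cases)
              case 1
              show ?case using n5(1) by (simp add: nodes_def)
            next
              case (2 t6 v6 h6)
              have g6: "a \<notin> {17} \<Longrightarrow> h6 a = h5 a" for a using agreeD[OF 2(4)] .
              have "Fm Q \<in> set os0" "h2 5 0 = ix os0 (Fm Q)" using P(3)[of 0] by auto
              then have Q6: "Fm Q \<in> set ?os" "h6 5 0 = ix ?os (Fm Q)"
                using g6 g5 g4 g3 by (simp_all add: ix_append)
              show ?case
              proof (rule wp_answer[OF 2(2) Q6 n5(3)], goal_cases)
                case (1 t7 v7)
                have v7: "v7 0 = (if qpl L (set hs) Q then 1 else 0)"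
                  using 1(2) unfolding en.qpl_iff sc by simp
                have "length ?cl \<le> length hs + length ?os * (3 + 2 * length prs)"
                  using cl.length_clauses[of ?os] by (simp add: hyp_def)
                moreover have lo: "length ?os \<le> card U" using cl.length_le[OF o5(1)] .
                then have "length ?os * (3 + 2 * length prs) \<le> card U * (3 + 2 * length prs)"
                  by (rule mult_le_mono1)
                ultimately have lc: "length ?cl \<le> length hs + card U * (3 + 2 * length prs)" by linarith
                have "0 < length os0" using os0 by (auto simp: base_def)
                then have N: "1 \<le> card U" using len0 by linarith
                have lp: "length prs = length vs * (length us + 1)" by (simp add: prs_def algebra_simps)
                have "t1 + (t2 + (t3 + (t4 + (t5 + (t6 + t7))))) \<le> program_time n (card U)"
                proof (rule time_bound[OF hs_le(4) N length_string _ _ hs_le(3) len0 lo lp lc])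
                  show "length vs \<le> 2 * n" "length us \<le> 2 * n" using len hs_le by linarith+
                  show "t5 \<le> (card U + 1) * (31 + (length prs + 1) * (9 * card U + 71)) + 2"
                    using \<open>t5 \<le> _\<close> by (simp only: cl.closure_time_def)
                  show "t6 \<le> (length ?os + 1) * ((length ?cl + 1) * 13 + 3) + 3"
                    using \<open>t6 \<le> _\<close> .
                  show "t4 \<le> (length hs + 1) * 7 + 4" using \<open>t4 \<le> _\<close> by simp
                  show "t2 \<le> length (instance_string hs Q) * (9 * length os0 + 50) + 10"
                    using \<open>t2 \<le> _\<close> by simp
                qed (fact \<open>t1 \<le> _\<close> \<open>t3 \<le> _\<close> \<open>t7 \<le> _\<close>)+
                then show ?case using v7 by simp
              qed
            qed
          qed
        qed (use P(10) in auto)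
      qed (use P f2 3(4) in \<open>auto simp: terms_at_def f_def\<close>)
    qed (use g1 f1 3(2,3) ps in auto)
  qed auto
qed

end

text \<open>Bernoulli's inequality gives \<open>n \<le> 16 * (17 / 16) ^ n\<close>; its fourth power
  bounds \<open>n ^ 4\<close> with the constant 65536 and the ratio \<open>83521 / 65536\<close>.
  The choice of 16 makes this ratio less than \<open>4 / 3\<close>, which is the comparison of
  250563 with 262144.\<close>

lemma nat_pow4_exp: "(n::nat) ^ 4 * 3 ^ n \<le> 65536 * 4 ^ n"
proof -
  have b: "16 ^ n * n \<le> 16 * (17::nat) ^ n" for n
  proof (induction n)
    case (Suc n)
    have "16 ^ n \<le> (17::nat) ^ n" by (rule power_mono) auto
    then show ?case using Suc by (simp add: algebra_simps)
  qed simp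
  have "(16 ^ n * n) ^ 4 \<le> (16 * 17 ^ n) ^ 4" using b[of n] by (rule power_mono) simp
  then have 1: "65536 ^ n * n ^ 4 \<le> 65536 * 83521 ^ n"
    by (simp add: power_mult_distrib power_mult[symmetric] mult.commute[of n 4] power_mult)
  have "65536 ^ n * (n ^ 4 * 3 ^ n) \<le> 65536 * (83521 ^ n * 3 ^ n)"
    using mult_le_mono1[OF 1, of "3 ^ n"] by (simp add: mult.assoc)
  also have "83521 ^ n * 3 ^ n = (250563::nat) ^ n" by (simp flip: power_mult_distrib)
  also have "(250563::nat) ^ n \<le> 262144 ^ n" by (rule power_mono) auto
  also have "(262144::nat) ^ n = 65536 ^ n * 4 ^ n" by (simp flip: power_mult_distrib)
  finally have "65536 ^ n * (n ^ 4 * 3 ^ n) \<le> 65536 ^ n * (65536 * 4 ^ n)" by simp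
  then show ?thesis by simp
qed

text \<open>
  If \<open>q \<le> n / 4\<close> the exponent is at most \<open>n / 2 + 4\<close>; otherwise the base is at most \<open>3 n / 4\<close>, and
  \<open>(3 / 4) ^ n\<close> absorbs the polynomial factor.
\<close>

lemma power_time_bound:
  fixes n q :: nat
  assumes "1 \<le> n" "2 * q < n"
  shows "n ^ 4 * ((n - q) ^ q) ^ 2 \<le> (8 ^ 12 + 65536) * n ^ n"
proof -
  have e: "((n - q) ^ q) ^ 2 = (n - q) ^ (2 * q)" by (simp add: power_mult[symmetric] mult.commute)
  have nn: "1 \<le> n ^ n" using assms(1) by simp
  show ?thesis
  proof (cases "4 * q \<le> n")
    case True
    have "n ^ 4 * (n - q) ^ (2 * q) \<le> n ^ 4 * n ^ (2 * q)" by (intro mult_le_mono2 power_mono) auto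
    also have "\<dots> = n ^ (4 + 2 * q)" by (simp add: power_add)
    also have "\<dots> \<le> 8 ^ 12 * n ^ n"
    proof (cases "8 \<le> n")
      case True
      then have "4 + 2 * q \<le> n" using \<open>4 * q \<le> n\<close> by linarith
      then have "n ^ (4 + 2 * q) \<le> n ^ n" using assms(1) by (intro power_increasing) auto
      then show ?thesis by simp
    next
      \<comment> \<open>For \<open>n < 8\<close> the inequality between the exponents may fail, but
        base and exponent are then bounded by 8 and 12, and the constant absorbs the whole
        power.\<close>
      case False
      have "n ^ (4 + 2 * q) \<le> 8 ^ (4 + 2 * q)" using False by (intro power_mono) auto
      also have "\<dots> \<le> 8 ^ 12" using False assms(2) by (intro power_increasing) auto
      also have "\<dots> \<le> 8 ^ 12 * n ^ n" using nn by simp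
      finally show ?thesis .
    qed
    finally show ?thesis unfolding e by (simp add: algebra_simps)
  next
    case False
    have "(n - q) ^ (2 * q) \<le> (n - q) ^ n" using assms by (intro power_increasing) auto
    then have "4 ^ n * (n - q) ^ (2 * q) \<le> 4 ^ n * (n - q) ^ n" by simp
    also have "\<dots> = (4 * (n - q)) ^ n" by (simp add: power_mult_distrib)
    also have "\<dots> \<le> (3 * n) ^ n" using False by (intro power_mono) auto
    also have "\<dots> = 3 ^ n * n ^ n" by (simp add: power_mult_distrib)
    finally have "n ^ 4 * (4 ^ n * (n - q) ^ (2 * q)) \<le> n ^ 4 * (3 ^ n * n ^ n)" by simp
    also have "\<dots> = (n ^ 4 * 3 ^ n) * n ^ n" by simp
    also have "\<dots> \<le> (65536 * 4 ^ n) * n ^ n" using nat_pow4_exp by (rule mult_le_mono1)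
    finally have "4 ^ n * (n ^ 4 * (n - q) ^ (2 * q)) \<le> 4 ^ n * (65536 * n ^ n)"
      by (simp add: algebra_simps)
    then have "n ^ 4 * (n - q) ^ (2 * q) \<le> 65536 * n ^ n" by simp
    then show ?thesis unfolding e by (simp add: algebra_simps)
  qed
qed

lemma answers_within_mono: "answers_within P w b t \<Longrightarrow> t \<le> t' \<Longrightarrow> answers_within P w b t'"
  unfolding answers_within_def using order_trans by blast

lemma program_answers:
  fixes n q :: nat
  assumes "qpl_instance L hs Q"
  defines "n \<equiv> total_length hs Q" and "q \<equiv> total_quantifications hs Q"
  shows "answers_within (comp 0 program) (encode_instance hs Q) (qpl L (set hs) Q)
      (2160000 * (n ^ 4 * ((n - q) ^ q) ^ 2))" and "2 * q < n"
proof -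
  interpret instance_run L hs Q by unfold_locales (rule assms)
  have n: "n = local.n" by (simp add: assms(2) n_def)
  have a: "answers_within (comp 0 program) (encode_instance hs Q) (qpl L (set hs) Q)
      (12 * program_time local.n (card U))"
    by (rule compile_answers[OF ok_program program_correct])
  have "(card U) ^ 2 \<le> (6 * n * (n - q) ^ q) ^ 2"
    using card_U(2) unfolding n q_def by (rule power_mono) simp
  \<comment> \<open>The constant 2160000 is the product of 12 for the compilation, 5000 for the
    program and \<open>6 ^ 2\<close> for the number of nodes.\<close>
  then have "12 * program_time n (card U) \<le> 12 * (5000 * n ^ 2 * (6 * n * (n - q) ^ q) ^ 2)"
    unfolding program_time_def by simp
  also have "12 * (5000 * n ^ 2 * (6 * n * (n - q) ^ q) ^ 2) = 2160000 * ((n ^ 2 * n ^ 2) * ((n - q) ^ q) ^ 2)"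
    unfolding power_mult_distrib by simp
  also have "n ^ 2 * n ^ 2 = n ^ 4" by (simp flip: power_add)
  finally have "12 * program_time n (card U) \<le> 2160000 * (n ^ 4 * ((n - q) ^ q) ^ 2)" .
  with a show "answers_within (comp 0 program) (encode_instance hs Q) (qpl L (set hs) Q)
      (2160000 * (n ^ 4 * ((n - q) ^ q) ^ 2))" unfolding n by (rule answers_within_mono)
  show "2 * q < n" using quantifications_less unfolding n q_def .
qed

theorem theorem8p2:
  fixes L :: lang
  shows "(\<exists>P T. (\<lambda>n. real (T n)) \<in> O(\<lambda>n. real n ^ n)
            \<and> solves_entailment L (\<lambda>hs Q. True) P T)
       \<and> (\<forall>k. \<exists>P T d. (\<lambda>n. real (T n)) \<in> O(\<lambda>n. real n ^ d)
            \<and> solves_entailment L (\<lambda>hs Q. total_quantifications hs Q \<le> k) P T)"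
proof (intro HOL.conjI HOL.allI)
  define c :: nat where "c = 2160000 * (8 ^ 12 + 65536)"
  have "(\<lambda>n. real (c * n ^ n)) \<in> O(\<lambda>n. real n ^ n)"
    by (intro bigoI[where c = "real c"]) (simp add: eventually_at_top_linorder)
  moreover have "solves_entailment L (\<lambda>hs Q. True) (comp 0 program) (\<lambda>n. c * n ^ n)"
    unfolding solves_entailment_def
  proof (intro HOL.allI HOL.impI)
    fix hs Q assume i: "qpl_instance L hs Q"
    let ?n = "total_length hs Q" and ?q = "total_quantifications hs Q"
    have q: "2 * ?q < ?n" using program_answers(2)[OF i] .
    then have "2160000 * (?n ^ 4 * ((?n - ?q) ^ ?q) ^ 2) \<le> c * ?n ^ ?n"
      unfolding c_def mult.assoc by (intro mult_le_mono2 power_time_bound) auto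
    then show "answers_within (comp 0 program) (encode_instance hs Q) (qpl L (set hs) Q) (c * ?n ^ ?n)"
      using program_answers(1)[OF i] answers_within_mono by blast
  qed
  ultimately show "\<exists>P T. (\<lambda>n. real (T n)) \<in> O(\<lambda>n. real n ^ n) \<and> solves_entailment L (\<lambda>hs Q. True) P T"
    by (intro HOL.exI HOL.conjI)
next
  fix k :: nat
  \<comment> \<open>The same machine is used for every \<open>k\<close>; the restriction only enters
    the estimate. The squared number of nodes contributes \<open>n ^ (2 * k)\<close>.\<close>
  let ?T = "\<lambda>n::nat. 2160000 * n ^ (4 + 2 * k)"
  have "(\<lambda>n. real (?T n)) \<in> O(\<lambda>n. real n ^ (4 + 2 * k))"
    by (intro bigoI[where c = 2160000]) (simp add: eventually_at_top_linorder)
  moreover have "solves_entailment L (\<lambda>hs Q. total_quantifications hs Q \<le> k) (comp 0 program) ?T"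
    unfolding solves_entailment_def
  proof (intro HOL.allI HOL.impI)
    fix hs Q assume i: "qpl_instance L hs Q" and k: "total_quantifications hs Q \<le> k"
    let ?n = "total_length hs Q" and ?q = "total_quantifications hs Q"
    have q: "2 * ?q < ?n" using program_answers(2)[OF i] .
    have "(?n - ?q) ^ ?q \<le> ?n ^ ?q" by (intro power_mono) auto
    also have "\<dots> \<le> ?n ^ k" using q k by (intro power_increasing) auto
    finally have "?n ^ 4 * ((?n - ?q) ^ ?q) ^ 2 \<le> ?n ^ 4 * (?n ^ k) ^ 2"
      by (intro mult_le_mono2 power_mono) auto
    then have "2160000 * (?n ^ 4 * ((?n - ?q) ^ ?q) ^ 2) \<le> ?T ?n"
      by (simp add: power_add power_mult[symmetric] mult.commute)
    then show "answers_within (comp 0 program) (encode_instance hs Q) (qpl L (set hs) Q) (?T ?n)"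
      using program_answers(1)[OF i] answers_within_mono by blast
  qed
  ultimately show "\<exists>P T d. (\<lambda>n. real (T n)) \<in> O(\<lambda>n. real n ^ d)
      \<and> solves_entailment L (\<lambda>hs Q. total_quantifications hs Q \<le> k) P T"
    by (intro HOL.exI HOL.conjI)
qed

end
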